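(* Let $\mathcal{B}=\bigoplus_{j=0}^{r-1}M_{m_j}(\mathbb{C})\subset\mathcal{A}=\bigoplus_{i=0}^{s-1}M_{n_i}(\mathbb{C})$ be a unital inclusion of finite-dimensional von Neumann algebras with inclusion matrix $A=[a_{ij}]_{0\le i\le s-1,\,0\le j\le r-1}$, and for each $i$ let $Y_i=\{j: a_{ij}\neq 0\}$ be the support of the $i$-th row of $A$. Then the inclusion $\mathcal{B}\subset\mathcal{A}$ is regular if and only if both of the following hold: (1) the inclusion matrix $A$ is a normalizer matrix; (2) for each $i\in\{0,1,\ldots,s-1\}$, all the summands $M_{m_j}(\mathbb{C})$ with $j\in Y_i$ have the same dimension (i.e. $m_j=m_{j'}$ for all $j,j'\in Y_i$). As a consequence, any regular inclusion is isomorphic to one obtained by finite tensor products and finite direct sums from inclusions of the forms $M_k(\mathbb{C})\subset M_k(\mathbb{C})$, $\mathbb{C}\subset\bigoplus_{i=0}^{v-1}M_{l_i}(\mathbb{C})$ and $\mathbb{C}^t\subset M_t(\mathbb{C})$ (the last being the diagonal inclusion).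
   Context: All inclusions are unital inclusions of finite-dimensional von Neumann algebras (finite direct sums of full matrix algebras over $\mathbb{C}$). The inclusion matrix of $\mathcal{B}\subset\mathcal{A}$ is the $s\times r$ matrix $A=[a_{ij}]$ of nonnegative integers where $a_{ij}$ is the number of times the summand $M_{m_j}$ of $\mathcal{B}$ appears in the summand $M_{n_i}$ of $\mathcal{A}$; that is, up to isomorphism the inclusion is $$\bigoplus_{j}X_j\mapsto\bigoplus_{i}\text{block-diag}(X_0\otimes\mathbf{1}_{a_{i0}},\ldots,X_{r-1}\otimes\mathbf{1}_{a_{i,r-1}}),$$ so that $\sum_j a_{ij}m_j=n_i$ for every $i$. The normalizer is $\mathcal{N}_{\mathcal{A}}(\mathcal{B})=\{U\in\mathcal{A}\text{ unitary}: U\mathcal{B}U^*=\mathcal{B}\}$, and the inclusion is regular if the linear span of $\mathcal{N}_{\mathcal{A}}(\mathcal{B})$ equals $\mathcal{A}$. A matrix is irredundant if none of its rows or columns is zero. An irredundant matrix $A=[a_{ij}]$ is a normalizer matrix if (a) in each row of $A$ all nonzero entries are equal, and (b) any two row supports $Y_i,Y_k$ are either equal or disjoint. Two inclusions $\mathcal{B}_1\subset\mathcal{A}_1$ and $\mathcal{B}_2\subset\mathcal{A}_2$ are isomorphic if there is a $*$-isomorphism $\theta:\mathcal{A}_1\to\mathcal{A}_2$ with $\theta(\mathcal{B}_1)=\mathcal{B}_2$. The direct sum and tensor product of the inclusions $\mathcal{B}_1\subset\mathcal{A}_1$, $\mathcal{B}_2\subset\mathcal{A}_2$ are $\mathcal{B}_1\oplus\mathcal{B}_2\subset\mathcal{A}_1\oplus\mathcal{A}_2$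 and $\mathcal{B}_1\otimes\mathcal{B}_2\subset\mathcal{A}_1\otimes\mathcal{A}_2$. *)

theory Defs
  imports
    "Jordan_Normal_Form.Schur_Decomposition"
    "Jordan_Normal_Form.VS_Connect"
begin

text \<open>Algebras are sets of complex \<open>N \<times> N\<close> matrices, i.e. algebras of operators on \<open>\<complex>\<^sup>N\<close>.
  Where a size \<open>N\<close> occurs as an argument, it is the dimension of this ambient space.\<close>

abbreviation mat_span :: "nat \<Rightarrow> complex mat set \<Rightarrow> complex mat set" where
  "mat_span N S \<equiv> LinearCombinations.module.span class_ring (module_mat TYPE(complex) N N) S"

definition unital_star_subalgebra :: "nat \<Rightarrow> complex mat set \<Rightarrow> bool" where
  "unital_star_subalgebra N A \<longleftrightarrow>
     A \<subseteq> carrier_mat N N \<and> 1\<^sub>m N \<in> A \<and>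
     (\<forall>X\<in>A. \<forall>Y\<in>A. X + Y \<in> A \<and> X * Y \<in> A) \<and>
     (\<forall>c. \<forall>X\<in>A. c \<cdot>\<^sub>m X \<in> A) \<and>
     (\<forall>X\<in>A. mat_adjoint X \<in> A)"

definition star_iso ::
  "(complex mat \<Rightarrow> complex mat) \<Rightarrow> complex mat set \<Rightarrow> complex mat set \<Rightarrow> bool" where
  "star_iso \<theta> A1 A2 \<longleftrightarrow>
     bij_betw \<theta> A1 A2 \<and>
     (\<forall>X\<in>A1. \<forall>Y\<in>A1. \<theta> (X + Y) = \<theta> X + \<theta> Y \<and> \<theta> (X * Y) = \<theta> X * \<theta> Y) \<and>
     (\<forall>c. \<forall>X\<in>A1. \<theta> (c \<cdot>\<^sub>m X) = c \<cdot>\<^sub>m \<theta> X) \<and>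
     (\<forall>X\<in>A1. \<theta> (mat_adjoint X) = mat_adjoint (\<theta> X))"

text \<open>The direct sum of the full matrix algebras of sizes \<open>n 0, \<dots>, n (s - 1)\<close>, realized as the
  block diagonal matrices in the full matrix algebra of size \<open>n 0 + \<dots> + n (s - 1)\<close>.\<close>

definition summands :: "nat \<Rightarrow> (nat \<Rightarrow> nat) \<Rightarrow> (nat \<Rightarrow> complex mat) set" where
  "summands s n = {X. \<forall>i<s. X i \<in> carrier_mat (n i) (n i)}"

definition block_diag :: "nat \<Rightarrow> (nat \<Rightarrow> complex mat) \<Rightarrow> complex mat" where
  "block_diag s X = diag_block_mat (map X [0..<s])"

definition block_alg :: "nat \<Rightarrow> (nat \<Rightarrow> nat) \<Rightarrow> complex mat set" where
  "block_alg s n = block_diag s ` summands s n"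

definition fd_von_neumann_algebra :: "nat \<Rightarrow> complex mat set \<Rightarrow> bool" where
  "fd_von_neumann_algebra N A \<longleftrightarrow>
     unital_star_subalgebra N A \<and>
     (\<exists>s n \<theta>. 0 < s \<and> (\<forall>i<s. 0 < n i) \<and> star_iso \<theta> A (block_alg s n))"

text \<open>Both algebras contain the identity matrix of size \<open>N\<close>, so the inclusion is unital.\<close>

definition unital_inclusion :: "nat \<Rightarrow> complex mat set \<Rightarrow> complex mat set \<Rightarrow> bool" where
  "unital_inclusion N B A \<longleftrightarrow>
     fd_von_neumann_algebra N A \<and> fd_von_neumann_algebra N B \<and> B \<subseteq> A"

definition inclusion_iso ::
  "complex mat set \<Rightarrow> complex mat set \<Rightarrow> complex mat set \<Rightarrow> complex mat set \<Rightarrow> bool" where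
  "inclusion_iso B1 A1 B2 A2 \<longleftrightarrow> (\<exists>\<theta>. star_iso \<theta> A1 A2 \<and> \<theta> ` B1 = B2)"

definition normalizer :: "nat \<Rightarrow> complex mat set \<Rightarrow> complex mat set \<Rightarrow> complex mat set" where
  "normalizer N B A =
     {U \<in> A. U * mat_adjoint U = 1\<^sub>m N \<and> mat_adjoint U * U = 1\<^sub>m N \<and>
             (\<lambda>X. U * X * mat_adjoint U) ` B = B}"

definition regular_inclusion :: "nat \<Rightarrow> complex mat set \<Rightarrow> complex mat set \<Rightarrow> bool" where
  "regular_inclusion N B A \<longleftrightarrow> mat_span N (normalizer N B A) = A"

definition kron :: "complex mat \<Rightarrow> complex mat \<Rightarrow> complex mat" where
  "kron X Y = mat (dim_row X * dim_row Y) (dim_col X * dim_col Y)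
     (\<lambda>(i, j). X $$ (i div dim_row Y, j div dim_col Y) * Y $$ (i mod dim_row Y, j mod dim_col Y))"

text \<open>The \<open>i\<close>-th block of the image of \<open>X\<close> is the block diagonal matrix with blocks
  \<open>X j \<otimes> 1\<close>, where the identity has size \<open>a $$ (i, j)\<close>; blocks with \<open>a $$ (i, j) = 0\<close> are empty.\<close>

definition standard_embedding ::
  "nat \<Rightarrow> nat \<Rightarrow> nat mat \<Rightarrow> (nat \<Rightarrow> complex mat) \<Rightarrow> complex mat" where
  "standard_embedding s r a X =
     block_diag s (\<lambda>i. block_diag r (\<lambda>j. kron (X j) (1\<^sub>m (a $$ (i, j)))))"

text \<open>\<open>B \<subseteq> A\<close> has inclusion matrix \<open>a\<close> with respect to identifications of \<open>A\<close> and \<open>B\<close> with direct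
  sums of full matrix algebras of sizes \<open>n i\<close> (\<open>i < s\<close>) and \<open>m j\<close> (\<open>j < r\<close>). The isomorphism \<open>\<phi>\<close>
  identifies the summands of \<open>B\<close>, so that the columns of \<open>a\<close> are matched with the sizes \<open>m j\<close>;
  in particular \<open>a\<close> can have no zero column, since \<open>\<theta> \<circ> \<phi>\<close> is injective.\<close>

definition has_inclusion_matrix ::
  "complex mat set \<Rightarrow> complex mat set \<Rightarrow>
   nat \<Rightarrow> (nat \<Rightarrow> nat) \<Rightarrow> nat \<Rightarrow> (nat \<Rightarrow> nat) \<Rightarrow> nat mat \<Rightarrow> bool" where
  "has_inclusion_matrix B A r m s n a \<longleftrightarrow>
     0 < r \<and> 0 < s \<and> (\<forall>j<r. 0 < m j) \<and> (\<forall>i<s. 0 < n i) \<and>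
     a \<in> carrier_mat s r \<and> (\<forall>i<s. (\<Sum>j<r. a $$ (i, j) * m j) = n i) \<and>
     (\<exists>\<theta> \<phi>. star_iso \<theta> A (block_alg s n) \<and> star_iso \<phi> (block_alg r m) B \<and>
        (\<forall>X\<in>summands r m. \<theta> (\<phi> (block_diag r X)) = standard_embedding s r a X))"

definition irredundant :: "nat mat \<Rightarrow> bool" where
  "irredundant a \<longleftrightarrow>
     (\<forall>i<dim_row a. \<exists>j<dim_col a. a $$ (i, j) \<noteq> 0) \<and>
     (\<forall>j<dim_col a. \<exists>i<dim_row a. a $$ (i, j) \<noteq> 0)"

definition row_support :: "nat mat \<Rightarrow> nat \<Rightarrow> nat set" where
  "row_support a i = {j. j < dim_col a \<and> a $$ (i, j) \<noteq> 0}"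

definition normalizer_matrix :: "nat mat \<Rightarrow> bool" where
  "normalizer_matrix a \<longleftrightarrow>
     irredundant a \<and>
     (\<forall>i<dim_row a. \<forall>j\<in>row_support a i. \<forall>j'\<in>row_support a i. a $$ (i, j) = a $$ (i, j')) \<and>
     (\<forall>i<dim_row a. \<forall>k<dim_row a.
        row_support a i = row_support a k \<or> row_support a i \<inter> row_support a k = {})"

definition alg_sum :: "complex mat set \<Rightarrow> complex mat set \<Rightarrow> complex mat set" where
  "alg_sum A1 A2 = {diag_block_mat [X, Y] | X Y. X \<in> A1 \<and> Y \<in> A2}"

definition alg_tensor ::
  "nat \<Rightarrow> complex mat set \<Rightarrow> nat \<Rightarrow> complex mat set \<Rightarrow> complex mat set" where
  "alg_tensor N1 A1 N2 A2 = mat_span (N1 * N2) {kron X Y | X Y. X \<in> A1 \<and> Y \<in> A2}"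

inductive generated_inclusion :: "nat \<Rightarrow> complex mat set \<Rightarrow> complex mat set \<Rightarrow> bool" where
  full: "0 < k \<Longrightarrow> generated_inclusion k (carrier_mat k k) (carrier_mat k k)"
| scalars: "0 < v \<Longrightarrow> \<forall>i<v. 0 < l i \<Longrightarrow> N = (\<Sum>i<v. l i) \<Longrightarrow>
    generated_inclusion N (range (\<lambda>c. c \<cdot>\<^sub>m 1\<^sub>m N)) (block_alg v l)"
| diagonal: "0 < t \<Longrightarrow>
    generated_inclusion t {D \<in> carrier_mat t t. diagonal_mat D} (carrier_mat t t)"
| direct_sum: "generated_inclusion N1 B1 A1 \<Longrightarrow> generated_inclusion N2 B2 A2 \<Longrightarrow>
    generated_inclusion (N1 + N2) (alg_sum B1 B2) (alg_sum A1 A2)"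
| tensor: "generated_inclusion N1 B1 A1 \<Longrightarrow> generated_inclusion N2 B2 A2 \<Longrightarrow>
    generated_inclusion (N1 * N2) (alg_tensor N1 B1 N2 B2) (alg_tensor N1 A1 N2 A2)"

end

theory Submission
  imports Defs "HOL-Combinatorics.Transposition"
begin

text \<open>Put the inclusion in coordinates: index the basis of the ambient space by tuples
  \<open>(k, l, y, p)\<close> with \<open>k\<close> a summand of \<open>A\<close>, \<open>l\<close> a summand of \<open>B\<close>, \<open>y < m l\<close> and \<open>p < a k l\<close>. Then \<open>A\<close>
  consists of the matrices that respect \<open>k\<close>, and \<open>B\<close> of those acting on \<open>y\<close> alone, by a matrix that
  depends only on \<open>l\<close>. Every unital inclusion has this form, by diagonalizing a system of matrix units.

  A normalizing unitary permutes the minimal central projections of \<open>B\<close>. If two columns \<open>j\<close>, \<open>j'\<close> meet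
  in a row, the matrix unit of \<open>A\<close> linking them lies in the span of the normalizer, so some normalizing
  unitary moves the \<open>j\<close>-th central projection to the \<open>j'\<close>-th; comparing traces inside each
  summand of \<open>A\<close> shows that the columns and the sizes \<open>m j\<close>, \<open>m j'\<close> agree. Conversely, if columns that meet
  are interchangeable, the signed permutations swapping two of them normalize \<open>B\<close>, and four of them
  combine to each matrix unit of \<open>A\<close>. In that case the columns fall into classes, and the class with
  size \<open>\<mu>\<close>, \<open>t\<close> columns and multiplicities \<open>c\<^sub>k\<close> is the tensor product of \<open>M\<^sub>\<mu> \<subseteq> M\<^sub>\<mu>\<close>,
  \<open>\<complex>\<^sup>t \<subseteq> M\<^sub>t\<close> and \<open>\<complex> \<subseteq> \<Oplus>\<^sub>k M\<close> of size \<open>c\<^sub>k\<close>.\<close>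

section \<open>Matrices, spans and star-isomorphisms\<close>

text \<open>Both conditions of the theorem speak about rows, whereas a normalizing unitary compares
  columns. They are therefore merged into one condition on pairs of columns,
  \<open>interchangeable_columns\<close>, and regularity is shown equivalent to that. Traces can be
  compared block by block because a unitary of \<open>A\<close> commutes with the central
  projections of \<open>A\<close>. A minimal projection of the \<open>j\<close>-th summand goes to
  one of some rank \<open>t\<close> in the \<open>j'\<close>-th, so column \<open>j\<close> is
  \<open>t\<close> times column \<open>j'\<close>. That the columns are equal follows only with the
  adjoint unitary, which bounds them the other way round; the sizes come after that. Four signed
  permutations appear because no single sign pattern isolates a coordinate: a sign taken from
  \<open>B\<close> repeats in every copy of its summand, one taken from the commutant repeats along
  all \<open>(l, y)\<close>. The two sets of sign changes meet in one coordinate. An inclusion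
  matrix comes with isomorphisms that already give the standard form. The diagonalization serves the
  structural consequence, where no matrix is given.\<close>

lemma square_mult_carrier:
  "X \<in> carrier_mat N N \<Longrightarrow> Y \<in> carrier_mat N N \<Longrightarrow> X * Y \<in> carrier_mat N N"
  by simp

lemma square_mult_assoc:
  fixes X Y Z :: "'a::semiring_0 mat"
  assumes "X \<in> carrier_mat N N" "Y \<in> carrier_mat N N" "Z \<in> carrier_mat N N"
  shows "X * Y * Z = X * (Y * Z)"
  using assms by (rule assoc_mult_mat)

lemma square_mult_one:
  fixes X :: "'a::semiring_1 mat"
  assumes "X \<in> carrier_mat N N"
  shows "X * 1\<^sub>m N = X" "1\<^sub>m N * X = X"
  using assms by auto

lemma square_mult_zero:
  fixes X :: "'a::semiring_0 mat"
  assumes "X \<in> carrier_mat N N"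
  shows "X * 0\<^sub>m N N = 0\<^sub>m N N" "0\<^sub>m N N * X = 0\<^sub>m N N"
  using assms by auto

text \<open>In the associativity rule \<open>N\<close> occurs only in the premises; the collection
  is used for rewriting with \<open>N\<close> instantiated.\<close>

lemmas square_mat_simps = square_mult_carrier square_mult_assoc square_mult_one square_mult_zero

lemma mat_adjoint_carrier [simp]: "X \<in> carrier_mat n k \<Longrightarrow> mat_adjoint X \<in> carrier_mat k n"
  by (auto simp: mat_adjoint_def)

lemma mat_adjoint_dim [simp]:
  "dim_row (mat_adjoint X) = dim_col X" "dim_col (mat_adjoint X) = dim_row X"
  by (auto simp: mat_adjoint_def)

lemma mat_adjoint_index [simp]:
  fixes X :: "complex mat"
  assumes "i < dim_col X" "j < dim_row X"
  shows "mat_adjoint X $$ (i, j) = cnj (X $$ (j, i))"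
  using assms by (simp add: mat_adjoint_def mat_of_rows_index conjugate_vec_def)

lemma mat_mult_index:
  fixes X :: "'a::semiring_0 mat"
  assumes "X \<in> carrier_mat n k" "Y \<in> carrier_mat k p" "i < n" "j < p"
  shows "(X * Y) $$ (i, j) = (\<Sum>q<k. X $$ (i, q) * Y $$ (q, j))"
  using assms by (auto simp: scalar_prod_def lessThan_atLeast0)

lemma mat_adjoint_adjoint [simp]:
  fixes X :: "complex mat"
  shows "mat_adjoint (mat_adjoint X) = X"
  by (rule eq_matI) auto

lemma mat_adjoint_mult:
  fixes X :: "complex mat"
  assumes X: "X \<in> carrier_mat n k" and Y: "Y \<in> carrier_mat k p"
  shows "mat_adjoint (X * Y) = mat_adjoint Y * mat_adjoint X"
proof (rule eq_matI)
  fix i j assume "i < dim_row (mat_adjoint Y * mat_adjoint X)" "j < dim_col (mat_adjoint Y * mat_adjoint X)"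
  then have ij: "i < p" "j < n" using assms by auto
  have "mat_adjoint (X * Y) $$ (i, j) = cnj (\<Sum>q<k. X $$ (j, q) * Y $$ (q, i))"
    using ij assms by (simp add: mat_mult_index[OF X Y] del: index_mult_mat(1))
  also have "\<dots> = (mat_adjoint Y * mat_adjoint X) $$ (i, j)"
    unfolding mat_mult_index[OF mat_adjoint_carrier[OF Y] mat_adjoint_carrier[OF X] ij]
    using ij assms by (auto simp: mult.commute intro!: sum.cong)
  finally show "mat_adjoint (X * Y) $$ (i, j) = (mat_adjoint Y * mat_adjoint X) $$ (i, j)" .
qed (use assms in auto)

definition mat_trace :: "complex mat \<Rightarrow> complex" where
  "mat_trace X = (\<Sum>i<dim_row X. X $$ (i, i))"

lemma mat_trace_commute:
  assumes "X \<in> carrier_mat n k" "Y \<in> carrier_mat k n"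
  shows "mat_trace (X * Y) = mat_trace (Y * X)"
proof -
  have "mat_trace (X * Y) = (\<Sum>i<n. \<Sum>q<k. X $$ (i, q) * Y $$ (q, i))"
    using assms by (auto simp: mat_trace_def mat_mult_index[OF assms] simp del: index_mult_mat(1) intro!: sum.cong)
  also have "\<dots> = (\<Sum>q<k. \<Sum>i<n. Y $$ (q, i) * X $$ (i, q))"
    by (subst sum.swap) (simp add: mult.commute)
  also have "\<dots> = mat_trace (Y * X)"
    using assms by (auto simp: mat_trace_def mat_mult_index[OF assms(2,1)] simp del: index_mult_mat(1) intro!: sum.cong)
  finally show ?thesis .
qed

section \<open>Linear subspaces of square matrices and spans\<close>

definition mat_subspace :: "nat \<Rightarrow> complex mat set \<Rightarrow> bool" where
  "mat_subspace N V \<longleftrightarrow> V \<subseteq> carrier_mat N N \<and> 0\<^sub>m N N \<in> V \<and>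
     (\<forall>X\<in>V. \<forall>Y\<in>V. X + Y \<in> V) \<and> (\<forall>c. \<forall>X\<in>V. c \<cdot>\<^sub>m X \<in> V)"

lemma mat_subspace_iff_submodule:
  "mat_subspace N V \<longleftrightarrow> LinearCombinations.submodule class_ring V (module_mat TYPE(complex) N N)"
proof -
  interpret vectorspace class_ring "module_mat TYPE(complex) N N" by (rule matrix_vs)
  have m: "Module.module class_ring (module_mat TYPE(complex) N N)" ..
  show ?thesis
    unfolding mat_subspace_def LinearCombinations.submodule_def using m
    by (auto simp: matrix_vs_simps)
qed

lemma mat_span_subspace:
  assumes "S \<subseteq> carrier_mat N N"
  shows "mat_subspace N (mat_span N S)"
proof -
  interpret vectorspace class_ring "module_mat TYPE(complex) N N" by (rule matrix_vs)
  show ?thesis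
    unfolding mat_subspace_iff_submodule
    by (rule span_is_submodule) (use assms in \<open>auto simp: matrix_vs_simps\<close>)
qed

lemma mat_span_superset:
  assumes "S \<subseteq> carrier_mat N N"
  shows "S \<subseteq> mat_span N S"
proof -
  interpret vectorspace class_ring "module_mat TYPE(complex) N N" by (rule matrix_vs)
  show ?thesis by (rule in_own_span) (use assms in \<open>auto simp: matrix_vs_simps\<close>)
qed

lemma mat_span_minimal:
  assumes "mat_subspace N V" "S \<subseteq> V"
  shows "mat_span N S \<subseteq> V"
proof -
  interpret vectorspace class_ring "module_mat TYPE(complex) N N" by (rule matrix_vs)
  show ?thesis by (rule span_is_subset) (use assms in \<open>auto simp: mat_subspace_iff_submodule\<close>)
qed

lemma mat_subspaceD:
  assumes "mat_subspace N V"
  shows "V \<subseteq> carrier_mat N N" "0\<^sub>m N N \<in> V"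
    "X \<in> V \<Longrightarrow> Y \<in> V \<Longrightarrow> X + Y \<in> V" "X \<in> V \<Longrightarrow> c \<cdot>\<^sub>m X \<in> V"
  using assms by (auto simp: mat_subspace_def)

text \<open>Matrices of all sizes share one type and have no common zero, so the linear combination
  is formed entry by entry.\<close>

lemma mat_subspace_sum:
  assumes V: "mat_subspace N V" and "finite I" "\<And>i. i \<in> I \<Longrightarrow> M i \<in> V"
  shows "mat N N (\<lambda>p. \<Sum>i\<in>I. x i * M i $$ p) \<in> V"
  using assms(2,3)
proof (induction I)
  case empty
  have "mat N N (\<lambda>p. \<Sum>i\<in>{}. x i * M i $$ p) = 0\<^sub>m N N" by (rule eq_matI) auto
  then show ?case using mat_subspaceD[OF V] by simp
next
  case (insert j I)
  have M: "M i \<in> carrier_mat N N" if "i \<in> insert j I" for i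
    using insert.prems that mat_subspaceD(1)[OF V] by blast
  have "mat N N (\<lambda>p. \<Sum>i\<in>insert j I. x i * M i $$ p)
      = x j \<cdot>\<^sub>m M j + mat N N (\<lambda>p. \<Sum>i\<in>I. x i * M i $$ p)"
    using M[of j] insert.hyps by (intro eq_matI) auto
  then show ?case using insert mat_subspaceD[OF V] by simp
qed

lemma unital_star_subalgebraD:
  assumes "unital_star_subalgebra N A"
  shows "A \<subseteq> carrier_mat N N" "X \<in> A \<Longrightarrow> X \<in> carrier_mat N N" "1\<^sub>m N \<in> A"
    "X \<in> A \<Longrightarrow> Y \<in> A \<Longrightarrow> X + Y \<in> A" "X \<in> A \<Longrightarrow> Y \<in> A \<Longrightarrow> X * Y \<in> A"
    "X \<in> A \<Longrightarrow> c \<cdot>\<^sub>m X \<in> A" "X \<in> A \<Longrightarrow> mat_adjoint X \<in> A"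
  using assms by (auto simp: unital_star_subalgebra_def)

lemma unital_star_subalgebra_subspace:
  assumes "unital_star_subalgebra N A"
  shows "mat_subspace N A"
proof -
  note a = unital_star_subalgebraD[OF assms]
  have "0 \<cdot>\<^sub>m 1\<^sub>m N = (0\<^sub>m N N :: complex mat)" by (rule eq_matI) auto
  then have "0\<^sub>m N N \<in> A" using a(6)[OF a(3), of 0] by simp
  then show ?thesis using a by (auto simp: mat_subspace_def)
qed

section \<open>Star-isomorphisms and the invariance of regularity\<close>

lemma star_isoD:
  assumes "star_iso \<theta> A A'"
  shows "bij_betw \<theta> A A'" "X \<in> A \<Longrightarrow> \<theta> X \<in> A'"
    "X \<in> A \<Longrightarrow> Y \<in> A \<Longrightarrow> \<theta> (X + Y) = \<theta> X + \<theta> Y"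
    "X \<in> A \<Longrightarrow> Y \<in> A \<Longrightarrow> \<theta> (X * Y) = \<theta> X * \<theta> Y"
    "X \<in> A \<Longrightarrow> \<theta> (c \<cdot>\<^sub>m X) = c \<cdot>\<^sub>m \<theta> X"
    "X \<in> A \<Longrightarrow> \<theta> (mat_adjoint X) = mat_adjoint (\<theta> X)"
  using assms by (auto simp: star_iso_def bij_betw_def)

lemma star_iso_trans:
  assumes 1: "star_iso \<theta> A A'" and 2: "star_iso \<theta>' A' A''"
  shows "star_iso (\<theta>' \<circ> \<theta>) A A''"
  using bij_betw_trans[OF star_isoD(1)[OF 1] star_isoD(1)[OF 2]]
    star_isoD(2-)[OF 1] star_isoD(2-)[OF 2]
  by (simp add: star_iso_def)

lemma star_iso_inv:
  assumes i: "star_iso \<theta> A A'" and A: "unital_star_subalgebra N A"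
  shows "star_iso (inv_into A \<theta>) A' A"
proof -
  note t = star_isoD[OF i] and a = unital_star_subalgebraD[OF A]
  let ?g = "inv_into A \<theta>"
  have inj: "inj_on \<theta> A" and im: "\<theta> ` A = A'" using t(1) by (auto simp: bij_betw_def)
  have g: "?g X \<in> A" "\<theta> (?g X) = X" if "X \<in> A'" for X
    using that im by (auto simp: inv_into_into f_inv_into_f)
  have gt: "?g (\<theta> X) = X" if "X \<in> A" for X using that inj by simp
  show ?thesis unfolding star_iso_def
  proof (intro conjI ballI allI)
    show "bij_betw ?g A' A" using t(1) by (rule bij_betw_inv_into)
    fix X Y assume XY: "X \<in> A'" "Y \<in> A'"
    show "?g (X + Y) = ?g X + ?g Y" "?g (X * Y) = ?g X * ?g Y"
      using gt[of "?g X + ?g Y"] gt[of "?g X * ?g Y"] a t g XY by auto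
  next
    fix X c assume X: "X \<in> A'"
    show "?g (c \<cdot>\<^sub>m X) = c \<cdot>\<^sub>m ?g X" using gt[of "c \<cdot>\<^sub>m ?g X"] a t g X by auto
  next
    fix X assume X: "X \<in> A'"
    show "?g (mat_adjoint X) = mat_adjoint (?g X)"
      using gt[of "mat_adjoint (?g X)"] a t g X by auto
  qed
qed

text \<open>Units are not mentioned in \<open>star_iso\<close>; surjectivity supplies them: if
  \<theta> maps \<open>X\<close> to the unit, then \<theta>(1) = \<theta>(1) \<theta>(X) =
  \<theta>(X).\<close>

lemma star_iso_one:
  assumes i: "star_iso \<theta> A A'" and A: "unital_star_subalgebra N A" and A': "unital_star_subalgebra N' A'"
  shows "\<theta> (1\<^sub>m N) = 1\<^sub>m N'"
proof -
  note t = star_isoD[OF i] and a = unital_star_subalgebraD[OF A] and a' = unital_star_subalgebraD[OF A']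
  obtain X where X: "X \<in> A" "\<theta> X = 1\<^sub>m N'" using t(1) a'(3) by (auto simp: bij_betw_def)
  have "\<theta> (1\<^sub>m N) = \<theta> (1\<^sub>m N) * \<theta> X" using a'(2)[OF t(2)[OF a(3)]] X(2) by simp
  also have "\<dots> = \<theta> (1\<^sub>m N * X)" using t(4)[OF a(3) X(1)] by simp
  also have "\<dots> = 1\<^sub>m N'" using a(2)[OF X(1)] X(2) by simp
  finally show ?thesis .
qed

text \<open>The elements of \<open>A\<close> whose image lies in the span of the target normalizer
  form a subspace. It contains the normalizer of \<open>B\<close>, hence by regularity all of
  \<open>A\<close>.\<close>

lemma regular_inclusion_star_iso:
  assumes i: "star_iso \<theta> A A'" and A: "unital_star_subalgebra N A" and A': "unital_star_subalgebra N' A'"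
    and BA: "B \<subseteq> A" and reg: "regular_inclusion N B A"
  shows "regular_inclusion N' (\<theta> ` B) A'"
proof -
  note t = star_isoD[OF i] and a = unital_star_subalgebraD[OF A] and a' = unital_star_subalgebraD[OF A']
  note one = star_iso_one[OF i A A']
  let ?N = "normalizer N B A" and ?N' = "normalizer N' (\<theta> ` B) A'"
  have sub: "?N' \<subseteq> A'" by (auto simp: normalizer_def)
  have subc: "?N' \<subseteq> carrier_mat N' N'" using sub a'(1) by blast
  note sp = mat_span_subspace[OF subc]
  have U: "\<theta> U \<in> ?N'" if "U \<in> ?N" for U
  proof -
    have UA: "U \<in> A" and UU: "U * mat_adjoint U = 1\<^sub>m N" "mat_adjoint U * U = 1\<^sub>m N"
      and UB: "(\<lambda>X. U * X * mat_adjoint U) ` B = B" using that by (auto simp: normalizer_def)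
    have conj: "\<theta> (U * X * mat_adjoint U) = \<theta> U * \<theta> X * mat_adjoint (\<theta> U)" if "X \<in> B" for X
      using that BA UA a t by (metis subsetD)
    have "(\<lambda>X. \<theta> U * X * mat_adjoint (\<theta> U)) ` \<theta> ` B = \<theta> ` (\<lambda>X. U * X * mat_adjoint U) ` B"
      using conj by (force simp: image_image)
    then have "(\<lambda>X. \<theta> U * X * mat_adjoint (\<theta> U)) ` \<theta> ` B = \<theta> ` B" using UB by simp
    moreover have "\<theta> U * mat_adjoint (\<theta> U) = 1\<^sub>m N'" "mat_adjoint (\<theta> U) * \<theta> U = 1\<^sub>m N'"
      using UU UA a t one by metis+
    ultimately show ?thesis using t(2)[OF UA] by (simp add: normalizer_def)
  qed
  let ?V = "{X \<in> A. \<theta> X \<in> mat_span N' ?N'}"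
  have "mat_subspace N ?V"
  proof -
    have "0\<^sub>m N N = 0 \<cdot>\<^sub>m (1\<^sub>m N :: complex mat)" by (rule eq_matI) auto
    then have z: "\<theta> (0\<^sub>m N N) = 0 \<cdot>\<^sub>m 1\<^sub>m N'" using t(5)[OF a(3), of 0] one by simp
    have "0 \<cdot>\<^sub>m 1\<^sub>m N' = (0\<^sub>m N' N' :: complex mat)" by (rule eq_matI) auto
    then have "\<theta> (0\<^sub>m N N) \<in> mat_span N' ?N'" using z mat_subspaceD(2)[OF sp] by simp
    then show ?thesis
      using mat_subspaceD[OF unital_star_subalgebra_subspace[OF A]] mat_subspaceD(3,4)[OF sp] t
      by (auto simp: mat_subspace_def)
  qed
  moreover have "?N \<subseteq> ?V"
  proof -
    have "?N \<subseteq> A" by (auto simp: normalizer_def)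
    then show ?thesis using U mat_span_superset[OF subc] by blast
  qed
  ultimately have "mat_span N ?N \<subseteq> ?V" by (rule mat_span_minimal)
  then have "\<theta> ` A \<subseteq> mat_span N' ?N'" using reg by (auto simp: regular_inclusion_def)
  moreover have "mat_span N' ?N' \<subseteq> A'"
    by (rule mat_span_minimal[OF unital_star_subalgebra_subspace[OF A'] sub])
  ultimately show ?thesis using t(1) by (auto simp: regular_inclusion_def bij_betw_def)
qed

lemma regular_inclusion_star_iso_iff:
  assumes i: "star_iso \<theta> A A'" and A: "unital_star_subalgebra N A" and A': "unital_star_subalgebra N' A'"
    and BA: "B \<subseteq> A"
  shows "regular_inclusion N' (\<theta> ` B) A' \<longleftrightarrow> regular_inclusion N B A"
proof
  assume r: "regular_inclusion N' (\<theta> ` B) A'"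
  have "\<theta> ` B \<subseteq> A'" using BA star_isoD(2)[OF i] by blast
  from regular_inclusion_star_iso[OF star_iso_inv[OF i A] A' A this r]
  show "regular_inclusion N B A"
    using BA star_isoD(1)[OF i] by (simp add: inv_into_image_cancel bij_betw_def)
qed (rule regular_inclusion_star_iso[OF i A A' BA])

section \<open>Projections\<close>

text \<open>Peel off the normalized column \<open>v = Q e\<^sub>i / \<surd>Q\<^sub>i\<^sub>i\<close>: the remainder \<open>Q - v v*\<close> is again a
  projection, with trace smaller by one.\<close>

lemma projection_basis:
  fixes Q :: "nat \<Rightarrow> nat \<Rightarrow> complex"
  assumes idem: "\<And>i j. i < N \<Longrightarrow> j < N \<Longrightarrow> (\<Sum>k<N. Q i k * Q k j) = Q i j"
    and herm: "\<And>i j. i < N \<Longrightarrow> j < N \<Longrightarrow> cnj (Q i j) = Q j i"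
  shows "\<exists>a v. (\<forall>p<a. \<forall>q<a. (\<Sum>i<N. cnj (v p i) * v q i) = (if p = q then 1 else 0)) \<and>
    (\<forall>i<N. \<forall>j<N. Q i j = (\<Sum>p<a::nat. v p i * cnj (v p j)))"
proof -
  \<comment> \<open>A diagonal entry of a projection is the squared norm of its row. The fact is
    kept general in \<open>Q\<close> because the induction below replaces \<open>Q\<close>.\<close>
  have pos: "Re (Q i i) = (\<Sum>k<N. (cmod (Q i k))\<^sup>2)" "Im (Q i i) = 0"
    if idem: "\<And>i j. i < N \<Longrightarrow> j < N \<Longrightarrow> (\<Sum>k<N. Q i k * Q k j) = Q i j"
    and herm: "\<And>i j. i < N \<Longrightarrow> j < N \<Longrightarrow> cnj (Q i j) = Q j i" and "i < N"
    for Q :: "nat \<Rightarrow> nat \<Rightarrow> complex" and i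
  proof -
    have "Q i i = (\<Sum>k<N. Q i k * cnj (Q i k))"
      using idem[of i i] herm[of i] that(3) by (simp cong: sum.cong_simp)
    then have "Q i i = complex_of_real (\<Sum>k<N. (cmod (Q i k))\<^sup>2)"
      by (simp only: of_real_sum complex_norm_square)
    then show "Re (Q i i) = (\<Sum>k<N. (cmod (Q i k))\<^sup>2)" "Im (Q i i) = 0" by simp_all
  qed
  \<comment> \<open>The induction runs over a natural number above the trace: that the trace itself
    is an integer is a consequence of the result.\<close>
  have "\<exists>a v. (\<forall>p<a. \<forall>q<a. (\<Sum>i<N. cnj (v p i) * v q i) = (if p = q then 1 else 0)) \<and>
      (\<forall>i<N. \<forall>j<N. Q i j = (\<Sum>p<a::nat. v p i * cnj (v p j)))"
    if "(\<Sum>i<N. Re (Q i i)) < real n"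
      "\<And>i j. i < N \<Longrightarrow> j < N \<Longrightarrow> (\<Sum>k<N. Q i k * Q k j) = Q i j"
      "\<And>i j. i < N \<Longrightarrow> j < N \<Longrightarrow> cnj (Q i j) = Q j i" for n
    using that
  proof (induction n arbitrary: Q)
    case 0
    have "0 \<le> (\<Sum>i<N. Re (Q i i))" by (intro sum_nonneg) (use pos[OF 0(2,3)] in \<open>auto intro: sum_nonneg\<close>)
    then show ?case using 0(1) by simp
  next
    case (Suc n)
    note idem = Suc.prems(2) and herm = Suc.prems(3)
    show ?case
    proof (cases "\<forall>i<N. Q i i = 0")
      case True
      have "Q i j = 0" if "i < N" "j < N" for i j
      proof -
        have "(\<Sum>k<N. (cmod (Q i k))\<^sup>2) = 0" using pos(1)[OF idem herm that(1)] True that(1) by simp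
        then have "(cmod (Q i j))\<^sup>2 = 0" using that(2) by (subst (asm) sum_nonneg_eq_0_iff) auto
        then show ?thesis by simp
      qed
      then show ?thesis by (intro exI[of _ 0]) auto
    next
      case False
      then obtain i0 where i0: "i0 < N" "Q i0 i0 \<noteq> 0" by blast
      define r where "r = Re (Q i0 i0)"
      have Qr: "Q i0 i0 = complex_of_real r" using pos(2)[OF idem herm i0(1)] by (simp add: r_def complex_eq_iff)
      have "r = (\<Sum>k<N. (cmod (Q i0 k))\<^sup>2)" unfolding r_def by (rule pos(1)[OF idem herm i0(1)])
      then have "0 \<le> r" by (simp add: sum_nonneg)
      then have r: "0 < r" using i0 Qr by (cases "r = 0") auto
      define s where "s = complex_of_real (sqrt r)"
      have s: "s * s = Q i0 i0" "cnj s = s" "s \<noteq> 0"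
        using r by (auto simp: s_def Qr simp flip: of_real_mult)
      define w where "w i = Q i i0 / s" for i
      define Q' where "Q' i j = Q i j - w i * cnj (w j)" for i j
      have cw: "cnj (w i) = Q i0 i / s" if "i < N" for i
        using herm[OF that i0(1)] s(2) by (simp add: w_def)
      have Qw: "(\<Sum>k<N. Q i k * w k) = w i" if "i < N" for i
        using idem[OF that i0(1)] by (simp add: w_def flip: sum_divide_distrib)
      have wQ: "(\<Sum>k<N. cnj (w k) * Q k j) = cnj (w j)" if "j < N" for j
      proof -
        have "(\<Sum>k<N. cnj (w k) * Q k j) = (\<Sum>k<N. Q i0 k * Q k j) / s"
          by (simp add: cw sum_divide_distrib cong: sum.cong_simp)
        then show ?thesis using idem[OF i0(1) that] that by (simp add: cw)
      qed
      have ww: "(\<Sum>k<N. cnj (w k) * w k) = 1"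
      proof -
        have "(\<Sum>k<N. cnj (w k) * w k) = (\<Sum>k<N. Q i0 k * Q k i0) / (s * s)"
          unfolding sum_divide_distrib by (intro sum.cong refl) (simp add: cw, simp add: w_def)
        then show ?thesis using idem[OF i0(1) i0(1)] s i0 by simp
      qed
      have idem': "(\<Sum>k<N. Q' i k * Q' k j) = Q' i j" if "i < N" "j < N" for i j
      proof -
        have "(\<Sum>k<N. Q' i k * Q' k j) = (\<Sum>k<N. Q i k * Q k j) - (\<Sum>k<N. Q i k * w k) * cnj (w j)
            - w i * (\<Sum>k<N. cnj (w k) * Q k j) + w i * (\<Sum>k<N. cnj (w k) * w k) * cnj (w j)"
          by (simp add: Q'_def algebra_simps sum.distrib sum_subtractf sum_distrib_left sum_distrib_right)
        then show ?thesis using that by (simp add: idem Qw wQ ww Q'_def)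
      qed
      have herm': "cnj (Q' i j) = Q' j i" if "i < N" "j < N" for i j
        using that by (simp add: Q'_def herm)
      have wQ': "(\<Sum>k<N. cnj (w k) * Q' k j) = 0" if "j < N" for j
      proof -
        have "(\<Sum>k<N. cnj (w k) * Q' k j) = (\<Sum>k<N. cnj (w k) * Q k j) - (\<Sum>k<N. cnj (w k) * w k) * cnj (w j)"
          by (simp add: Q'_def algebra_simps sum_subtractf sum_distrib_left sum_distrib_right)
        then show ?thesis using that by (simp add: wQ ww)
      qed
      have "(\<Sum>i<N. Re (Q' i i)) = (\<Sum>i<N. Re (Q i i)) - Re (\<Sum>k<N. cnj (w k) * w k)"
        by (simp add: Q'_def sum_subtractf mult.commute)
      then have "(\<Sum>i<N. Re (Q' i i)) < real n" using ww Suc.prems(1) by simp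
      from Suc.IH[of Q', OF this idem' herm'] obtain a v where
        on: "\<And>p q. p < a \<Longrightarrow> q < a \<Longrightarrow> (\<Sum>i<N. cnj (v p i) * v q i) = (if p = q then 1 else 0)"
        and Q'v: "\<And>i j. i < N \<Longrightarrow> j < N \<Longrightarrow> Q' i j = (\<Sum>p<a::nat. v p i * cnj (v p j))"
        by blast
      \<comment> \<open>Every \<open>v q\<close> is fixed by \<open>Q'\<close>, while
        \<open>w\<close> is killed by it; so \<open>w\<close> is orthogonal to all
        \<open>v q\<close> and extends the orthonormal family.\<close>
      have vQ': "(\<Sum>j<N. Q' i j * v q j) = v q i" if "i < N" "q < a" for i q
      proof -
        have "(\<Sum>j<N. Q' i j * v q j) = (\<Sum>j<N. \<Sum>p<a. v p i * (cnj (v p j) * v q j))"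
          using that by (intro sum.cong) (auto simp: Q'v sum_distrib_right mult.assoc)
        also have "\<dots> = (\<Sum>p<a. v p i * (\<Sum>j<N. cnj (v p j) * v q j))"
          by (subst sum.swap) (simp add: sum_distrib_left)
        also have "\<dots> = (\<Sum>p<a. if p = q then v p i else 0)"
          using that on by (intro sum.cong) auto
        also have "\<dots> = v q i" using that by simp
        finally show ?thesis .
      qed
      have wv: "(\<Sum>i<N. cnj (w i) * v q i) = 0" if "q < a" for q
      proof -
        have "(\<Sum>i<N. cnj (w i) * v q i) = (\<Sum>i<N. \<Sum>j<N. cnj (w i) * Q' i j * v q j)"
          using that by (intro sum.cong) (auto simp: vQ' mult.assoc simp flip: sum_distrib_left)
        also have "\<dots> = (\<Sum>j<N. (\<Sum>i<N. cnj (w i) * Q' i j) * v q j)"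
          by (subst sum.swap) (simp add: sum_distrib_right)
        also have "\<dots> = 0" by (simp add: wQ')
        finally show ?thesis .
      qed
      have vw: "(\<Sum>i<N. cnj (v q i) * w i) = 0" if "q < a" for q
      proof -
        have "(\<Sum>i<N. cnj (v q i) * w i) = cnj (\<Sum>i<N. cnj (w i) * v q i)" by (simp add: mult.commute)
        then show ?thesis using wv[OF that] by simp
      qed
      define v' where "v' p = (if p = a then w else v p)" for p
      show ?thesis
      proof (intro exI[of _ "Suc a"] exI[of _ v'] conjI allI impI)
        fix p q assume "p < Suc a" "q < Suc a"
        then show "(\<Sum>i<N. cnj (v' p i) * v' q i) = (if p = q then 1 else 0)"
          using on[of p q] wv vw ww by (auto simp: v'_def less_Suc_eq)
      next
        fix i j assume "i < N" "j < N"
        then have "Q i j = (\<Sum>p<a. v p i * cnj (v p j)) + w i * cnj (w j)"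
          by (simp add: Q'_def flip: Q'v)
        then show "Q i j = (\<Sum>p<Suc a. v' p i * cnj (v' p j))"
          by (simp add: v'_def)
      qed
    qed
  qed
  from this[OF _ idem herm] show ?thesis using reals_Archimedean2 by blast
qed

text \<open>The columns of \<open>V\<close> are an orthonormal basis of the range of
  \<open>Q\<close>, and \<open>a\<close> is its rank.\<close>

lemma projection_factorization:
  assumes Q: "Q \<in> carrier_mat N N" and idem: "Q * Q = Q" and herm: "mat_adjoint Q = Q"
  obtains a and V :: "complex mat" where "V \<in> carrier_mat N a" "mat_adjoint V * V = 1\<^sub>m a" "V * mat_adjoint V = Q"
proof -
  have 1: "(\<Sum>k<N. Q $$ (i, k) * Q $$ (k, j)) = Q $$ (i, j)" if "i < N" "j < N" for i j
    using mat_mult_index[OF Q Q that] idem by simp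
  have 2: "cnj (Q $$ (i, j)) = Q $$ (j, i)" if "i < N" "j < N" for i j
    using mat_adjoint_index[of j Q i] herm Q that by auto
  obtain a v where on: "\<And>p q. p < a \<Longrightarrow> q < a \<Longrightarrow> (\<Sum>i<N. cnj (v p i) * v q i) = (if p = q then 1 else 0)"
    and Qv: "\<And>i j. i < N \<Longrightarrow> j < N \<Longrightarrow> Q $$ (i, j) = (\<Sum>p<a::nat. v p i * cnj (v p j))"
    using projection_basis[of N "\<lambda>i j. Q $$ (i, j)", OF 1 2] by blast
  let ?V = "mat N a (\<lambda>(i, p). v p i)"
  have V: "?V \<in> carrier_mat N a" by simp
  note V' = mat_adjoint_carrier[OF V]
  show thesis
  proof (rule that[OF V])
    show "mat_adjoint ?V * ?V = 1\<^sub>m a"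
    proof (rule eq_matI)
      fix p q assume "p < dim_row (1\<^sub>m a)" "q < dim_col (1\<^sub>m a)"
      then have pq: "p < a" "q < a" by auto
      show "(mat_adjoint ?V * ?V) $$ (p, q) = 1\<^sub>m a $$ (p, q)"
        unfolding mat_mult_index[OF V' V pq] using pq by (simp add: on)
    qed auto
    show "?V * mat_adjoint ?V = Q"
    proof (rule eq_matI)
      fix p q assume "p < dim_row Q" "q < dim_col Q"
      then have pq: "p < N" "q < N" using Q by auto
      show "(?V * mat_adjoint ?V) $$ (p, q) = Q $$ (p, q)"
        unfolding mat_mult_index[OF V V' pq] using pq by (simp add: Qv)
    qed (use Q in auto)
  qed
qed

lemma mat_trace_one: "mat_trace (1\<^sub>m n) = of_nat n"
  by (simp add: mat_trace_def)

text \<open>With the isometry \<open>V\<close> above, cyclicity turns the trace of \<open>Q\<close>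
  into that of the identity of size \<open>a\<close>. Rank 0 makes \<open>V\<close> empty and
  \<open>Q\<close> zero.\<close>

lemma projection_trace:
  assumes Q: "Q \<in> carrier_mat N N" and idem: "Q * Q = Q" and herm: "mat_adjoint Q = Q"
  shows "\<exists>a. mat_trace Q = of_nat a \<and> (Q \<noteq> 0\<^sub>m N N \<longrightarrow> 0 < a)"
proof -
  obtain a V where V: "V \<in> carrier_mat N a" "mat_adjoint V * V = 1\<^sub>m a" "V * mat_adjoint V = Q"
    using projection_factorization[OF assms] by metis
  have "mat_trace Q = of_nat a"
    using mat_trace_commute[OF V(1) mat_adjoint_carrier[OF V(1)]] V by (simp add: mat_trace_one)
  moreover have "Q = 0\<^sub>m N N" if "a = 0"
  proof (rule eq_matI)
    fix i j assume "i < dim_row (0\<^sub>m N N)" "j < dim_col (0\<^sub>m N N)"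
    then have ij: "i < N" "j < N" by auto
    show "Q $$ (i, j) = 0\<^sub>m N N $$ (i, j)"
      using mat_mult_index[OF V(1) mat_adjoint_carrier[OF V(1)] ij] V(3) that ij by simp
  qed (use Q in auto)
  ultimately show ?thesis by auto
qed

section \<open>Matrices with labelled indices\<close>

text \<open>A pattern \<open>P\<close> prescribes which entries vanish (\<open>P u v = None\<close>) and which entries coincide
  (equal values \<open>Some x\<close>).\<close>

definition labelled_mat :: "nat \<Rightarrow> (nat \<Rightarrow> 'u) \<Rightarrow> ('u \<Rightarrow> 'u \<Rightarrow> complex) \<Rightarrow> complex mat" where
  "labelled_mat N d f = mat N N (\<lambda>(g, h). f (d g) (d h))"

definition labelled_alg :: "nat \<Rightarrow> (nat \<Rightarrow> 'u) \<Rightarrow> ('u \<Rightarrow> 'u \<Rightarrow> 'c option) \<Rightarrow> complex mat set" where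
  "labelled_alg N d P = range (\<lambda>c. labelled_mat N d (\<lambda>u v. case P u v of None \<Rightarrow> 0 | Some x \<Rightarrow> c x))"

lemma labelled_mat_carrier [simp]: "labelled_mat N d f \<in> carrier_mat N N"
  by (simp add: labelled_mat_def)

lemma labelled_mat_dim [simp]: "dim_row (labelled_mat N d f) = N" "dim_col (labelled_mat N d f) = N"
  by (simp_all add: labelled_mat_def)

lemma labelled_alg_carrier: "labelled_alg N d P \<subseteq> carrier_mat N N"
  by (auto simp: labelled_alg_def)

lemma labelled_mat_add:
  "labelled_mat N d f + labelled_mat N d f' = labelled_mat N d (\<lambda>u v. f u v + f' u v)"
  by (rule eq_matI) (auto simp: labelled_mat_def)

lemma labelled_mat_smult:
  "c \<cdot>\<^sub>m labelled_mat N d f = labelled_mat N d (\<lambda>u v. c * f u v)"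
  by (rule eq_matI) (auto simp: labelled_mat_def)

lemma labelled_mat_adjoint:
  "mat_adjoint (labelled_mat N d f) = labelled_mat N d (\<lambda>u v. cnj (f v u))"
  by (rule eq_matI) (auto simp: labelled_mat_def)

text \<open>Matrix positions are addressed by labels in \<open>I\<close>, so that products become
  sums over \<open>I\<close> and index arithmetic is confined to the construction of
  \<open>d\<close>.\<close>

locale labelling =
  fixes N :: nat and d :: "nat \<Rightarrow> 'u" and I :: "'u set"
  assumes bij: "bij_betw d {..<N} I"
begin

abbreviation lm :: "('u \<Rightarrow> 'u \<Rightarrow> complex) \<Rightarrow> complex mat" where "lm \<equiv> labelled_mat N d"

lemma fin: "finite I"
  using bij bij_betw_finite by blast

lemma label_mem [simp]: "g < N \<Longrightarrow> d g \<in> I"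
  using bij by (auto simp: bij_betw_def)

lemma label_eq_iff [simp]: "g < N \<Longrightarrow> h < N \<Longrightarrow> d g = d h \<longleftrightarrow> g = h"
  using bij by (auto simp: bij_betw_def inj_on_def)

lemma label_ex: "u \<in> I \<Longrightarrow> \<exists>g<N. d g = u"
  using bij by (auto simp: bij_betw_def)

lemma lm_eqI: "(\<And>u v. u \<in> I \<Longrightarrow> v \<in> I \<Longrightarrow> f u v = f' u v) \<Longrightarrow> lm f = lm f'"
  by (rule eq_matI) (auto simp: labelled_mat_def)

lemma lm_eq_iff: "lm f = lm f' \<longleftrightarrow> (\<forall>u\<in>I. \<forall>v\<in>I. f u v = f' u v)"
proof
  assume e: "lm f = lm f'"
  show "\<forall>u\<in>I. \<forall>v\<in>I. f u v = f' u v"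
  proof (intro ballI)
    fix u v assume "u \<in> I" "v \<in> I"
    then obtain g h where gh: "g < N" "h < N" "u = d g" "v = d h" using label_ex by metis
    have "lm f $$ (g, h) = lm f' $$ (g, h)" using e by simp
    then show "f u v = f' u v" using gh by (simp add: labelled_mat_def)
  qed
qed (blast intro: lm_eqI)

lemma lm_surj:
  assumes "X \<in> carrier_mat N N"
  obtains f where "X = lm f"
proof
  let ?e = "inv_into {..<N} d"
  have "?e (d g) = g" if "g < N" for g
    using bij that by (auto simp: bij_betw_def)
  then show "X = lm (\<lambda>u v. X $$ (?e u, ?e v))"
    using assms by (intro eq_matI) (auto simp: labelled_mat_def)
qed

lemma lm_mult: "lm f * lm f' = lm (\<lambda>u v. \<Sum>w\<in>I. f u w * f' w v)"
proof (rule eq_matI)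
  fix i j assume "i < dim_row (lm (\<lambda>u v. \<Sum>w\<in>I. f u w * f' w v))" "j < dim_col (lm (\<lambda>u v. \<Sum>w\<in>I. f u w * f' w v))"
  then have ij: "i < N" "j < N" by auto
  have "(lm f * lm f') $$ (i, j) = (\<Sum>q<N. lm f $$ (i, q) * lm f' $$ (q, j))"
    by (rule mat_mult_index[OF _ _ ij]) auto
  also have "\<dots> = (\<Sum>q<N. f (d i) (d q) * f' (d q) (d j))"
    using ij by (intro sum.cong) (auto simp: labelled_mat_def)
  also have "\<dots> = (\<Sum>w\<in>I. f (d i) w * f' w (d j))"
    by (rule sum.reindex_bij_betw[OF bij])
  finally show "(lm f * lm f') $$ (i, j) = lm (\<lambda>u v. \<Sum>w\<in>I. f u w * f' w v) $$ (i, j)"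
    using ij by (simp add: labelled_mat_def)
qed auto

lemma lm_one: "1\<^sub>m N = lm (\<lambda>u v. if u = v then 1 else 0)"
  by (rule eq_matI) (auto simp: labelled_mat_def)

lemma lm_trace: "mat_trace (lm f) = (\<Sum>u\<in>I. f u u)"
proof -
  have "mat_trace (lm f) = (\<Sum>q<N. f (d q) (d q))"
    by (simp add: mat_trace_def labelled_mat_def)
  then show ?thesis using sum.reindex_bij_betw[OF bij, of "\<lambda>u. f u u"] by simp
qed

end

lemma star_iso_restrict:
  assumes "star_iso \<theta> C C'" "A \<subseteq> C"
  shows "star_iso \<theta> A (\<theta> ` A)"
  using assms by (auto simp: star_iso_def bij_betw_def subset_iff intro: inj_on_subset)

text \<open>Two enumerations of the same label set differ by a permutation of the basis; \<theta> is
  conjugation by it, written through the labels.\<close>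

lemma relabelling_star_iso:
  assumes "bij_betw d {..<N} I" "bij_betw d' {..<N'} I"
  obtains \<theta> where "star_iso \<theta> (carrier_mat N N) (carrier_mat N' N')"
    "\<And>f. \<theta> (labelled_mat N d f) = labelled_mat N' d' f"
proof -
  interpret l: labelling N d I by standard fact
  interpret l': labelling N' d' I by standard fact
  let ?e = "inv_into {..<N} d"
  define \<theta> where "\<theta> X = labelled_mat N' d' (\<lambda>u v. X $$ (?e u, ?e v))" for X
  have e: "?e u < N" "d (?e u) = u" if "u \<in> I" for u
    using assms(1) that inv_into_into[of u d "{..<N}"] f_inv_into_f[of u d "{..<N}"]
    by (auto simp: bij_betw_def)
  have \<theta>: "\<theta> (labelled_mat N d f) = labelled_mat N' d' f" for f
    unfolding \<theta>_def by (rule l'.lm_eqI) (use e in \<open>auto simp: labelled_mat_def\<close>)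
  have "star_iso \<theta> (carrier_mat N N) (carrier_mat N' N')"
    unfolding star_iso_def
  proof (intro conjI ballI allI)
    show "bij_betw \<theta> (carrier_mat N N) (carrier_mat N' N')"
    proof (rule bij_betwI')
      fix X Y :: "complex mat" assume "X \<in> carrier_mat N N" "Y \<in> carrier_mat N N"
      then obtain f f' where "X = l.lm f" "Y = l.lm f'" using l.lm_surj by metis
      then show "(\<theta> X = \<theta> Y) = (X = Y)" by (simp add: \<theta> l.lm_eq_iff l'.lm_eq_iff)
    next
      fix Y :: "complex mat" assume "Y \<in> carrier_mat N' N'"
      then obtain f where "Y = l'.lm f" using l'.lm_surj by metis
      then show "\<exists>X\<in>carrier_mat N N. Y = \<theta> X" using \<theta> labelled_mat_carrier by metis
    qed (simp add: \<theta>_def)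
  next
    fix X Y :: "complex mat" assume "X \<in> carrier_mat N N" "Y \<in> carrier_mat N N"
    then obtain f f' where XY: "X = l.lm f" "Y = l.lm f'" using l.lm_surj by metis
    show "\<theta> (X + Y) = \<theta> X + \<theta> Y" "\<theta> (X * Y) = \<theta> X * \<theta> Y"
      unfolding XY by (simp_all add: labelled_mat_add \<theta> l.lm_mult l'.lm_mult)
  next
    fix X :: "complex mat" and c assume "X \<in> carrier_mat N N"
    then obtain f where X: "X = l.lm f" using l.lm_surj by metis
    show "\<theta> (c \<cdot>\<^sub>m X) = c \<cdot>\<^sub>m \<theta> X" unfolding X by (simp add: labelled_mat_smult \<theta>)
  next
    fix X :: "complex mat" assume "X \<in> carrier_mat N N"
    then obtain f where X: "X = l.lm f" using l.lm_surj by metis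
    show "\<theta> (mat_adjoint X) = mat_adjoint (\<theta> X)" unfolding X by (simp add: labelled_mat_adjoint \<theta>)
  qed
  then show thesis using \<theta> that by blast
qed

text \<open>Up to isomorphism an inclusion depends on labels and patterns alone. This passes from
  the basis order of the diagonalization to the one forced by sums and tensor products.\<close>

lemma relabelling_inclusion_iso:
  fixes P :: "'u \<Rightarrow> 'u \<Rightarrow> 'c option" and Q :: "'u \<Rightarrow> 'u \<Rightarrow> 'e option"
  assumes "bij_betw d {..<N} I" "bij_betw d' {..<N'} I"
  shows "inclusion_iso (labelled_alg N d Q) (labelled_alg N d P) (labelled_alg N' d' Q) (labelled_alg N' d' P)"
proof -
  obtain \<theta> where t: "star_iso \<theta> (carrier_mat N N) (carrier_mat N' N')"
    and l: "\<And>f. \<theta> (labelled_mat N d f) = labelled_mat N' d' f"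
    using relabelling_star_iso[OF assms] by metis
  have "\<theta> ` labelled_alg N d P = labelled_alg N' d' P"
    by (simp add: labelled_alg_def image_image l)
  moreover have "\<theta> ` labelled_alg N d Q = labelled_alg N' d' Q"
    by (simp add: labelled_alg_def image_image l)
  ultimately show ?thesis
    using star_iso_restrict[OF t labelled_alg_carrier[of N d P]] by (auto simp: inclusion_iso_def)
qed

section \<open>The algebras \<open>A\<close> and \<open>B\<close> in coordinates\<close>

type_synonym coord = "nat \<times> nat \<times> nat \<times> nat"

definition coords :: "nat set \<Rightarrow> nat set \<Rightarrow> (nat \<Rightarrow> nat) \<Rightarrow> (nat \<Rightarrow> nat \<Rightarrow> nat) \<Rightarrow> coord set" where
  "coords K L m a = {(k, l, y, p). k \<in> K \<and> l \<in> L \<and> y < m l \<and> p < a k l}"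

definition big_pattern :: "'a \<times> 'b \<Rightarrow> 'a \<times> 'b \<Rightarrow> (('a \<times> 'b) \<times> ('a \<times> 'b)) option" where
  "big_pattern u v = (if fst u = fst v then Some (u, v) else None)"

definition small_pattern :: "coord \<Rightarrow> coord \<Rightarrow> (nat \<times> nat \<times> nat) option" where
  "small_pattern = (\<lambda>(k, l, y, p) (k', l', y', p').
     if k = k' \<and> l = l' \<and> p = p' then Some (l, y, y') else None)"

locale block_labelling =
  labelling N d I for N :: nat and d :: "nat \<Rightarrow> 'k \<times> 'v" and I
begin

definition "bigA = labelled_alg N d big_pattern"

lemma bigA_iff: "lm f \<in> bigA \<longleftrightarrow> (\<forall>u\<in>I. \<forall>v\<in>I. fst u \<noteq> fst v \<longrightarrow> f u v = 0)"
proof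
  assume "lm f \<in> bigA"
  then obtain c where "lm f = lm (\<lambda>u v. case big_pattern u v of None \<Rightarrow> 0 | Some x \<Rightarrow> c x)"
    by (auto simp: bigA_def labelled_alg_def)
  then show "\<forall>u\<in>I. \<forall>v\<in>I. fst u \<noteq> fst v \<longrightarrow> f u v = 0"
    unfolding lm_eq_iff by (auto simp: big_pattern_def)
next
  assume *: "\<forall>u\<in>I. \<forall>v\<in>I. fst u \<noteq> fst v \<longrightarrow> f u v = 0"
  have "lm f = lm (\<lambda>u v. case big_pattern u v of None \<Rightarrow> 0 | Some x \<Rightarrow> (\<lambda>(u, v). f u v) x)"
    unfolding lm_eq_iff using * by (auto simp: big_pattern_def)
  then show "lm f \<in> bigA" unfolding bigA_def labelled_alg_def by blast
qed

lemma bigA_carrier: "bigA \<subseteq> carrier_mat N N"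
  by (simp add: bigA_def labelled_alg_carrier)

lemma bigA_obtain:
  assumes "X \<in> bigA"
  obtains f where "X = lm f" "\<forall>u\<in>I. \<forall>v\<in>I. fst u \<noteq> fst v \<longrightarrow> f u v = 0"
proof -
  obtain f where f: "X = lm f" using assms bigA_carrier lm_surj by blast
  with assms have "\<forall>u\<in>I. \<forall>v\<in>I. fst u \<noteq> fst v \<longrightarrow> f u v = 0" by (simp only: bigA_iff)
  with f show thesis by (rule that)
qed

lemma bigA_subalgebra: "unital_star_subalgebra N bigA"
  unfolding unital_star_subalgebra_def
proof (intro conjI ballI allI bigA_carrier)
  show "1\<^sub>m N \<in> bigA" unfolding lm_one bigA_iff by auto
  fix X Y assume X: "X \<in> bigA" and Y: "Y \<in> bigA"
  obtain f where f: "X = lm f" "\<forall>u\<in>I. \<forall>v\<in>I. fst u \<noteq> fst v \<longrightarrow> f u v = 0"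
    by (rule bigA_obtain[OF X])
  obtain g where g: "Y = lm g" "\<forall>u\<in>I. \<forall>v\<in>I. fst u \<noteq> fst v \<longrightarrow> g u v = 0"
    by (rule bigA_obtain[OF Y])
  show "X + Y \<in> bigA" unfolding f(1) g(1) labelled_mat_add bigA_iff using f(2) g(2) by auto
  show "X * Y \<in> bigA" unfolding f(1) g(1) lm_mult bigA_iff
  proof (intro ballI impI sum.neutral)
    fix u v w assume *: "u \<in> I" "v \<in> I" "fst u \<noteq> fst v" "w \<in> I"
    show "f u w * g w v = 0"
      using f(2) g(2) * by (cases "fst u = fst w") auto
  qed
next
  fix X c assume X: "X \<in> bigA"
  obtain f where f: "X = lm f" "\<forall>u\<in>I. \<forall>v\<in>I. fst u \<noteq> fst v \<longrightarrow> f u v = 0"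
    by (rule bigA_obtain[OF X])
  show "c \<cdot>\<^sub>m X \<in> bigA" unfolding f(1) labelled_mat_smult bigA_iff using f(2) by auto
next
  fix X assume X: "X \<in> bigA"
  obtain f where f: "X = lm f" "\<forall>u\<in>I. \<forall>v\<in>I. fst u \<noteq> fst v \<longrightarrow> f u v = 0"
    by (rule bigA_obtain[OF X])
  show "mat_adjoint X \<in> bigA" unfolding f(1) labelled_mat_adjoint bigA_iff using f(2)
    by (metis complex_cnj_zero)
qed

text \<open>The central projection of \<open>bigA\<close> belonging to the block
  \<open>k\<close>.\<close>

definition block_proj :: "'k \<Rightarrow> complex mat" where
  "block_proj k = lm (\<lambda>u v. if u = v \<and> fst u = k then 1 else 0)"

lemma block_proj_mult: "block_proj k * lm f = lm (\<lambda>u v. if fst u = k then f u v else 0)"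
  unfolding block_proj_def lm_mult
proof (rule lm_eqI)
  fix u v assume "u \<in> I" "v \<in> I"
  have "(\<Sum>w\<in>I. (if u = w \<and> fst u = k then 1 else 0) * f w v)
      = (\<Sum>w\<in>I. if w = u then (if fst u = k then f u v else 0) else 0)"
    by (intro sum.cong) auto
  then show "(\<Sum>w\<in>I. (if u = w \<and> fst u = k then 1 else 0) * f w v) = (if fst u = k then f u v else 0)"
    using \<open>u \<in> I\<close> fin by simp
qed

lemma mult_block_proj: "lm f * block_proj k = lm (\<lambda>u v. if fst v = k then f u v else 0)"
  unfolding block_proj_def lm_mult
proof (rule lm_eqI)
  fix u v assume "u \<in> I" "v \<in> I"
  have "(\<Sum>w\<in>I. f u w * (if w = v \<and> fst w = k then 1 else 0))
      = (\<Sum>w\<in>I. if w = v then (if fst v = k then f u v else 0) else 0)"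
    by (intro sum.cong) auto
  then show "(\<Sum>w\<in>I. f u w * (if w = v \<and> fst w = k then 1 else 0)) = (if fst v = k then f u v else 0)"
    using \<open>v \<in> I\<close> fin by simp
qed

lemma block_proj_carrier [simp]: "block_proj k \<in> carrier_mat N N"
  by (simp add: block_proj_def)

lemma block_proj_commute:
  assumes "U \<in> bigA"
  shows "block_proj k * U = U * block_proj k"
proof -
  obtain f where f: "U = lm f" "\<forall>u\<in>I. \<forall>v\<in>I. fst u \<noteq> fst v \<longrightarrow> f u v = 0"
    by (rule bigA_obtain[OF assms])
  show ?thesis unfolding f(1) block_proj_mult mult_block_proj by (rule lm_eqI) (use f(2) in auto)
qed

lemma block_proj_bigA: "block_proj k \<in> bigA"
  unfolding block_proj_def bigA_iff by auto

lemma block_proj_block_proj: "block_proj k * block_proj k' = (if k = k' then block_proj k else 0\<^sub>m N N)"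
proof -
  have z: "0\<^sub>m N N = lm (\<lambda>u v. 0)" by (rule eq_matI) (auto simp: labelled_mat_def)
  show ?thesis unfolding block_proj_def[of k'] block_proj_mult z unfolding block_proj_def by (auto intro!: lm_eqI)
qed

lemma block_proj_adjoint: "mat_adjoint (block_proj k) = block_proj k"
  unfolding block_proj_def labelled_mat_adjoint by (rule lm_eqI) auto

text \<open>Block diagonal matrices are the commutant of the block projections. Unlike the pattern,
  this description is preserved by conjugation with a unitary.\<close>

lemma commute_imp_bigA:
  assumes X: "X \<in> carrier_mat N N" and comm: "\<And>k. k \<in> fst ` I \<Longrightarrow> block_proj k * X = X * block_proj k"
  shows "X \<in> bigA"
proof -
  obtain f where f: "X = lm f" using lm_surj[OF X] .
  show ?thesis unfolding f bigA_iff
  proof (intro ballI impI)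
    fix u v assume "u \<in> I" "v \<in> I" "fst u \<noteq> fst v"
    then show "f u v = 0" using comm[of "fst u"] unfolding f block_proj_mult mult_block_proj lm_eq_iff by fastforce
  qed
qed

end

text \<open>\<open>col_nonzero\<close> is faithfulness: a summand of \<open>B\<close> with zero
  column would have no coordinates and be invisible in the matrices.\<close>

locale coord_inclusion =
  block_labelling N d "coords K L m a"
  for N :: nat and d :: "nat \<Rightarrow> coord" and K L m a +
  assumes finite_K: "finite K" and finite_L: "finite L"
    and m_pos: "\<And>l. l \<in> L \<Longrightarrow> 0 < m l"
    and col_nonzero: "\<And>l. l \<in> L \<Longrightarrow> \<exists>k\<in>K. 0 < a k l"
begin

abbreviation "I \<equiv> coords K L m a"

definition "smallB = labelled_alg N d small_pattern"

text \<open>With \<open>c l\<close> read as a matrix of size \<open>m l\<close>, these are the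
  entries of the image of the family \<open>c\<close> under the standard embedding.\<close>

definition small_entry :: "(nat \<Rightarrow> nat \<Rightarrow> nat \<Rightarrow> complex) \<Rightarrow> coord \<Rightarrow> coord \<Rightarrow> complex" where
  "small_entry c = (\<lambda>(k, l, y, p) (k', l', y', p'). if k = k' \<and> l = l' \<and> p = p' then c l y y' else 0)"

lemma smallB_eq: "smallB = range (\<lambda>c. lm (small_entry c))"
proof -
  have 1: "(\<lambda>u v. case small_pattern u v of None \<Rightarrow> 0 | Some x \<Rightarrow> c x) = small_entry (\<lambda>l y y'. c (l, y, y'))" for c
    by (auto simp: fun_eq_iff small_pattern_def small_entry_def)
  have "range (\<lambda>c. lm (small_entry (\<lambda>l y y'. c (l, y, y')))) = range (\<lambda>c. lm (small_entry c))"
  proof (intro equalityI subsetI)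
    fix X assume "X \<in> range (\<lambda>c. lm (small_entry c))"
    then obtain c where "X = lm (small_entry c)" by blast
    then show "X \<in> range (\<lambda>c. lm (small_entry (\<lambda>l y y'. c (l, y, y'))))"
      by (intro range_eqI[of _ _ "\<lambda>(l, y, y'). c l y y'"]) simp
  qed auto
  then show ?thesis unfolding smallB_def labelled_alg_def 1 .
qed

lemma small_entry_sum:
  assumes "v \<in> I" "u \<in> I"
  shows "(\<Sum>w\<in>I. small_entry c u w * f w) = (case u of (k, l, y, p) \<Rightarrow> \<Sum>z<m l. c l y z * f (k, l, z, p))"
proof -
  obtain k l y p where u: "u = (k, l, y, p)" by (metis prod_cases4)
  have "(\<Sum>w\<in>I. small_entry c u w * f w) = (\<Sum>w\<in>(\<lambda>z. (k, l, z, p)) ` {..<m l}. small_entry c u w * f w)"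
    using assms fin by (intro sum.mono_neutral_right) (auto simp: u coords_def small_entry_def split: if_splits)
  also have "\<dots> = (\<Sum>z<m l. c l y z * f (k, l, z, p))"
    by (subst sum.reindex) (auto simp: inj_on_def u small_entry_def)
  finally show ?thesis by (simp add: u)
qed

lemma small_entry_mult: "lm (small_entry c) * lm (small_entry c') = lm (small_entry (\<lambda>l y y'. \<Sum>z<m l. c l y z * c' l z y'))"
  unfolding lm_mult
proof (rule lm_eqI)
  fix u v assume uv: "u \<in> I" "v \<in> I"
  show "(\<Sum>w\<in>I. small_entry c u w * small_entry c' w v) = small_entry (\<lambda>l y y'. \<Sum>z<m l. c l y z * c' l z y') u v"
    unfolding small_entry_sum[OF uv(2,1)] by (auto simp: small_entry_def split: prod.splits)
qed

text \<open>Faithfulness: \<open>c l y y'\<close> can be read off at the coordinates with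
  \<open>p = 0\<close> in any block where the column \<open>l\<close> is nonzero.\<close>

lemma small_entry_eq_iff: "lm (small_entry c) = lm (small_entry c') \<longleftrightarrow> (\<forall>l\<in>L. \<forall>y<m l. \<forall>y'<m l. c l y y' = c' l y y')"
proof
  assume e: "lm (small_entry c) = lm (small_entry c')"
  show "\<forall>l\<in>L. \<forall>y<m l. \<forall>y'<m l. c l y y' = c' l y y'"
  proof (intro ballI allI impI)
    fix l y y' assume l: "l \<in> L" "y < m l" "y' < m l"
    then obtain k where "k \<in> K" "0 < a k l" using col_nonzero by blast
    then have "(k, l, y, 0) \<in> I" "(k, l, y', 0) \<in> I" using l by (auto simp: coords_def)
    then have "small_entry c (k, l, y, 0) (k, l, y', 0) = small_entry c' (k, l, y, 0) (k, l, y', 0)"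
      using e unfolding lm_eq_iff by blast
    then show "c l y y' = c' l y y'" by (simp add: small_entry_def)
  qed
next
  assume "\<forall>l\<in>L. \<forall>y<m l. \<forall>y'<m l. c l y y' = c' l y y'"
  then show "lm (small_entry c) = lm (small_entry c')" by (intro lm_eqI) (auto simp: small_entry_def coords_def)
qed

lemma smallB_carrier: "smallB \<subseteq> carrier_mat N N"
  by (simp add: smallB_def labelled_alg_carrier)

end

section \<open>Regularity in coordinates\<close>

text \<open>Two columns that meet in one row agree in all rows and have equal sizes. This is the
  conjunction of the two conditions of the theorem, rewritten for columns; see
  \<open>normalizer_matrix_iff_interchangeable\<close>.\<close>

definition interchangeable_columns :: "nat set \<Rightarrow> nat set \<Rightarrow> (nat \<Rightarrow> nat) \<Rightarrow> (nat \<Rightarrow> nat \<Rightarrow> nat) \<Rightarrow> bool" where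
  "interchangeable_columns K L m a \<longleftrightarrow>
     (\<forall>i\<in>K. \<forall>j\<in>L. \<forall>j'\<in>L. 0 < a i j \<longrightarrow> 0 < a i j' \<longrightarrow>
        m j = m j' \<and> (\<forall>k\<in>K. a k j = a k j'))"

lemma interchangeable_columnsD:
  assumes "interchangeable_columns K L m a" "i \<in> K" "j \<in> L" "j' \<in> L" "0 < a i j" "0 < a i j'"
  shows "m j = m j'" "k \<in> K \<Longrightarrow> a k j = a k j'"
  using assms unfolding interchangeable_columns_def by blast+

section \<open>Sufficiency: signed permutations in the normalizer\<close>

context coord_inclusion
begin

text \<open>Invariance of \<open>B\<close> under conjugation by \<open>U\<close> and by its adjoint
  yields equality of the image with \<open>B\<close>, since the second conjugate of \<open>X\<close>
  is a preimage of \<open>X\<close> under the first.\<close>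

lemma normalizer_memI:
  assumes U: "U \<in> bigA" and UU: "U * mat_adjoint U = 1\<^sub>m N" "mat_adjoint U * U = 1\<^sub>m N"
    and 1: "\<And>X. X \<in> smallB \<Longrightarrow> U * X * mat_adjoint U \<in> smallB"
    and 2: "\<And>X. X \<in> smallB \<Longrightarrow> mat_adjoint U * X * U \<in> smallB"
  shows "U \<in> normalizer N smallB bigA"
proof -
  have Uc: "U \<in> carrier_mat N N" using U bigA_carrier by blast
  have "X \<in> (\<lambda>X. U * X * mat_adjoint U) ` smallB" if X: "X \<in> smallB" for X
  proof
    have Xc: "X \<in> carrier_mat N N" using X smallB_carrier by blast
    have "U * (mat_adjoint U * X * U) * mat_adjoint U = (U * mat_adjoint U) * X * (U * mat_adjoint U)"
      using Uc Xc by (simp add: square_mult_assoc[where N = N] square_mult_carrier)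
    then show "X = U * (mat_adjoint U * X * U) * mat_adjoint U" using UU Xc by simp
  qed (rule 2[OF X])
  then show ?thesis using U UU 1 by (auto simp: normalizer_def)
qed

text \<open>The basis vector labelled \<open>v\<close> goes to \<open>e v\<close> times the one
  labelled \<open>T v\<close>.\<close>

definition signed_perm :: "(coord \<Rightarrow> coord) \<Rightarrow> (coord \<Rightarrow> complex) \<Rightarrow> complex mat" where
  "signed_perm T e = lm (\<lambda>u v. if u = T v then e v else 0)"

text \<open>Since \<open>T\<close> is an involution, adjoints are again signed permutations along
  \<open>T\<close>; since it fixes the first component, they lie in \<open>bigA\<close>.\<close>

context
  fixes T :: "coord \<Rightarrow> coord"
  assumes T: "\<And>u. u \<in> I \<Longrightarrow> T u \<in> I" "\<And>u. u \<in> I \<Longrightarrow> T (T u) = u" "\<And>u. u \<in> I \<Longrightarrow> fst (T u) = fst u"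
begin

lemma T_eq_iff: "u \<in> I \<Longrightarrow> v \<in> I \<Longrightarrow> u = T v \<longleftrightarrow> v = T u"
  using T(2) by metis

lemma signed_perm_adjoint:
  assumes "\<And>u. cnj (e u) = e u"
  shows "mat_adjoint (signed_perm T e) = signed_perm T (e \<circ> T)"
  unfolding signed_perm_def labelled_mat_adjoint
  by (rule lm_eqI) (use assms T_eq_iff T in auto)

lemma signed_perm_mult_left:
  "signed_perm T e * lm f = lm (\<lambda>u v. e (T u) * f (T u) v)"
  unfolding signed_perm_def lm_mult
proof (rule lm_eqI)
  fix u v assume uv: "u \<in> I" "v \<in> I"
  have "(\<Sum>w\<in>I. (if u = T w then e w else 0) * f w v) = (\<Sum>w\<in>I. if w = T u then e w * f w v else 0)"
    using T_eq_iff[OF uv(1)] by (intro sum.cong) auto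
  then show "(\<Sum>w\<in>I. (if u = T w then e w else 0) * f w v) = e (T u) * f (T u) v"
    using T(1)[OF uv(1)] fin by simp
qed

lemma signed_perm_mult_right:
  "lm f * signed_perm T e = lm (\<lambda>u v. f u (T v) * e v)"
  unfolding signed_perm_def lm_mult
proof (rule lm_eqI)
  fix u v assume uv: "u \<in> I" "v \<in> I"
  have "(\<Sum>w\<in>I. f u w * (if w = T v then e v else 0)) = (\<Sum>w\<in>I. if w = T v then f u w * e v else 0)"
    by (intro sum.cong) auto
  then show "(\<Sum>w\<in>I. f u w * (if w = T v then e v else 0)) = f u (T v) * e v"
    using T(1)[OF uv(2)] fin by simp
qed

text \<open>\<open>B'\<close> is invariance under conjugation by the signed permutation,
  \<open>B\<close> that under conjugation by its adjoint, both written entrywise.\<close>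

lemma signed_perm_normalizer:
  assumes e: "\<And>u. e u = 1 \<or> e u = -1"
    and B: "\<And>c. \<exists>c'. \<forall>u\<in>I. \<forall>v\<in>I. e u * e v * small_entry c (T u) (T v) = small_entry c' u v"
    and B': "\<And>c. \<exists>c'. \<forall>u\<in>I. \<forall>v\<in>I. e (T u) * e (T v) * small_entry c (T u) (T v) = small_entry c' u v"
  shows "signed_perm T e \<in> normalizer N smallB bigA"
proof -
  let ?U = "signed_perm T e"
  have cnj: "cnj (e u) = e u" for u using e[of u] by auto
  have sq: "e u * e u = 1" for u using e[of u] by auto
  note adj = signed_perm_adjoint[of e, OF cnj]
  have conj: "signed_perm T e1 * lm f * signed_perm T e2 = lm (\<lambda>u v. e1 (T u) * f (T u) (T v) * e2 v)" for e1 e2 f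
    by (simp add: signed_perm_mult_left signed_perm_mult_right)
  show ?thesis
  proof (rule normalizer_memI)
    show "?U \<in> bigA" unfolding signed_perm_def bigA_iff using T(3) by auto
    show "?U * mat_adjoint ?U = 1\<^sub>m N"
      unfolding adj lm_one
      unfolding signed_perm_def[of T e] signed_perm_mult_right
      by (rule lm_eqI) (simp add: T_eq_iff T sq)
    show "mat_adjoint ?U * ?U = 1\<^sub>m N"
      unfolding adj lm_one
      unfolding signed_perm_def[of T "e \<circ> T"] signed_perm_mult_right
      by (rule lm_eqI) (simp add: T_eq_iff T sq)
  next
    fix X assume "X \<in> smallB"
    then obtain c where X: "X = lm (small_entry c)" by (auto simp: smallB_eq)
    obtain c1 where c1: "\<forall>u\<in>I. \<forall>v\<in>I. e (T u) * e (T v) * small_entry c (T u) (T v) = small_entry c1 u v"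
      using B'[of c] by blast
    have "?U * X * mat_adjoint ?U = lm (small_entry c1)"
      unfolding adj X conj by (rule lm_eqI) (use c1 in \<open>auto simp: mult_ac\<close>)
    then show "?U * X * mat_adjoint ?U \<in> smallB" by (auto simp: smallB_eq)
    obtain c2 where c2: "\<forall>u\<in>I. \<forall>v\<in>I. e u * e v * small_entry c (T u) (T v) = small_entry c2 u v"
      using B[of c] by blast
    have "mat_adjoint ?U * X * ?U = lm (small_entry c2)"
      unfolding adj X conj by (rule lm_eqI) (use c2 T in \<open>auto simp: mult_ac\<close>)
    then show "mat_adjoint ?U * X * ?U \<in> smallB" by (auto simp: smallB_eq)
  qed
qed

end

text \<open>The sign \<open>f\<close> comes from a diagonal unitary of \<open>B\<close>, the sign \<open>g\<close> and the permutation \<open>\<rho>\<close> from the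
  commutant of \<open>B\<close> in \<open>A\<close>.\<close>

lemma swap_normalizer:
  fixes \<sigma> :: "nat \<Rightarrow> nat" and \<tau> \<rho> :: "nat \<Rightarrow> nat \<Rightarrow> nat" and f g :: "nat \<Rightarrow> nat \<Rightarrow> complex"
  defines "T \<equiv> (\<lambda>(k, l, y, p). (k, \<sigma> l, \<tau> l y, \<rho> k p))"
    and "e \<equiv> (\<lambda>(k, l, y, p). f l y * g k p)"
  assumes TI: "\<And>u. u \<in> I \<Longrightarrow> T u \<in> I"
    and \<sigma>: "\<And>l. \<sigma> (\<sigma> l) = l" and \<tau>: "\<And>l y. \<tau> (\<sigma> l) (\<tau> l y) = y" and \<rho>: "\<And>k p. \<rho> k (\<rho> k p) = p"
    and f: "\<And>l y. f l y = 1 \<or> f l y = -1" and g: "\<And>k p. g k p = 1 \<or> g k p = -1"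
  shows "signed_perm T e \<in> normalizer N smallB bigA"
proof (rule signed_perm_normalizer)
  have \<sigma>i: "\<sigma> l = \<sigma> l' \<longleftrightarrow> l = l'" for l l' using \<sigma> by metis
  have \<rho>i: "\<rho> k p = \<rho> k p' \<longleftrightarrow> p = p'" for k p p' using \<rho> by metis
  \<comment> \<open>At a nonzero entry of an element of \<open>B\<close> row and column share
    \<open>k\<close> and \<open>p\<close>, so the two factors \<open>g\<close> cancel. The factors
    \<open>f\<close> go into the new coefficients.\<close>
  have gg: "g k p * g k p = 1" for k p using g[of k p] by auto
  have gg': "g k p * (g k p * x) = x" for k p x using gg[of k p] by (simp flip: mult.assoc)
  show "T u \<in> I" if "u \<in> I" for u by (rule TI[OF that])
  show "T (T u) = u" for u by (cases u) (simp add: T_def \<sigma> \<tau> \<rho>)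
  show "fst (T u) = fst u" for u by (cases u) (simp add: T_def)
  show "e u = 1 \<or> e u = -1" for u
  proof (cases u)
    case (fields k l y p)
    then show ?thesis using f[of l y] g[of k p] by (auto simp: e_def)
  qed
  fix c
  show "\<exists>c'. \<forall>u\<in>I. \<forall>v\<in>I. e u * e v * small_entry c (T u) (T v) = small_entry c' u v"
  proof (intro exI ballI)
    fix u v
    show "e u * e v * small_entry c (T u) (T v) = small_entry (\<lambda>l y y'. f l y * f l y' * c (\<sigma> l) (\<tau> l y) (\<tau> l y')) u v"
      by (cases u; cases v) (auto simp: small_entry_def T_def e_def \<sigma>i \<rho>i gg' mult_ac)
  qed
  show "\<exists>c'. \<forall>u\<in>I. \<forall>v\<in>I. e (T u) * e (T v) * small_entry c (T u) (T v) = small_entry c' u v"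
  proof (intro exI ballI)
    fix u v
    show "e (T u) * e (T v) * small_entry c (T u) (T v)
        = small_entry (\<lambda>l y y'. f (\<sigma> l) (\<tau> l y) * f (\<sigma> l) (\<tau> l y') * c (\<sigma> l) (\<tau> l y) (\<tau> l y')) u v"
      by (cases u; cases v) (auto simp: small_entry_def T_def e_def \<sigma>i \<rho>i gg' mult_ac)
  qed
qed

lemma unit_in_span_normalizer:
  assumes C: "interchangeable_columns K L m a" and uv: "u \<in> I" "v \<in> I" "fst u = fst v"
  shows "lm (\<lambda>u' v'. if u' = u \<and> v' = v then 1 else 0) \<in> mat_span N (normalizer N smallB bigA)"
proof -
  let ?S = "mat_span N (normalizer N smallB bigA)"
  have nc: "normalizer N smallB bigA \<subseteq> carrier_mat N N"
    using bigA_carrier by (auto simp: normalizer_def)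
  note sub = mat_subspaceD[OF mat_span_subspace[OF nc]]
  obtain i j x q where u: "u = (i, j, x, q)" by (metis prod_cases4)
  obtain j' x' q' where v: "v = (i, j', x', q')" using uv(3) u by (cases v) auto
  have I: "i \<in> K" "j \<in> L" "j' \<in> L" "x < m j" "x' < m j'" "q < a i j" "q' < a i j'"
    using uv u v by (auto simp: coords_def)
  have mj: "m j = m j'" and aj: "\<And>k. k \<in> K \<Longrightarrow> a k j = a k j'"
    using interchangeable_columnsD[OF C I(1-3)] I(6,7) by auto
  \<comment> \<open>The three transpositions together send \<open>v\<close> to \<open>u\<close>.
    They may be trivial, which covers \<open>u = v\<close> and \<open>j = j'\<close>. Using \<rho>
    in the block \<open>i\<close> only leaves the other multiplicities alone.\<close>
  define \<sigma> where "\<sigma> = transpose j j'"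
  define \<tau> where "\<tau> l = (if l = j \<or> l = j' then transpose x x' else id)" for l
  define \<rho> where "\<rho> k = (if k = i then transpose q q' else id)" for k
  define T where "T = (\<lambda>(k, l, y, p). (k, \<sigma> l, \<tau> l y, \<rho> k p))"
  define e where "e f g = (\<lambda>(k, l, y, p). f l y * g k p)" for f g :: "nat \<Rightarrow> nat \<Rightarrow> complex"
  have TI: "T w \<in> I" if "w \<in> I" for w
  proof -
    obtain k l y p where w: "w = (k, l, y, p)" by (metis prod_cases4)
    have W: "k \<in> K" "l \<in> L" "y < m l" "p < a k l" using that by (auto simp: w coords_def)
    have 1: "\<sigma> l \<in> L" using W I by (auto simp: \<sigma>_def transpose_def)
    have mx: "m (\<sigma> l) = m l" unfolding \<sigma>_def transpose_def by (simp add: mj)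
    have "x < m l" "x' < m l" if "l = j \<or> l = j'" using that I(4,5) mj by auto
    then have 2: "\<tau> l y < m (\<sigma> l)" unfolding mx using W(3) by (auto simp: \<tau>_def transpose_def)
    have 3: "a k (\<sigma> l) = a k l" using W aj by (auto simp: \<sigma>_def transpose_def)
    \<comment> \<open>A column \<open>l\<close> with coordinates in the block \<open>i\<close> meets
      \<open>j\<close> in the row \<open>i\<close>, so it has the multiplicity \<open>a i j\<close>,
      and both \<open>q\<close> and \<open>q'\<close> are legal there.\<close>
    have 4: "\<rho> k p < a k l"
    proof (cases "k = i")
      case True
      have "a i l = a i j" using C I W True unfolding interchangeable_columns_def
        by (metis gr_zeroI not_less0)
      moreover have "q < a i l" "q' < a i l" using I(6,7) aj[OF I(1)] calculation by simp_all
      ultimately show ?thesis using W(4) True by (auto simp: \<rho>_def transpose_def)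
    qed (use W in \<open>auto simp: \<rho>_def\<close>)
    show ?thesis using W 1 2 3 4 by (auto simp: w T_def coords_def)
  qed
  have mem: "signed_perm T (e f g) \<in> ?S"
    if "\<And>l y. f l y = 1 \<or> f l y = -1" "\<And>k p. g k p = 1 \<or> g k p = -1" for f g
  proof -
    have "signed_perm T (e f g) \<in> normalizer N smallB bigA"
      unfolding T_def e_def
      by (rule swap_normalizer)
        (use TI in \<open>simp_all add: T_def\<close>, simp_all add: \<sigma>_def \<tau>_def \<rho>_def that) 
    then show ?thesis using mat_span_superset[OF nc] by blast
  qed
  \<comment> \<open>The four matrices combine to the factor (1 - f)(1 - g)/4 on the permutation. It
    vanishes unless \<open>l = j'\<close>, \<open>y = x'\<close>, \<open>k = i\<close> and
    \<open>p = q'\<close>, which is the column \<open>v\<close>, and is 1 there.\<close>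
  define f where "f l y = (if l = j' \<and> y = x' then -1 else 1 :: complex)" for l y
  define g where "g k p = (if k = i \<and> p = q' then -1 else 1 :: complex)" for k p
  let ?o = "\<lambda>_ _. 1 :: complex"
  have "(1/4) \<cdot>\<^sub>m (signed_perm T (e ?o ?o) + (-1) \<cdot>\<^sub>m signed_perm T (e f ?o)
      + (-1) \<cdot>\<^sub>m signed_perm T (e ?o g) + signed_perm T (e f g)) \<in> ?S"
    by (intro sub(3,4) mem) (auto simp: f_def g_def)
  also have "(1/4) \<cdot>\<^sub>m (signed_perm T (e ?o ?o) + (-1) \<cdot>\<^sub>m signed_perm T (e f ?o)
      + (-1) \<cdot>\<^sub>m signed_perm T (e ?o g) + signed_perm T (e f g))
    = lm (\<lambda>u' v'. if u' = u \<and> v' = v then 1 else 0)"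
    unfolding signed_perm_def labelled_mat_smult labelled_mat_add
  proof (rule lm_eqI)
    fix u' v' assume "u' \<in> I" "v' \<in> I"
    have Tv: "T v = u" by (auto simp: T_def u v \<sigma>_def \<tau>_def \<rho>_def)
    obtain k l y p where v': "v' = (k, l, y, p)" by (metis prod_cases4)
    show "1/4 * ((if u' = T v' then e ?o ?o v' else 0) + - 1 * (if u' = T v' then e f ?o v' else 0) +
           - 1 * (if u' = T v' then e ?o g v' else 0) + (if u' = T v' then e f g v' else 0))
        = (if u' = u \<and> v' = v then 1 else 0)"
    proof (cases "v' = v")
      case True
      then show ?thesis by (simp add: Tv) (simp add: e_def f_def g_def v)
    next
      case False
      then show ?thesis by (auto simp: e_def f_def g_def v v')
    qed
  qed
  finally show ?thesis .
qed

theorem interchangeable_imp_regular: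
  assumes C: "interchangeable_columns K L m a"
  shows "regular_inclusion N smallB bigA"
proof -
  let ?S = "mat_span N (normalizer N smallB bigA)"
  have nA: "normalizer N smallB bigA \<subseteq> bigA" by (auto simp: normalizer_def)
  have nc: "normalizer N smallB bigA \<subseteq> carrier_mat N N" using nA bigA_carrier by blast
  have "X \<in> ?S" if X: "X \<in> bigA" for X
  proof -
    obtain f where f: "X = lm f" "\<forall>u\<in>I. \<forall>v\<in>I. fst u \<noteq> fst v \<longrightarrow> f u v = 0"
      by (rule bigA_obtain[OF X])
    let ?E = "\<lambda>w. lm (\<lambda>u' v'. if u' = fst w \<and> v' = snd w then 1 else 0)"
    let ?J = "{w \<in> I \<times> I. fst (fst w) = fst (snd w)}"
    have "mat N N (\<lambda>p. \<Sum>w\<in>?J. f (fst w) (snd w) * ?E w $$ p) \<in> ?S"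
      by (rule mat_subspace_sum[OF mat_span_subspace[OF nc]])
        (use fin unit_in_span_normalizer[OF C] in auto)
    also have "mat N N (\<lambda>p. \<Sum>w\<in>?J. f (fst w) (snd w) * ?E w $$ p) = lm f"
    proof (rule eq_matI)
      fix g h assume "g < dim_row (lm f)" "h < dim_col (lm f)"
      then have gh: "g < N" "h < N" by auto
      have "(\<Sum>w\<in>?J. f (fst w) (snd w) * ?E w $$ (g, h))
          = (\<Sum>w\<in>?J. if w = (d g, d h) then f (d g) (d h) else 0)"
        using gh by (intro sum.cong) (auto simp: labelled_mat_def)
      also have "\<dots> = f (d g) (d h)"
        using gh fin f(2) by (auto simp: sum.delta)
      finally show "mat N N (\<lambda>p. \<Sum>w\<in>?J. f (fst w) (snd w) * ?E w $$ p) $$ (g, h) = lm f $$ (g, h)"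
        using gh by (simp add: labelled_mat_def)
    qed auto
    finally show ?thesis using f(1) by simp
  qed
  moreover have "?S \<subseteq> bigA"
    by (rule mat_span_minimal[OF unital_star_subalgebra_subspace[OF bigA_subalgebra] nA])
  ultimately show ?thesis by (auto simp: regular_inclusion_def)
qed

section \<open>Necessity: the action of a normalizing unitary on the centre of
  \<open>B\<close>\<close>

definition centre_coeff :: "nat set \<Rightarrow> nat \<Rightarrow> nat \<Rightarrow> nat \<Rightarrow> complex" where
  "centre_coeff S l y y' = (if l \<in> S \<and> y = y' then 1 else 0)"

text \<open>Indexed by sets of summands, because the conjugate of a minimal central projection is at
  first known only to be a sum of such projections.\<close>

definition centre_proj :: "nat set \<Rightarrow> complex mat" where "centre_proj S = lm (small_entry (centre_coeff S))"

lemma centre_proj_mult: "centre_proj S * lm f = lm (\<lambda>u v. if fst (snd u) \<in> S then f u v else 0)"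
  unfolding centre_proj_def lm_mult
proof (rule lm_eqI)
  fix u v assume uv: "u \<in> I" "v \<in> I"
  have "(\<Sum>w\<in>I. small_entry (centre_coeff S) u w * f w v)
      = (\<Sum>w\<in>I. if w = u then (if fst (snd u) \<in> S then f u v else 0) else 0)"
    by (intro sum.cong) (auto simp: small_entry_def centre_coeff_def split: prod.splits)
  then show "(\<Sum>w\<in>I. small_entry (centre_coeff S) u w * f w v) = (if fst (snd u) \<in> S then f u v else 0)"
    using \<open>u \<in> I\<close> fin by simp
qed

lemma mult_centre_proj: "lm f * centre_proj S = lm (\<lambda>u v. if fst (snd v) \<in> S then f u v else 0)"
  unfolding centre_proj_def lm_mult
proof (rule lm_eqI)
  fix u v assume uv: "u \<in> I" "v \<in> I"
  have "(\<Sum>w\<in>I. f u w * small_entry (centre_coeff S) w v)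
      = (\<Sum>w\<in>I. if w = v then (if fst (snd v) \<in> S then f u v else 0) else 0)"
    by (intro sum.cong) (auto simp: small_entry_def centre_coeff_def split: prod.splits)
  then show "(\<Sum>w\<in>I. f u w * small_entry (centre_coeff S) w v) = (if fst (snd v) \<in> S then f u v else 0)"
    using \<open>v \<in> I\<close> fin by simp
qed

lemma centre_proj_mult_small_entry: "centre_proj S * lm (small_entry c) = lm (small_entry (\<lambda>l y y'. if l \<in> S then c l y y' else 0))"
  unfolding centre_proj_mult by (rule lm_eqI) (auto simp: small_entry_def)

lemma centre_proj_centre_proj: "centre_proj S * centre_proj S' = centre_proj (S \<inter> S')"
  unfolding centre_proj_def[of S'] centre_proj_mult_small_entry unfolding centre_proj_def by (rule arg_cong[of _ _ "\<lambda>c. lm (small_entry c)"]) (auto simp: centre_coeff_def fun_eq_iff)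

lemma centre_proj_eq_iff: "centre_proj S = centre_proj S' \<longleftrightarrow> S \<inter> L = S' \<inter> L"
  unfolding centre_proj_def small_entry_eq_iff using m_pos by (auto simp: centre_coeff_def split: if_splits)

lemma small_entry_adjoint: "mat_adjoint (lm (small_entry c)) = lm (small_entry (\<lambda>l y y'. cnj (c l y' y)))"
  unfolding labelled_mat_adjoint by (rule lm_eqI) (auto simp: small_entry_def)

lemma centre_proj_smallB: "centre_proj S \<in> smallB"
  by (auto simp: centre_proj_def smallB_eq)

lemma centre_proj_carrier [simp]: "centre_proj S \<in> carrier_mat N N"
  by (simp add: centre_proj_def)

lemma coords_Sigma: "I = (SIGMA k:K. SIGMA l:L. {..<m l} \<times> {..<a k l})"
  by (auto simp: coords_def)

text \<open>The \<open>l\<close>-th summand of \<open>B\<close> occurs \<open>a k l\<close> times in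
  the block \<open>k\<close>. Through these block traces the inclusion matrix becomes accessible to
  conjugation.\<close>

lemma trace_block_proj_small_entry:
  assumes "k \<in> K"
  shows "mat_trace (block_proj k * lm (small_entry c)) = (\<Sum>l\<in>L. of_nat (a k l) * (\<Sum>y<m l. c l y y))"
proof -
  have "mat_trace (block_proj k * lm (small_entry c)) = (\<Sum>u\<in>I. if fst u = k then small_entry c u u else 0)"
    unfolding block_proj_mult lm_trace ..
  also have "\<dots> = (\<Sum>(k', l, y, p)\<in>I. if k' = k then c l y y else 0)"
    by (intro sum.cong) (auto simp: small_entry_def)
  also have "\<dots> = (\<Sum>k'\<in>K. \<Sum>l\<in>L. \<Sum>y<m l. \<Sum>p<a k' l. if k' = k then c l y y else 0)"
  proof -
    have "(\<Sum>(k', l, y, p)\<in>I. if k' = k then c l y y else 0)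
        = (\<Sum>k'\<in>K. \<Sum>(l, y, p)\<in>(SIGMA l:L. {..<m l} \<times> {..<a k' l}). if k' = k then c l y y else 0)"
      unfolding coords_Sigma by (subst sum.Sigma) (use finite_K finite_L in auto)
    also have "\<dots> = (\<Sum>k'\<in>K. \<Sum>l\<in>L. \<Sum>(y, p)\<in>{..<m l} \<times> {..<a k' l}. if k' = k then c l y y else 0)"
      by (intro sum.cong refl, subst sum.Sigma) (use finite_L in auto)
    finally show ?thesis by (simp only: sum.cartesian_product)
  qed
  also have "\<dots> = (\<Sum>k'\<in>K. if k' = k then (\<Sum>l\<in>L. of_nat (a k' l) * (\<Sum>y<m l. c l y y)) else 0)"
    by (intro sum.cong) (auto simp: sum_distrib_left)
  also have "\<dots> = (\<Sum>l\<in>L. of_nat (a k l) * (\<Sum>y<m l. c l y y))"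
    using assms finite_K by simp
  finally show ?thesis .
qed

lemma trace_block_proj_centre_proj: "k \<in> K \<Longrightarrow> j \<in> L \<Longrightarrow> mat_trace (block_proj k * centre_proj {j}) = of_nat (a k j * m j)"
  unfolding centre_proj_def trace_block_proj_small_entry using finite_L
  by (simp add: centre_coeff_def if_distrib[of "(*) x" for x] cong: if_cong)

lemma normalizerD:
  assumes "U \<in> normalizer N smallB bigA"
  shows "U \<in> bigA" "U \<in> carrier_mat N N" "mat_adjoint U \<in> carrier_mat N N"
    "U * mat_adjoint U = 1\<^sub>m N" "mat_adjoint U * U = 1\<^sub>m N"
    "X \<in> carrier_mat N N \<Longrightarrow> mat_adjoint U * (U * X) = X"
    "X \<in> carrier_mat N N \<Longrightarrow> U * (mat_adjoint U * X) = X"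
    "X \<in> smallB \<Longrightarrow> U * X * mat_adjoint U \<in> smallB"
    "X \<in> smallB \<Longrightarrow> mat_adjoint U * X * U \<in> smallB"
proof -
  have U: "U \<in> bigA" "U * mat_adjoint U = 1\<^sub>m N" "mat_adjoint U * U = 1\<^sub>m N"
    "(\<lambda>X. U * X * mat_adjoint U) ` smallB = smallB" using assms by (auto simp: normalizer_def)
  then show "U \<in> bigA" "U * mat_adjoint U = 1\<^sub>m N" "mat_adjoint U * U = 1\<^sub>m N" by auto
  show c: "U \<in> carrier_mat N N" using U(1) bigA_carrier by blast
  then show c': "mat_adjoint U \<in> carrier_mat N N" by simp
  show c1: "mat_adjoint U * (U * X) = X" if "X \<in> carrier_mat N N" for X
    using U(3) c c' that square_mult_assoc[OF c' c that] by simp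
  show c2: "U * (mat_adjoint U * X) = X" if "X \<in> carrier_mat N N" for X
    using U(2) c c' that square_mult_assoc[OF c c' that] by simp
  show "X \<in> smallB \<Longrightarrow> U * X * mat_adjoint U \<in> smallB" using U(4) by blast
  assume "X \<in> smallB"
  then obtain Y where Y: "Y \<in> smallB" "X = U * Y * mat_adjoint U" using U(4) by blast
  have Yc: "Y \<in> carrier_mat N N" using Y(1) smallB_carrier by blast
  have "mat_adjoint U * X * U = Y"
    unfolding Y(2) using c c' Yc U(3) by (simp add: square_mat_simps[where N = N] c1)
  then show "mat_adjoint U * X * U \<in> smallB" using Y(1) by simp
qed

lemma adjoint_normalizer:
  assumes "U \<in> normalizer N smallB bigA"
  shows "mat_adjoint U \<in> normalizer N smallB bigA"
  using normalizerD[OF assms] unital_star_subalgebraD(7)[OF bigA_subalgebra]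
  by (intro normalizer_memI) simp_all

text \<open>\<open>U\<close> lies in \<open>A\<close> and so commutes with its central projections;
  the rest is cyclicity of the trace.\<close>

lemma trace_block_proj_conj:
  assumes U: "U \<in> normalizer N smallB bigA" and X: "X \<in> carrier_mat N N"
  shows "mat_trace (block_proj k * (U * X * mat_adjoint U)) = mat_trace (block_proj k * X)"
proof -
  note u = normalizerD[OF U]
  note a = square_mat_simps[where N = N] u(2-7) X
  have "block_proj k * (U * X * mat_adjoint U) = block_proj k * U * (X * mat_adjoint U)"
    by (simp add: a)
  also have "\<dots> = U * (block_proj k * X * mat_adjoint U)"
    unfolding block_proj_commute[OF u(1)] by (simp add: a)
  finally have "mat_trace (block_proj k * (U * X * mat_adjoint U)) = mat_trace (block_proj k * X * (mat_adjoint U * U))"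
    using mat_trace_commute[OF u(2), of "block_proj k * X * mat_adjoint U"] by (simp add: a)
  then show ?thesis by (simp add: a u(5))
qed

text \<open>Commuting with the matrix unit at \<open>(x, z)\<close> of a summand, read at the entry
  \<open>(y, z)\<close>, makes \<open>c l\<close> a scalar matrix; idempotence then leaves only the
  scalars 0 and 1.\<close>

lemma small_entry_central_idempotent:
  assumes comm: "\<And>c'. lm (small_entry c) * lm (small_entry c') = lm (small_entry c') * lm (small_entry c)"
    and idem: "lm (small_entry c) * lm (small_entry c) = lm (small_entry c)"
  shows "\<exists>S. lm (small_entry c) = centre_proj S"
proof -
  have diag: "c l y x = (if y = x then c l z z else 0)" if l: "l \<in> L" "x < m l" "y < m l" "z < m l" for l x y z
  proof -
    let ?e = "\<lambda>l' w w'. if l' = l \<and> w = x \<and> w' = z then 1 else 0 :: complex"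
    have "(\<Sum>w<m l. c l y w * ?e l w z) = (\<Sum>w<m l. ?e l y w * c l w z)"
      using comm[of ?e] l unfolding small_entry_mult small_entry_eq_iff by blast
    also have "(\<Sum>w<m l. c l y w * ?e l w z) = (\<Sum>w<m l. if w = x then c l y w else 0)"
      by (intro sum.cong) auto
    also have "(\<Sum>w<m l. ?e l y w * c l w z) = (\<Sum>w<m l. if w = z then (if y = x then c l w z else 0) else 0)"
      by (intro sum.cong) auto
    finally show ?thesis using l by simp
  qed
  define S where "S = {l. c l 0 0 = 1}"
  have "c l 0 0 = 0 \<or> c l 0 0 = 1" if l: "l \<in> L" for l
  proof -
    have "(\<Sum>w<m l. c l 0 w * c l w 0) = c l 0 0"
      using idem l m_pos[OF l] unfolding small_entry_mult small_entry_eq_iff by blast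
    also have "(\<Sum>w<m l. c l 0 w * c l w 0) = (\<Sum>w<m l. if w = 0 then c l 0 0 * c l 0 0 else 0)"
    proof (intro sum.cong refl)
      fix w assume "w \<in> {..<m l}"
      then show "c l 0 w * c l w 0 = (if w = 0 then c l 0 0 * c l 0 0 else 0)"
        using diag[OF l _ m_pos[OF l] m_pos[OF l], of w] by (cases "w = 0") simp_all
    qed
    finally show ?thesis using m_pos[OF l] by simp
  qed
  then have "c l y y' = centre_coeff S l y y'" if "l \<in> L" "y < m l" "y' < m l" for l y y'
    using diag[OF that(1,3,2) m_pos[OF that(1)]] that(1) by (auto simp: centre_coeff_def S_def)
  then have "lm (small_entry c) = centre_proj S" unfolding centre_proj_def small_entry_eq_iff by blast
  then show ?thesis ..
qed

text \<open>Conjugation by \<open>U\<close> is an automorphism of \<open>B\<close>, so it preserves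
  central idempotents.\<close>

lemma conj_centre_proj:
  assumes U: "U \<in> normalizer N smallB bigA"
  shows "\<exists>S'. U * centre_proj S * mat_adjoint U = centre_proj S'"
proof -
  note u = normalizerD[OF U]
  note a = square_mat_simps[where N = N] u(2-7)
  obtain c where c: "U * centre_proj S * mat_adjoint U = lm (small_entry c)"
    using u(8)[OF centre_proj_smallB] by (auto simp: smallB_eq)
  have "lm (small_entry c) * lm (small_entry c') = lm (small_entry c') * lm (small_entry c)" for c'
  proof -
    let ?X = "lm (small_entry c')"
    have "mat_adjoint U * ?X * U \<in> smallB" by (rule u(9)) (auto simp: smallB_eq)
    then obtain c2 where c2: "mat_adjoint U * ?X * U = lm (small_entry c2)" by (auto simp: smallB_eq)
    have X: "?X = U * lm (small_entry c2) * mat_adjoint U" unfolding c2[symmetric] by (simp add: a)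
    have z: "centre_proj S * lm (small_entry c2) = lm (small_entry c2) * centre_proj S"
      unfolding centre_proj_mult mult_centre_proj by (rule lm_eqI) (auto simp: small_entry_def)
    have "lm (small_entry c) * ?X = U * (centre_proj S * lm (small_entry c2)) * mat_adjoint U"
      unfolding X c[symmetric] by (simp add: a)
    also have "\<dots> = ?X * lm (small_entry c)"
      unfolding z X c[symmetric] by (simp add: a)
    finally show ?thesis .
  qed
  moreover have "lm (small_entry c) * lm (small_entry c) = U * (centre_proj S * centre_proj S) * mat_adjoint U"
    unfolding c[symmetric] by (simp add: a)
  then have "lm (small_entry c) * lm (small_entry c) = lm (small_entry c)" by (simp add: centre_proj_centre_proj c)
  ultimately show ?thesis unfolding c by (rule small_entry_central_idempotent)
qed

text \<open>The nonzero entry shows that the image of the \<open>j\<close>-th central projection is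
  not orthogonal to the \<open>j'\<close>-th, hence lies above it. Pulled back, the
  \<open>j'\<close>-th becomes a nonzero central projection below the minimal \<open>j\<close>-th
  one, and so equals it.\<close>

lemma conj_centre_proj_singleton:
  assumes U: "U \<in> normalizer N smallB bigA" and Uf: "U = lm f"
    and uv: "u \<in> I" "v \<in> I" "f u v \<noteq> 0"
  shows "U * centre_proj {fst (snd v)} * mat_adjoint U = centre_proj {fst (snd u)}"
proof -
  note n = normalizerD[OF U]
  note a = square_mat_simps[where N = N] n(2-7)
  define j j' where "j = fst (snd v)" and "j' = fst (snd u)"
  have jL: "j \<in> L" "j' \<in> L" using uv by (auto simp: j_def j'_def coords_def)
  obtain S where S: "U * centre_proj {j} * mat_adjoint U = centre_proj S" using conj_centre_proj[OF U] by blast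
  obtain S' where S': "mat_adjoint U * centre_proj {j'} * U = centre_proj S'"
    using conj_centre_proj[OF adjoint_normalizer[OF U], of "{j'}"] by auto
  have SU: "centre_proj S * U = U * centre_proj {j}" unfolding S[symmetric] by (simp add: a)
  have "j' \<in> S"
  proof (rule ccontr)
    assume "j' \<notin> S"
    \<comment> \<open>If \<open>j'\<close> were outside \<open>S\<close>, cutting \<open>U\<close>
      down by the two central projections would give zero; but the entry \<open>(u, v)\<close>
      survives this cut.\<close>
    have "centre_proj {j'} * (centre_proj S * U) = centre_proj {j'} * centre_proj S * U" by (simp add: a)
    also have "\<dots> = centre_proj {} * U" using \<open>j' \<notin> S\<close> by (simp add: centre_proj_centre_proj)
    finally have "centre_proj {j'} * (U * centre_proj {j}) = centre_proj {} * U" by (simp add: SU)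
    then have "(if fst (snd u) \<in> {j'} then if fst (snd v) \<in> {j} then f u v else 0 else 0) = 0"
      using uv(1,2) unfolding Uf mult_centre_proj centre_proj_mult lm_eq_iff by fastforce
    then show False using uv(3) by (simp add: j_def j'_def)
  qed
  then have "centre_proj {j'} * centre_proj S = centre_proj {j'}" by (simp add: centre_proj_centre_proj Int_absorb2)
  then have "mat_adjoint U * centre_proj {j'} * U = mat_adjoint U * (centre_proj {j'} * centre_proj S) * U" by simp
  also have "\<dots> = mat_adjoint U * centre_proj {j'} * (centre_proj S * U)" by (simp add: a)
  also have "\<dots> = centre_proj S' * centre_proj {j}" unfolding SU S'[symmetric] by (simp add: a)
  finally have "centre_proj S' = centre_proj (S' \<inter> {j})" unfolding S' centre_proj_centre_proj .
  then have "S' \<inter> L \<subseteq> {j}" unfolding centre_proj_eq_iff by blast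
  moreover have Z: "centre_proj {j'} = U * centre_proj S' * mat_adjoint U" unfolding S'[symmetric] by (simp add: a)
  have "S' \<inter> L \<noteq> {}"
  proof
    assume "S' \<inter> L = {}"
    then have S'e: "centre_proj S' = centre_proj {}" by (simp add: centre_proj_eq_iff)
    have "centre_proj {} = 0\<^sub>m N N"
      by (rule eq_matI) (auto simp: centre_proj_def labelled_mat_def small_entry_def centre_coeff_def split: prod.splits)
    then have "centre_proj {j'} = centre_proj {}" using Z n(2,3) by (simp add: S'e)
    then show False using jL by (auto simp: centre_proj_eq_iff)
  qed
  ultimately have "centre_proj S' = centre_proj {j}" using jL(1) unfolding centre_proj_eq_iff by blast
  then show ?thesis using Z by (simp add: j_def j'_def)
qed

text \<open>The unitary moves a minimal projection of the \<open>j\<close>-th summand of \<open>B\<close> to a projection of rank \<open>t\<close> in the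
  \<open>j'\<close>-th.\<close>

lemma column_proportional:
  assumes U: "U \<in> normalizer N smallB bigA" and jL: "j \<in> L" "j' \<in> L"
    and z: "U * centre_proj {j} * mat_adjoint U = centre_proj {j'}"
  shows "\<exists>t>0. \<forall>k\<in>K. a k j = a k j' * t"
proof -
  note n = normalizerD[OF U]
  note as = square_mat_simps[where N = N] n(2-7)
  \<comment> \<open>A minimal projection of the \<open>j\<close>-th summand of
    \<open>B\<close>.\<close>
  define e where "e = small_entry (\<lambda>l y y'. if l = j \<and> y = 0 \<and> y' = 0 then 1 else 0)"
  have eB: "lm e \<in> smallB" by (auto simp: e_def smallB_eq)
  obtain c where c: "U * lm e * mat_adjoint U = lm (small_entry c)" using n(8)[OF eB] by (auto simp: smallB_eq)
  have "centre_proj {j} * lm e = lm e" unfolding e_def centre_proj_mult_small_entry by (intro arg_cong[of _ _ "\<lambda>c. lm (small_entry c)"]) (auto simp: fun_eq_iff)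
  moreover have "centre_proj {j'} * lm (small_entry c) = U * (centre_proj {j} * lm e) * mat_adjoint U"
    unfolding z[symmetric] c[symmetric] by (simp add: as)
  ultimately have "centre_proj {j'} * lm (small_entry c) = lm (small_entry c)" by (simp only: c)
  then have c0: "c l y y' = 0" if "l \<in> L" "y < m l" "y' < m l" "l \<noteq> j'" for l y y'
    using that unfolding centre_proj_mult_small_entry small_entry_eq_iff by fastforce
  have ee: "lm e * lm e = lm e"
    unfolding e_def small_entry_mult small_entry_eq_iff using m_pos by (auto simp: if_distrib[of "\<lambda>x. x * _"] if_distrib[of "(*) x" for x] cong: if_cong)
  have ea: "mat_adjoint (lm e) = lm e"
    unfolding labelled_mat_adjoint by (rule lm_eqI) (auto simp: e_def small_entry_def)
  \<comment> \<open>By \<open>c0\<close> the image of \<open>e\<close> lives in the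
    \<open>j'\<close>-th summand alone; \<open>?Q\<close> is its component there, a nonzero
    projection of rank \<open>t\<close>.\<close>
  let ?Q = "mat (m j') (m j') (\<lambda>(y, y'). c j' y y')"
  have Q: "?Q \<in> carrier_mat (m j') (m j')" by simp
  have "lm (small_entry c) * lm (small_entry c) = U * (lm e * lm e) * mat_adjoint U"
    unfolding c[symmetric] by (simp add: as)
  then have "lm (small_entry c) * lm (small_entry c) = lm (small_entry c)" unfolding ee c .
  then have cc: "(\<Sum>z<m j'. c j' y z * c j' z y') = c j' y y'" if "y < m j'" "y' < m j'" for y y'
    using that jL unfolding small_entry_mult small_entry_eq_iff by blast
  have "mat_adjoint (lm (small_entry c)) = lm (small_entry c)"
    unfolding c[symmetric] by (simp add: mat_adjoint_mult[of _ N N _ N] as ea)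
  then have "lm (small_entry (\<lambda>l y y'. cnj (c l y' y))) = lm (small_entry c)"
    unfolding small_entry_adjoint .
  then have ca: "cnj (c j' y' y) = c j' y y'" if "y < m j'" "y' < m j'" for y y'
    using that jL unfolding small_entry_eq_iff by blast
  have "?Q * ?Q = ?Q"
  proof (rule eq_matI)
    fix y y' assume "y < dim_row ?Q" "y' < dim_col ?Q"
    then have y: "y < m j'" "y' < m j'" by auto
    show "(?Q * ?Q) $$ (y, y') = ?Q $$ (y, y')" unfolding mat_mult_index[OF Q Q y] using y cc by simp
  qed auto
  moreover have "mat_adjoint ?Q = ?Q" by (rule eq_matI) (auto simp: ca)
  ultimately obtain t where t: "mat_trace ?Q = of_nat t" "?Q \<noteq> 0\<^sub>m (m j') (m j') \<longrightarrow> 0 < t"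
    using projection_trace[OF Q] by blast
  have "?Q \<noteq> 0\<^sub>m (m j') (m j')"
  proof
    assume q: "?Q = 0\<^sub>m (m j') (m j')"
    have "c j' y y' = 0" if y: "y < m j'" "y' < m j'" for y y'
      using arg_cong[OF q, of "\<lambda>M. M $$ (y, y')"] y by simp
    then have "lm (small_entry c) = lm (small_entry (\<lambda>_ _ _. 0))" unfolding small_entry_eq_iff using c0 by metis
    also have "\<dots> = 0\<^sub>m N N"
      by (rule eq_matI) (auto simp: labelled_mat_def small_entry_def split: prod.splits)
    finally have "mat_adjoint U * (U * lm e * mat_adjoint U) * U = 0\<^sub>m N N" unfolding c using n(2,3) by simp
    then have "lm e = 0\<^sub>m N N" by (simp add: as)
    also have "\<dots> = lm (small_entry (\<lambda>_ _ _. 0))"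
      by (rule eq_matI) (auto simp: labelled_mat_def small_entry_def split: prod.splits)
    finally show False unfolding e_def small_entry_eq_iff using jL(1) m_pos[OF jL(1)] by fastforce
  qed
  then have "0 < t" using t by blast
  \<comment> \<open>In the block \<open>k\<close> the projection \<open>e\<close> has trace
    \<open>a k j\<close> and its image has trace \<open>a k j' * t\<close>; conjugation preserves
    this trace.\<close>
  moreover have "a k j = a k j' * t" if k: "k \<in> K" for k
  proof -
    have "mat_trace (block_proj k * lm (small_entry c)) = mat_trace (block_proj k * lm e)"
      unfolding c[symmetric] by (rule trace_block_proj_conj[OF U]) simp
    moreover have "mat_trace (block_proj k * lm (small_entry c)) = of_nat (a k j' * t)"
    proof -
      have "(\<Sum>y<m l. c l y y) = (if l = j' then of_nat t else 0)" if "l \<in> L" for l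
        using c0[OF that] t(1) by (auto simp: mat_trace_def)
      then show ?thesis unfolding trace_block_proj_small_entry[OF k] using finite_L jL by (simp add: if_distrib[of "(*) x" for x] cong: sum.cong_simp if_cong)
    qed
    moreover have "mat_trace (block_proj k * lm e) = of_nat (a k j)"
    proof -
      have "(\<Sum>y<m l. if l = j \<and> y = 0 \<and> y = 0 then 1 else 0) = (if l = j then 1 else 0 :: complex)" if "l \<in> L" for l
        using m_pos[OF that] by (cases "l = j") auto
      then show ?thesis unfolding e_def trace_block_proj_small_entry[OF k] using finite_L jL by (simp add: if_distrib[of "(*) x" for x] cong: sum.cong_simp if_cong)
    qed
    ultimately show ?thesis using of_nat_eq_iff by metis
  qed
  ultimately show ?thesis by blast
qed

theorem regular_imp_interchangeable:
  assumes reg: "regular_inclusion N smallB bigA"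
  shows "interchangeable_columns K L m a"
  unfolding interchangeable_columns_def
proof (intro ballI impI)
  fix i j j' assume i: "i \<in> K" "j \<in> L" "j' \<in> L" "0 < a i j" "0 < a i j'"
  let ?u = "(i, j', 0, 0) :: coord" and ?v = "(i, j, 0, 0) :: coord"
  have uv: "?u \<in> I" "?v \<in> I" using i m_pos by (auto simp: coords_def)
  obtain g h where gh: "g < N" "h < N" "d g = ?u" "d h = ?v" using uv label_ex by metis
  let ?n = "normalizer N smallB bigA"
  have nA: "?n \<subseteq> bigA" by (auto simp: normalizer_def)
  \<comment> \<open>If all normalizing unitaries vanished at this entry, so would their span, which
    is \<open>A\<close>; but \<open>A\<close> contains the matrix unit at that entry.\<close>
  have "\<exists>U\<in>?n. U $$ (g, h) \<noteq> 0"
  proof (rule ccontr)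
    assume no: "\<not> ?thesis"
    let ?V = "{X \<in> carrier_mat N N. X $$ (g, h) = 0}"
    have "mat_subspace N ?V" using gh by (auto simp: mat_subspace_def)
    moreover have "?n \<subseteq> ?V" using no nA bigA_carrier by blast
    ultimately have "bigA \<subseteq> ?V" using mat_span_minimal reg unfolding regular_inclusion_def by blast
    moreover have "lm (\<lambda>u v. if u = ?u \<and> v = ?v then 1 else 0) \<in> bigA" by (auto simp: bigA_iff)
    ultimately have "lm (\<lambda>u v. if u = ?u \<and> v = ?v then 1 else 0) $$ (g, h) = 0" by blast
    then show False using gh by (simp add: labelled_mat_def)
  qed
  then obtain U where U: "U \<in> ?n" "U $$ (g, h) \<noteq> 0" by blast
  note n = normalizerD[OF U(1)]
  obtain f where f: "U = lm f" using lm_surj[OF n(2)] by blast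
  have "f ?u ?v \<noteq> 0" using U(2) gh unfolding f by (simp add: labelled_mat_def)
  from conj_centre_proj_singleton[OF U(1) f uv this] have z: "U * centre_proj {j} * mat_adjoint U = centre_proj {j'}" by simp
  have z': "mat_adjoint U * centre_proj {j'} * mat_adjoint (mat_adjoint U) = centre_proj {j}"
    unfolding z[symmetric] by (simp add: square_mat_simps[where N = N] n(2-7))
  obtain t where t: "t > 0" "\<forall>k\<in>K. a k j = a k j' * t"
    using column_proportional[OF U(1) i(2,3) z] by blast
  obtain t' where t': "t' > 0" "\<forall>k\<in>K. a k j' = a k j * t'"
    using column_proportional[OF adjoint_normalizer[OF U(1)] i(3,2) z'] by blast
  \<comment> \<open>\<open>t\<close> and \<open>t'\<close> are at least 1, so each of the two
    entries is at least the other.\<close>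
  have eq: "a k j = a k j'" if "k \<in> K" for k
    using t t' that by (metis le_antisym mult.commute mult_le_mono2 nat_mult_1_right Suc_leI One_nat_def mult_1)
  \<comment> \<open>The trace of a whole central projection in the block \<open>i\<close> is
    multiplicity times size; with equal nonzero multiplicities the sizes agree.\<close>
  have "mat_trace (block_proj i * centre_proj {j'}) = mat_trace (block_proj i * centre_proj {j})"
    unfolding z[symmetric] by (rule trace_block_proj_conj[OF U(1)]) simp
  then have "a i j' * m j' = a i j * m j" unfolding trace_block_proj_centre_proj[OF i(1,3)] trace_block_proj_centre_proj[OF i(1,2)] by (simp only: of_nat_eq_iff)
  then have "m j = m j'" using eq[OF i(1)] i by simp
  then show "m j = m j' \<and> (\<forall>k\<in>K. a k j = a k j')" using eq by blast
qed

theorem regular_iff_interchangeable: "regular_inclusion N smallB bigA \<longleftrightarrow> interchangeable_columns K L m a"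
  using regular_imp_interchangeable interchangeable_imp_regular by blast

end

section \<open>Block diagonal matrices and standard embeddings\<close>

definition offset :: "(nat \<Rightarrow> nat) \<Rightarrow> nat \<Rightarrow> nat" where
  "offset n k = (\<Sum>i<k. n i)"

lemma offset_simps [simp]: "offset n 0 = 0" "offset n (Suc k) = offset n k + n k"
  by (simp_all add: offset_def)

lemma offset_mono: "i \<le> k \<Longrightarrow> offset n i \<le> offset n k"
  unfolding offset_def by (rule sum_mono2) auto

lemma offset_less: "i < k \<Longrightarrow> u < n i \<Longrightarrow> offset n i + u < offset n k"
  using offset_mono[of "Suc i" k n] by simp

lemma offset_inj:
  assumes "u < n i" "u' < n i'" "offset n i + u = offset n i' + u'"
  shows "i = i' \<and> u = u'"
proof -
  have "\<not> i < i'" using offset_less[of i i' u n] assms by linarith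
  moreover have "\<not> i' < i" using offset_less[of i' i u' n] assms by linarith
  ultimately show ?thesis using assms(3) by simp
qed

lemma offset_surj:
  assumes "g < offset n s"
  shows "\<exists>i<s. \<exists>u<n i. g = offset n i + u"
  using assms
proof (induction s)
  case (Suc s)
  show ?case
  proof (cases "g < offset n s")
    case True
    then show ?thesis using Suc.IH less_Suc_eq by blast
  next
    case False
    then show ?thesis using Suc.prems by (intro exI[of _ s] conjI exI[of _ "g - offset n s"]) auto
  qed
qed simp

text \<open>The enumerations \<open>e i\<close> of the blocks are arbitrary, so that the lemma can
  be nested: blocks of \<open>A\<close> outside, summands of \<open>B\<close> inside a
  block.\<close>

lemma offset_bij:
  assumes "\<And>i. i < s \<Longrightarrow> bij_betw (e i) (J i) {..<n i}"
  shows "bij_betw (\<lambda>(i, x). offset n i + e i x) (SIGMA i:{..<s}. J i) {..<offset n s}"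
proof -
  have lt: "e i x < n i" if "i < s" "x \<in> J i" for i x
    using assms[OF that(1)] that(2) by (auto simp: bij_betw_def)
  have inj: "x = x'" if "i < s" "x \<in> J i" "x' \<in> J i" "e i x = e i x'" for i x x'
    using assms[OF that(1)] that by (auto simp: bij_betw_def inj_on_def)
  have surj: "\<exists>x\<in>J i. e i x = u" if "i < s" "u < n i" for i u
    using assms[OF that(1)] that(2) unfolding bij_betw_def by (metis imageE lessThan_iff)
  show ?thesis
  proof (rule bij_betwI')
    fix u v assume uv: "u \<in> (SIGMA i:{..<s}. J i)" "v \<in> (SIGMA i:{..<s}. J i)"
    obtain i x i' x' where e: "u = (i, x)" "v = (i', x')" by (metis surj_pair)
    then have *: "i < s" "x \<in> J i" "i' < s" "x' \<in> J i'" using uv by auto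
    have "i = i' \<and> x = x'" if "offset n i + e i x = offset n i' + e i' x'"
      using offset_inj[of "e i x" n i "e i' x'" i', OF lt[OF *(1,2)] lt[OF *(3,4)] that] inj * by auto
    then show "((case u of (i, x) \<Rightarrow> offset n i + e i x) = (case v of (i, x) \<Rightarrow> offset n i + e i x)) = (u = v)"
      by (auto simp: e)
  next
    fix u assume "u \<in> (SIGMA i:{..<s}. J i)"
    then show "(case u of (i, x) \<Rightarrow> offset n i + e i x) \<in> {..<offset n s}"
      using offset_less lt by auto
  next
    fix g assume "g \<in> {..<offset n s}"
    then obtain i u where iu: "i < s" "u < n i" "g = offset n i + u" using offset_surj by blast
    obtain x where "x \<in> J i" "e i x = u" using surj[OF iu(1,2)] by blast
    then show "\<exists>w\<in>SIGMA i:{..<s}. J i. g = (case w of (i, x) \<Rightarrow> offset n i + e i x)"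
      using iu by (intro bexI[of _ "(i, x)"]) auto
  qed
qed

lemma block_diag_Suc:
  "block_diag (Suc s) X =
     (let D = block_diag s X in four_block_mat D (0\<^sub>m (dim_row D) (dim_col (X s))) (0\<^sub>m (dim_row (X s)) (dim_col D)) (X s))"
  by (simp add: block_diag_def diag_block_mat_last)

lemma block_diag_carrier:
  assumes "\<And>i. i < s \<Longrightarrow> X i \<in> carrier_mat (n i) (n i)"
  shows "block_diag s X \<in> carrier_mat (offset n s) (offset n s)"
  using assms
proof (induction s)
  case 0
  then show ?case by (simp add: block_diag_def)
next
  case (Suc s)
  then have "block_diag s X \<in> carrier_mat (offset n s) (offset n s)" "X s \<in> carrier_mat (n s) (n s)" by simp_all
  then show ?case by (simp add: block_diag_Suc Let_def)
qed

lemma block_diag_index: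
  assumes "\<And>i. i < s \<Longrightarrow> X i \<in> carrier_mat (n i) (n i)"
    and "i < s" "i' < s" "u < n i" "u' < n i'"
  shows "block_diag s X $$ (offset n i + u, offset n i' + u') = (if i = i' then X i $$ (u, u') else 0)"
  using assms
proof (induction s)
  case (Suc s)
  have D: "block_diag s X \<in> carrier_mat (offset n s) (offset n s)"
    using Suc.prems by (intro block_diag_carrier) auto
  have S: "X s \<in> carrier_mat (n s) (n s)" using Suc.prems by auto
  have lt: "offset n i + u < offset n (Suc s)" "offset n i' + u' < offset n (Suc s)"
    using Suc.prems offset_less by blast+
  have in1: "i < s \<Longrightarrow> offset n i + u < offset n s" "i' < s \<Longrightarrow> offset n i' + u' < offset n s"
    using Suc.prems offset_less by blast+
  consider "i < s" "i' < s" | "i < s" "i' = s" | "i = s" "i' < s" | "i = s" "i' = s"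
    using Suc.prems by linarith
  then show ?case
    using D carrier_matD[OF S] lt in1 Suc.prems(2-) Suc.IH[OF Suc.prems(1)]
    by cases (simp_all add: block_diag_Suc Let_def)
qed simp

text \<open>Concrete block matrices come with a map from labels to positions; the labelling is its
  inverse.\<close>

lemma labelled_mat_inv_intoI:
  assumes enc: "bij_betw enc I {..<N}" and M: "M \<in> carrier_mat N N"
    and eq: "\<And>u v. u \<in> I \<Longrightarrow> v \<in> I \<Longrightarrow> M $$ (enc u, enc v) = f u v"
  shows "M = labelled_mat N (inv_into I enc) f"
proof (rule eq_matI)
  fix g h assume "g < dim_row (labelled_mat N (inv_into I enc) f)" "h < dim_col (labelled_mat N (inv_into I enc) f)"
  then have gh: "g < N" "h < N" by auto
  have "inv_into I enc x \<in> I" "enc (inv_into I enc x) = x" if "x < N" for x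
    using enc that by (auto simp: bij_betw_def inv_into_into f_inv_into_f)
  then show "M $$ (g, h) = labelled_mat N (inv_into I enc) f $$ (g, h)"
    using gh eq[of "inv_into I enc g" "inv_into I enc h"] by (simp add: labelled_mat_def)
qed (use M in auto)

lemma block_alg_labelled:
  assumes e: "\<And>i. i < s \<Longrightarrow> bij_betw (e i) (J i) {..<n i}"
  shows "block_alg s n = labelled_alg (offset n s)
    (inv_into (SIGMA i:{..<s}. J i) (\<lambda>(i, x). offset n i + e i x)) big_pattern"
proof -
  let ?N = "offset n s" and ?I = "SIGMA i:{..<s}. J i" and ?enc = "\<lambda>(i, x). offset n i + e i x"
  let ?d = "inv_into ?I ?enc"
  note bij = offset_bij[of s e J n, OF e]
  have lt: "e i x < n i" if "i < s" "x \<in> J i" for i x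
    using e[OF that(1)] that(2) by (auto simp: bij_betw_def)
  show ?thesis
  proof (intro equalityI subsetI)
    fix M assume "M \<in> block_alg s n"
    then obtain X where X: "\<And>i. i < s \<Longrightarrow> X i \<in> carrier_mat (n i) (n i)" "M = block_diag s X"
      by (auto simp: block_alg_def summands_def)
    have "M = labelled_mat ?N ?d (\<lambda>u v. case big_pattern u v of None \<Rightarrow> 0 | Some x \<Rightarrow> (\<lambda>(u, v). X (fst u) $$ (e (fst u) (snd u), e (fst u) (snd v))) x)"
    proof (rule labelled_mat_inv_intoI[OF bij])
      show "M \<in> carrier_mat ?N ?N" unfolding X(2) by (rule block_diag_carrier[OF X(1)])
      fix u v assume uv: "u \<in> ?I" "v \<in> ?I"
      obtain i x i' x' where u: "u = (i, x)" "v = (i', x')" by (metis surj_pair)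
      then have *: "i < s" "x \<in> J i" "i' < s" "x' \<in> J i'" using uv by auto
      show "M $$ (?enc u, ?enc v) = (case big_pattern u v of None \<Rightarrow> 0 | Some x \<Rightarrow> (\<lambda>(u, v). X (fst u) $$ (e (fst u) (snd u), e (fst u) (snd v))) x)"
        using block_diag_index[OF X(1) *(1,3) lt[OF *(1,2)] lt[OF *(3,4)]]
        by (auto simp: u X(2) big_pattern_def)
    qed
    then show "M \<in> labelled_alg ?N ?d big_pattern" unfolding labelled_alg_def by blast
  next
    fix M assume "M \<in> labelled_alg ?N ?d big_pattern"
    then obtain c where M: "M = labelled_mat ?N ?d (\<lambda>u v. case big_pattern u v of None \<Rightarrow> 0 | Some x \<Rightarrow> c x)"
      by (auto simp: labelled_alg_def)
    define X where "X i = mat (n i) (n i) (\<lambda>(x, x'). c (?d (offset n i + x), ?d (offset n i + x')))" for i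
    have X: "X i \<in> carrier_mat (n i) (n i)" for i by (simp add: X_def)
    have "block_diag s X = M" unfolding M
    proof (rule labelled_mat_inv_intoI[OF bij])
      show "block_diag s X \<in> carrier_mat ?N ?N" by (rule block_diag_carrier[OF X])
      fix u v assume uv: "u \<in> ?I" "v \<in> ?I"
      obtain i x i' x' where u: "u = (i, x)" "v = (i', x')" by (metis surj_pair)
      then have *: "i < s" "x \<in> J i" "i' < s" "x' \<in> J i'" using uv by auto
      have d: "?d (?enc w) = w" if "w \<in> ?I" for w
        using bij that by (simp add: bij_betw_def)
      have "?d (offset n i + e i x) = u" "?d (offset n i' + e i' x') = v"
        using d[OF uv(1)] d[OF uv(2)] by (simp_all add: u)
      then show "block_diag s X $$ (?enc u, ?enc v) = (case big_pattern u v of None \<Rightarrow> 0 | Some x \<Rightarrow> c x)"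
        using block_diag_index[of s X n, OF X *(1,3) lt[OF *(1,2)] lt[OF *(3,4)]] lt[OF *(1,2)] lt[OF *(3,4)]
        by (auto simp: u X_def big_pattern_def)
    qed
    then show "M \<in> block_alg s n" using X by (auto simp: block_alg_def summands_def)
  qed
qed

section \<open>Kronecker products and the standard embedding in coordinates\<close>

lemma div_mod_bij: "bij_betw (\<lambda>(y, p). y * a + p) ({..<m} \<times> {..<a}) {..<m * a :: nat}"
proof (rule bij_betw_byWitness[where f' = "\<lambda>w. (w div a, w mod a)"])
  show "(\<lambda>(y, p). y * a + p) ` ({..<m} \<times> {..<a}) \<subseteq> {..<m * a}"
  proof safe
    fix y p assume "y < m" "p < a"
    then have "y * a + p < Suc y * a" "Suc y * a \<le> m * a" by (simp, intro mult_le_mono1, simp)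
    then show "y * a + p < m * a" by linarith
  qed
  show "(\<lambda>w. (w div a, w mod a)) ` {..<m * a} \<subseteq> {..<m} \<times> {..<a}"
  proof safe
    fix w assume "w < m * a"
    then show "w div a < m" "w mod a < a"
      by (simp add: less_mult_imp_div_less, cases "a = 0", auto)
  qed
qed auto

lemma kron_index:
  assumes "X \<in> carrier_mat m m" "Y \<in> carrier_mat a a" "y < m" "y' < m" "p < a" "p' < a"
  shows "kron X Y $$ (y * a + p, y' * a + p') = X $$ (y, y') * Y $$ (p, p')"
proof -
  have "y * a + p < m * a" "y' * a + p' < m * a"
    using div_mod_bij[of a m] assms(3-) unfolding bij_betw_def by force+
  then show ?thesis using assms by (simp add: kron_def)
qed

lemma kron_carrier: "X \<in> carrier_mat m m \<Longrightarrow> Y \<in> carrier_mat a a \<Longrightarrow> kron X Y \<in> carrier_mat (m * a) (m * a)"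
  by (auto simp: kron_def)

text \<open>The summands follow the nesting of \<open>standard_embedding\<close>: start of the block
  of \<open>A\<close>, start of the copy of the \<open>j\<close>-th summand in it, position in the
  Kronecker product with the identity.\<close>

definition std_enc :: "(nat \<Rightarrow> nat) \<Rightarrow> (nat \<Rightarrow> nat) \<Rightarrow> nat mat \<Rightarrow> coord \<Rightarrow> nat" where
  "std_enc n m a = (\<lambda>(i, j, y, p). offset n i + (offset (\<lambda>j. m j * a $$ (i, j)) j + (y * a $$ (i, j) + p)))"

context
  fixes r s :: nat and m n :: "nat \<Rightarrow> nat" and a :: "nat mat"
  assumes n: "\<And>i. i < s \<Longrightarrow> (\<Sum>j<r. a $$ (i, j) * m j) = n i"
begin

abbreviation "std_coords \<equiv> coords {..<s} {..<r} m (\<lambda>i j. a $$ (i, j))"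
abbreviation "std_dec \<equiv> inv_into std_coords (std_enc n m a)"

lemma std_block_size: "i < s \<Longrightarrow> offset (\<lambda>j. m j * a $$ (i, j)) r = n i"
  using n[of i] by (simp add: offset_def mult.commute)

lemma std_block_bij:
  assumes "i < s"
  shows "bij_betw (\<lambda>(j, y, p). offset (\<lambda>j. m j * a $$ (i, j)) j + (y * a $$ (i, j) + p))
    (SIGMA j:{..<r}. {..<m j} \<times> {..<a $$ (i, j)}) {..<n i}"
proof -
  have eq: "(\<lambda>(j, y, p). offset (\<lambda>j. m j * a $$ (i, j)) j + (y * a $$ (i, j) + p))
      = (\<lambda>(j, x). offset (\<lambda>j. m j * a $$ (i, j)) j + (\<lambda>(y, p). y * a $$ (i, j) + p) x)"
    by (simp add: fun_eq_iff)
  show ?thesis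
    unfolding eq std_block_size[OF assms, symmetric] by (rule offset_bij) (rule div_mod_bij)
qed

lemma std_coords_eq: "std_coords = (SIGMA i:{..<s}. SIGMA j:{..<r}. {..<m j} \<times> {..<a $$ (i, j)})"
  by (auto simp: coords_def)

lemma std_enc_eq: "std_enc n m a = (\<lambda>(i, x). offset n i + (\<lambda>(j, y, p). offset (\<lambda>j. m j * a $$ (i, j)) j + (y * a $$ (i, j) + p)) x)"
  by (auto simp: std_enc_def)

lemma std_enc_bij: "bij_betw (std_enc n m a) std_coords {..<offset n s}"
  unfolding std_coords_eq std_enc_eq by (rule offset_bij) (rule std_block_bij)

lemma std_dec_bij: "bij_betw std_dec {..<offset n s} std_coords"
  using std_enc_bij by (rule bij_betw_inv_into)

lemma block_alg_std: "block_alg s n = labelled_alg (offset n s) std_dec big_pattern"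
  unfolding std_coords_eq std_enc_eq by (rule block_alg_labelled) (rule std_block_bij)

text \<open>The two levels of \<open>block_diag\<close> force \<open>i = i'\<close> and
  \<open>j = j'\<close>, and the identity factor of the Kronecker product forces
  \<open>p = p'\<close>: this is the small pattern.\<close>

lemma standard_embedding_std:
  assumes X: "X \<in> summands r m"
  shows "standard_embedding s r a X = labelled_mat (offset n s) std_dec
    (\<lambda>u v. case small_pattern u v of None \<Rightarrow> 0 | Some (l, y, y') \<Rightarrow> X l $$ (y, y'))"
proof (rule labelled_mat_inv_intoI[OF std_enc_bij])
  have Xj: "X j \<in> carrier_mat (m j) (m j)" if "j < r" for j using X that by (auto simp: summands_def)
  let ?D = "\<lambda>i. block_diag r (\<lambda>j. kron (X j) (1\<^sub>m (a $$ (i, j))))"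
  have kr: "kron (X j) (1\<^sub>m (a $$ (i, j))) \<in> carrier_mat (m j * a $$ (i, j)) (m j * a $$ (i, j))" if "j < r" for i j
    by (rule kron_carrier) (use Xj that in auto)
  have D: "?D i \<in> carrier_mat (n i) (n i)" if "i < s" for i
    using block_diag_carrier[of r _ "\<lambda>j. m j * a $$ (i, j)", OF kr] by (simp add: std_block_size[OF that])
  show "standard_embedding s r a X \<in> carrier_mat (offset n s) (offset n s)"
    unfolding standard_embedding_def by (rule block_diag_carrier) (rule D)
  fix u v assume uv: "u \<in> std_coords" "v \<in> std_coords"
  obtain i j y p where u: "u = (i, j, y, p)" by (metis prod_cases4)
  obtain i' j' y' p' where v: "v = (i', j', y', p')" by (metis prod_cases4)
  have U: "i < s" "j < r" "y < m j" "p < a $$ (i, j)" using uv by (auto simp: u coords_def)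
  have V: "i' < s" "j' < r" "y' < m j'" "p' < a $$ (i', j')" using uv by (auto simp: v coords_def)
  let ?x = "\<lambda>i j y p. offset (\<lambda>j. m j * a $$ (i, j)) j + (y * a $$ (i, j) + p)"
  have ypl: "y * a $$ (i, j) + p < m j * a $$ (i, j)" if "y < m j" "p < a $$ (i, j)" for i j y p
    using div_mod_bij[of "a $$ (i, j)" "m j"] that unfolding bij_betw_def by force
  have xl: "?x i j y p < n i" if "i < s" "j < r" "y < m j" "p < a $$ (i, j)" for i j y p
    using offset_less[of j r "y * a $$ (i, j) + p" "\<lambda>j. m j * a $$ (i, j)"] that ypl
    by (simp add: std_block_size)
  have "standard_embedding s r a X $$ (std_enc n m a u, std_enc n m a v)
      = (if i = i' then ?D i $$ (?x i j y p, ?x i' j' y' p') else 0)"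
    unfolding standard_embedding_def u v std_enc_def
    using block_diag_index[of s ?D n, OF D U(1) V(1) xl[OF U] xl[OF V]] by simp
  also have "\<dots> = (if i = i' \<and> j = j' then kron (X j) (1\<^sub>m (a $$ (i, j))) $$ (y * a $$ (i, j) + p, y' * a $$ (i, j) + p') else 0)"
    using block_diag_index[of r "\<lambda>j. kron (X j) (1\<^sub>m (a $$ (i, j)))" "\<lambda>j. m j * a $$ (i, j)" j j' "y * a $$ (i, j) + p" "y' * a $$ (i, j') + p'", OF kr U(2) V(2)]
      ypl U V by auto
  also have "\<dots> = (if i = i' \<and> j = j' then X j $$ (y, y') * (1\<^sub>m (a $$ (i, j)) $$ (p, p')) else 0)"
    using kron_index[OF Xj[OF U(2)] one_carrier_mat U(3) _ U(4), of y' p'] V by auto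
  also have "\<dots> = (case small_pattern u v of None \<Rightarrow> 0 | Some (l, y, y') \<Rightarrow> X l $$ (y, y'))"
    using U V by (auto simp: u v small_pattern_def)
  finally show "standard_embedding s r a X $$ (std_enc n m a u, std_enc n m a v)
      = (case small_pattern u v of None \<Rightarrow> 0 | Some (l, y, y') \<Rightarrow> X l $$ (y, y'))" .
qed

lemma standard_embedding_image:
  "standard_embedding s r a ` summands r m = labelled_alg (offset n s) std_dec small_pattern"
proof (intro equalityI subsetI)
  fix M assume "M \<in> standard_embedding s r a ` summands r m"
  then obtain X where "X \<in> summands r m" "M = standard_embedding s r a X" by blast
  then have "M = labelled_mat (offset n s) std_dec
      (\<lambda>u v. case small_pattern u v of None \<Rightarrow> 0 | Some x \<Rightarrow> (\<lambda>(l, y, y'). X l $$ (y, y')) x)"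
    using standard_embedding_std by simp
  then show "M \<in> labelled_alg (offset n s) std_dec small_pattern" unfolding labelled_alg_def by blast
next
  fix M assume "M \<in> labelled_alg (offset n s) std_dec small_pattern"
  then obtain c where M: "M = labelled_mat (offset n s) std_dec
      (\<lambda>u v. case small_pattern u v of None \<Rightarrow> 0 | Some x \<Rightarrow> c x)"
    by (auto simp: labelled_alg_def)
  define X where "X l = mat (m l) (m l) (\<lambda>(y, y'). c (l, y, y'))" for l
  interpret l: labelling "offset n s" std_dec std_coords by standard (rule std_dec_bij)
  have X: "X \<in> summands r m" by (auto simp: X_def summands_def)
  have "M = standard_embedding s r a X" unfolding standard_embedding_std[OF X] M
    by (rule l.lm_eqI) (auto simp: small_pattern_def X_def coords_def)
  then show "M \<in> standard_embedding s r a ` summands r m" using X by blast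
qed

end

text \<open>Let columns \<open>j\<close>, \<open>j'\<close> meet in the row \<open>i\<close>. If one
  of them is nonzero in a row \<open>k\<close>, the supports of \<open>i\<close> and
  \<open>k\<close> intersect, hence coincide, and constancy along the row \<open>k\<close> equates
  the entries. Conversely, if rows \<open>i\<close> and \<open>k\<close> share \<open>j\<close>,
  every column in the support of \<open>i\<close> agrees with column \<open>j\<close> and is nonzero
  in the row \<open>k\<close>.\<close>

lemma normalizer_matrix_iff_interchangeable:
  assumes a: "a \<in> carrier_mat s r"
    and rows: "\<And>i. i < s \<Longrightarrow> \<exists>j<r. a $$ (i, j) \<noteq> 0" and cols: "\<And>j. j < r \<Longrightarrow> \<exists>i<s. a $$ (i, j) \<noteq> 0"
  shows "normalizer_matrix a \<and> (\<forall>i<s. \<forall>j\<in>row_support a i. \<forall>j'\<in>row_support a i. m j = m j')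
    \<longleftrightarrow> interchangeable_columns {..<s} {..<r} m (\<lambda>i j. a $$ (i, j))"
    (is "?N \<and> ?M \<longleftrightarrow> ?C")
proof
  assume NM: "?N \<and> ?M"
  then have eq: "a $$ (i, j) = a $$ (i, j')" "m j = m j'"
    if "i < s" "j \<in> row_support a i" "j' \<in> row_support a i" for i j j'
    using that a unfolding normalizer_matrix_def by blast+
  have sup: "row_support a i = row_support a k" if "i < s" "k < s" "j \<in> row_support a i" "j \<in> row_support a k" for i k j
    using NM that a unfolding normalizer_matrix_def by (metis carrier_matD(1) disjoint_iff)
  show ?C unfolding interchangeable_columns_def
  proof (intro ballI impI conjI)
    fix i j j' assume "i \<in> {..<s}" "j \<in> {..<r}" "j' \<in> {..<r}" "0 < a $$ (i, j)" "0 < a $$ (i, j')"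
    then have i: "i < s" "j \<in> row_support a i" "j' \<in> row_support a i" "j < r" "j' < r"
      using a by (auto simp: row_support_def)
    show "m j = m j'" using eq(2)[OF i(1-3)] .
    fix k assume "k \<in> {..<s}"
    then have k: "k < s" by simp
    show "a $$ (k, j) = a $$ (k, j')"
    proof (cases "a $$ (k, j) = 0 \<and> a $$ (k, j') = 0")
      case False
      then have "j \<in> row_support a k \<or> j' \<in> row_support a k" using i a by (auto simp: row_support_def)
      then have "row_support a i = row_support a k" using sup[OF i(1) k] i by blast
      then show ?thesis using eq(1)[OF k] i by blast
    qed simp
  qed
next
  assume C: ?C
  note D = interchangeable_columnsD[OF C]
  have rs: "j \<in> row_support a i \<longleftrightarrow> j < r \<and> 0 < a $$ (i, j)" for i j using a by (auto simp: row_support_def)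
  have sub: "row_support a i \<subseteq> row_support a k"
    if "i < s" "k < s" "j \<in> row_support a i" "j \<in> row_support a k" for i j k
    using that D(2)[of i j _ k] unfolding rs by (metis lessThan_iff rs subsetI)
  have ?N unfolding normalizer_matrix_def
  proof (intro conjI allI impI ballI)
    show "irredundant a" unfolding irredundant_def using a rows cols by auto
    show "a $$ (i, j) = a $$ (i, j')" if "i < dim_row a" "j \<in> row_support a i" "j' \<in> row_support a i" for i j j'
      using that a D(2)[of i j j' i] by (simp add: rs)
    show "row_support a i = row_support a k \<or> row_support a i \<inter> row_support a k = {}"
      if "i < dim_row a" "k < dim_row a" for i k
      using that a sub[of i k] sub[of k i] by (auto simp: disjoint_iff)
  qed
  moreover have ?M
  proof (intro allI impI ballI)
    fix i j j' assume "i < s" "j \<in> row_support a i" "j' \<in> row_support a i"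
    then show "m j = m j'" using D(1)[of i j j'] by (simp add: rs)
  qed
  ultimately show "?N \<and> ?M" ..
qed

text \<open>The isomorphism \<theta> supplied with the inclusion matrix carries \<open>A\<close> to
  \<open>bigA\<close> and \<open>B\<close> to \<open>smallB\<close> for the standard labelling, so
  the criterion for coordinates applies.\<close>

lemma regular_iff_normalizer_matrix:
  assumes inc: "unital_inclusion N B A" and M: "has_inclusion_matrix B A r m s n a"
  shows "regular_inclusion N B A \<longleftrightarrow> normalizer_matrix a \<and>
    (\<forall>i<s. \<forall>j\<in>row_support a i. \<forall>j'\<in>row_support a i. m j = m j')"
proof -
  have m: "\<And>j. j < r \<Longrightarrow> 0 < m j" and npos: "\<And>i. i < s \<Longrightarrow> 0 < n i" and a: "a \<in> carrier_mat s r"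
    and n: "\<And>i. i < s \<Longrightarrow> (\<Sum>j<r. a $$ (i, j) * m j) = n i"
    using M by (auto simp: has_inclusion_matrix_def)
  obtain \<theta> \<phi> where \<theta>: "star_iso \<theta> A (block_alg s n)" and \<phi>: "star_iso \<phi> (block_alg r m) B"
    and se: "\<And>X. X \<in> summands r m \<Longrightarrow> \<theta> (\<phi> (block_diag r X)) = standard_embedding s r a X"
    using M by (auto simp: has_inclusion_matrix_def)
  have A: "unital_star_subalgebra N A" and BA: "B \<subseteq> A"
    using inc by (auto simp: unital_inclusion_def fd_von_neumann_algebra_def)
  let ?d = "std_dec r s m n a"
  let ?N = "offset n s"
  have rows: "\<exists>j<r. a $$ (i, j) \<noteq> 0" if "i < s" for i
  proof (rule ccontr)
    assume "\<not> ?thesis"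
    then have "(\<Sum>j<r. a $$ (i, j) * m j) = 0" by simp
    then show False using n[OF that] npos[OF that] by simp
  qed
  \<comment> \<open>Were column \<open>j\<close> zero, the unit of the \<open>j\<close>-th summand
    of \<open>B\<close> would have the same standard embedding as 0, against injectivity.\<close>
  have cols: "\<exists>i<s. a $$ (i, j) \<noteq> 0" if j: "j < r" for j
  proof (rule ccontr)
    assume no: "\<not> ?thesis"
    define X where "X l = (if l = j then 1\<^sub>m (m l) else 0\<^sub>m (m l) (m l) :: complex mat)" for l
    define Y where "Y l = (0\<^sub>m (m l) (m l) :: complex mat)" for l
    have XY: "X \<in> summands r m" "Y \<in> summands r m" by (auto simp: X_def Y_def summands_def)
    interpret l: labelling ?N ?d "coords {..<s} {..<r} m (\<lambda>i j. a $$ (i, j))"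
      by standard (rule std_dec_bij[OF n])
    have std: "standard_embedding s r a Z = l.lm (\<lambda>u v. case small_pattern u v of None \<Rightarrow> 0 | Some (l, y, y') \<Rightarrow> Z l $$ (y, y'))"
      if "Z \<in> summands r m" for Z
      by (rule standard_embedding_std[OF n that])
    have "standard_embedding s r a X = standard_embedding s r a Y"
      unfolding std[OF XY(1)] std[OF XY(2)]
      by (rule l.lm_eqI) (use no in \<open>auto simp: small_pattern_def X_def Y_def coords_def\<close>)
    then have "\<theta> (\<phi> (block_diag r X)) = \<theta> (\<phi> (block_diag r Y))" using se XY by simp
    moreover have bl: "block_diag r X \<in> block_alg r m" "block_diag r Y \<in> block_alg r m"
      using XY by (auto simp: block_alg_def)
    moreover have "\<phi> (block_diag r X) \<in> A" "\<phi> (block_diag r Y) \<in> A" using star_isoD(2)[OF \<phi>] bl BA by blast+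
    ultimately have "block_diag r X = block_diag r Y"
      using star_isoD(1)[OF \<theta>] star_isoD(1)[OF \<phi>] unfolding bij_betw_def by (metis inj_onD)
    then have "block_diag r X $$ (offset m j + 0, offset m j + 0) = block_diag r Y $$ (offset m j + 0, offset m j + 0)" by simp
    then show False
      using block_diag_index[of r X m j j 0 0] block_diag_index[of r Y m j j 0 0] j m[OF j] XY
      by (simp add: X_def Y_def summands_def)
  qed
  interpret c: coord_inclusion ?N ?d "{..<s}" "{..<r}" m "\<lambda>i j. a $$ (i, j)"
  proof
    show "bij_betw ?d {..<?N} (coords {..<s} {..<r} m (\<lambda>i j. a $$ (i, j)))"
      by (rule std_dec_bij[OF n])
  qed (use m cols in auto)
  have bA: "block_alg s n = c.bigA" unfolding c.bigA_def by (rule block_alg_std[OF n])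
  have "\<theta> ` B = \<theta> ` \<phi> ` block_alg r m" using star_isoD(1)[OF \<phi>] by (simp add: bij_betw_def)
  also have "\<dots> = standard_embedding s r a ` summands r m"
    by (force simp: block_alg_def image_image se)
  also have "\<dots> = c.smallB" unfolding c.smallB_def by (rule standard_embedding_image[OF n])
  finally have sB: "\<theta> ` B = c.smallB" .
  have "regular_inclusion N B A \<longleftrightarrow> regular_inclusion ?N c.smallB c.bigA"
    using regular_inclusion_star_iso_iff[OF \<theta>[unfolded bA] A c.bigA_subalgebra BA] unfolding sB by simp
  then show ?thesis
    unfolding c.regular_iff_interchangeable using normalizer_matrix_iff_interchangeable[OF a rows cols] by simp
qed

section \<open>Standard form of a unital inclusion\<close>

text \<open>One system of matrix units for each pair \<open>(k, l)\<close>, mutually orthogonal and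
  adding up to the identity. A system may be zero; its pair then gets multiplicity 0.\<close>

locale matrix_units =
  fixes N :: nat and K L :: "nat set" and m :: "nat \<Rightarrow> nat"
    and G :: "nat \<Rightarrow> nat \<Rightarrow> nat \<Rightarrow> nat \<Rightarrow> complex mat"
  assumes finK: "finite K" and finL: "finite L" and m_pos: "\<And>l. l \<in> L \<Longrightarrow> 0 < m l"
    and G_carrier: "\<And>k l x y. k \<in> K \<Longrightarrow> l \<in> L \<Longrightarrow> x < m l \<Longrightarrow> y < m l \<Longrightarrow> G k l x y \<in> carrier_mat N N"
    and G_mult: "\<And>k l x y k' l' x' y'. k \<in> K \<Longrightarrow> l \<in> L \<Longrightarrow> x < m l \<Longrightarrow> y < m l \<Longrightarrow>
      k' \<in> K \<Longrightarrow> l' \<in> L \<Longrightarrow> x' < m l' \<Longrightarrow> y' < m l' \<Longrightarrow>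
      G k l x y * G k' l' x' y' = (if k = k' \<and> l = l' \<and> y = x' then G k l x y' else 0\<^sub>m N N)"
    and G_adjoint: "\<And>k l x y. k \<in> K \<Longrightarrow> l \<in> L \<Longrightarrow> x < m l \<Longrightarrow> y < m l \<Longrightarrow> mat_adjoint (G k l x y) = G k l y x"
    and G_sum: "\<And>i j. i < N \<Longrightarrow> j < N \<Longrightarrow>
      (\<Sum>k\<in>K. \<Sum>l\<in>L. \<Sum>y<m l. G k l y y $$ (i, j)) = (if i = j then 1 else 0)"
begin

lemma finite_coords: "finite (coords K L m a)"
proof (rule finite_subset)
  show "coords K L m a \<subseteq> (SIGMA k:K. SIGMA l:L. {..<m l} \<times> {..<a k l})" by (auto simp: coords_def)
qed (use finK finL in auto)

text \<open>The columns of \<open>V k l\<close> are an orthonormal basis of the range of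
  \<open>G k l 0 0\<close>, and \<open>G k l y 0\<close> carries them isometrically onto the range
  of \<open>G k l y y\<close>. These ranges decompose the space orthogonally, so all the transported
  vectors together are the columns of a unitary \<open>W\<close>.\<close>

theorem diagonalization:
  obtains a d W V where "bij_betw d {..<N} (coords K L m a)"
    "W \<in> carrier_mat N N" "mat_adjoint W * W = 1\<^sub>m N" "W * mat_adjoint W = 1\<^sub>m N"
    "\<And>k l. k \<in> K \<Longrightarrow> l \<in> L \<Longrightarrow> V k l \<in> carrier_mat N (a k l)"
    "\<And>k l. k \<in> K \<Longrightarrow> l \<in> L \<Longrightarrow> mat_adjoint (V k l) * V k l = 1\<^sub>m (a k l)"
    "\<And>k l. k \<in> K \<Longrightarrow> l \<in> L \<Longrightarrow> V k l * mat_adjoint (V k l) = G k l 0 0"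
    "\<And>M. M \<in> carrier_mat N N \<Longrightarrow> mat_adjoint W * M * W = labelled_mat N d
       (\<lambda>(k, l, y, p) (k', l', y', p'). (mat_adjoint (V k l) * (G k l 0 y * M * G k' l' y' 0) * V k' l') $$ (p, p'))"
proof -
  have "\<exists>a V. V \<in> carrier_mat N a \<and> mat_adjoint V * V = 1\<^sub>m a \<and> V * mat_adjoint V = G k l 0 0"
    if "k \<in> K" "l \<in> L" for k l
  proof -
    note z = m_pos[OF that(2)]
    have "G k l 0 0 * G k l 0 0 = G k l 0 0" using G_mult[OF that z z that z z] by simp
    then show ?thesis
      using projection_factorization[OF G_carrier[OF that z z] _ G_adjoint[OF that z z]] by metis
  qed
  then obtain a V where V: "V k l \<in> carrier_mat N (a k l)" "mat_adjoint (V k l) * V k l = 1\<^sub>m (a k l)"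
    "V k l * mat_adjoint (V k l) = G k l 0 0" if "k \<in> K" "l \<in> L" for k l
    by metis
  let ?C = "coords K L m a" and ?n = "card (coords K L m a)"
  obtain d where d: "bij_betw d {..<?n} ?C"
    using ex_bij_betw_nat_finite[OF finite_coords] by (metis lessThan_atLeast0)
  have dC: "d g \<in> ?C" if "g < ?n" for g using d that by (auto simp: bij_betw_def)
  define T where "T k l y = G k l y 0 * V k l" for k l y
  have Tc: "T k l y \<in> carrier_mat N (a k l)" if "k \<in> K" "l \<in> L" "y < m l" for k l y
    using G_carrier[OF that m_pos[OF that(2)]] V(1)[OF that(1,2)] by (simp add: T_def)
  define W where "W = mat N ?n (\<lambda>(i, g). case d g of (k, l, y, p) \<Rightarrow> T k l y $$ (i, p))"
  have W: "W \<in> carrier_mat N ?n" by (simp add: W_def)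
  note W' = mat_adjoint_carrier[OF W]
  have WMW: "(mat_adjoint W * M * W) $$ (g, h) = (mat_adjoint (V k l) * (G k l 0 y * M * G k' l' y' 0) * V k' l') $$ (p, p')"
    if M: "M \<in> carrier_mat N N" and gh: "g < ?n" "h < ?n" and dgh: "d g = (k, l, y, p)" "d h = (k', l', y', p')"
    for M g h k l y p k' l' y' p'
  proof -
    have c: "k \<in> K" "l \<in> L" "y < m l" "p < a k l" "k' \<in> K" "l' \<in> L" "y' < m l'" "p' < a k' l'"
      using dC[OF gh(1)] dC[OF gh(2)] by (auto simp: dgh coords_def)
    note T1 = Tc[OF c(1-3)] and T2 = Tc[OF c(5-7)]
    have *: "(mat_adjoint W * M * W) $$ (g, h) = (\<Sum>j<N. (\<Sum>i<N. cnj (T k l y $$ (i, p)) * M $$ (i, j)) * T k' l' y' $$ (j, p'))"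
      unfolding mat_mult_index[OF mult_carrier_mat[OF W' M] W gh]
    proof (intro sum.cong refl)
      fix j assume "j \<in> {..<N}"
      then have j: "j < N" by simp
      show "(mat_adjoint W * M) $$ (g, j) * W $$ (j, h) = (\<Sum>i<N. cnj (T k l y $$ (i, p)) * M $$ (i, j)) * T k' l' y' $$ (j, p')"
        unfolding mat_mult_index[OF W' M gh(1) j] using gh j W by (simp add: W_def dgh)
    qed
    note T1' = mat_adjoint_carrier[OF T1]
    have "(mat_adjoint (T k l y) * M * T k' l' y') $$ (p, p') = (\<Sum>j<N. (\<Sum>i<N. cnj (T k l y $$ (i, p)) * M $$ (i, j)) * T k' l' y' $$ (j, p'))"
      unfolding mat_mult_index[OF mult_carrier_mat[OF T1' M] T2 c(4,8)]
    proof (intro sum.cong refl)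
      fix j assume "j \<in> {..<N}"
      then have j: "j < N" by simp
      show "(mat_adjoint (T k l y) * M) $$ (p, j) * T k' l' y' $$ (j, p') = (\<Sum>i<N. cnj (T k l y $$ (i, p)) * M $$ (i, j)) * T k' l' y' $$ (j, p')"
        unfolding mat_mult_index[OF T1' M c(4) j] using T1 c(4) by simp
    qed
    moreover have "mat_adjoint (T k l y) * M * T k' l' y' = mat_adjoint (V k l) * (G k l 0 y * M * G k' l' y' 0) * V k' l'"
    proof -
      note g1 = G_carrier[OF c(1-3) m_pos[OF c(2)]] and g1' = G_carrier[OF c(1,2) m_pos[OF c(2)] c(3)]
        and g2 = G_carrier[OF c(5-7) m_pos[OF c(6)]] and v1 = V(1)[OF c(1,2)] and v2 = V(1)[OF c(5,6)]
      note v1' = mat_adjoint_carrier[OF v1]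
      have "mat_adjoint (T k l y) = mat_adjoint (V k l) * G k l 0 y"
        unfolding T_def mat_adjoint_mult[OF g1 v1] G_adjoint[OF c(1-3) m_pos[OF c(2)]] ..
      then have "mat_adjoint (T k l y) * M * T k' l' y' = mat_adjoint (V k l) * G k l 0 y * M * (G k' l' y' 0 * V k' l')"
        by (simp add: T_def)
      also have "\<dots> = mat_adjoint (V k l) * G k l 0 y * M * G k' l' y' 0 * V k' l'"
        using assoc_mult_mat[OF mult_carrier_mat[OF mult_carrier_mat[OF v1' g1'] M] g2 v2] by simp
      also have "mat_adjoint (V k l) * G k l 0 y * M * G k' l' y' 0 = mat_adjoint (V k l) * (G k l 0 y * M) * G k' l' y' 0"
        using assoc_mult_mat[OF v1' g1' M] by simp
      also have "\<dots> = mat_adjoint (V k l) * (G k l 0 y * M * G k' l' y' 0)"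
        by (rule assoc_mult_mat[OF v1' mult_carrier_mat[OF g1' M] g2])
      finally show ?thesis .
    qed
    ultimately show ?thesis using * by simp
  qed
  have WW1: "mat_adjoint W * W = 1\<^sub>m ?n"
  proof (rule eq_matI)
    fix g h assume "g < dim_row (1\<^sub>m ?n)" "h < dim_col (1\<^sub>m ?n)"
    then have gh: "g < ?n" "h < ?n" by auto
    obtain k l y p where dg: "d g = (k, l, y, p)" by (metis prod_cases4)
    obtain k' l' y' p' where dh: "d h = (k', l', y', p')" by (metis prod_cases4)
    have c: "k \<in> K" "l \<in> L" "y < m l" "p < a k l" "k' \<in> K" "l' \<in> L" "y' < m l'" "p' < a k' l'"
      using dC[OF gh(1)] dC[OF gh(2)] by (auto simp: dg dh coords_def)
    have inj: "d g = d h \<longleftrightarrow> g = h" using d gh by (auto simp: bij_betw_def inj_on_def)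
    note v1 = V(1)[OF c(1,2)] and v2 = V(1)[OF c(5,6)]
    note v1' = mat_adjoint_carrier[OF v1]
    have g: "G k l 0 y * 1\<^sub>m N * G k' l' y' 0 = (if k = k' \<and> l = l' \<and> y = y' then G k l 0 0 else 0\<^sub>m N N)"
      using G_mult[OF c(1,2) m_pos[OF c(2)] c(3,5-7) m_pos[OF c(6)]] G_carrier[OF c(1,2) m_pos[OF c(2)] c(3)] by simp
    have "(mat_adjoint W * W) $$ (g, h) = (mat_adjoint W * 1\<^sub>m N * W) $$ (g, h)"
      by (simp only: right_mult_one_mat[OF W'])
    also have "\<dots> = (mat_adjoint (V k l) * (if k = k' \<and> l = l' \<and> y = y' then G k l 0 0 else 0\<^sub>m N N) * V k' l') $$ (p, p')"
      using WMW[OF one_carrier_mat gh dg dh] g by simp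
    also have "\<dots> = (if g = h then 1 else 0)"
    proof (cases "k = k' \<and> l = l' \<and> y = y'")
      case True
      have "mat_adjoint (V k l) * G k l 0 0 * V k l = (mat_adjoint (V k l) * V k l) * (mat_adjoint (V k l) * V k l)"
        unfolding V(3)[OF c(1,2), symmetric]
        using assoc_mult_mat[OF v1' v1 v1'] assoc_mult_mat[OF mult_carrier_mat[OF v1' v1] v1' v1] by simp
      also have "\<dots> = 1\<^sub>m (a k l)" using V(2)[OF c(1,2)] by simp
      finally show ?thesis using True c inj by (auto simp: dg dh)
    next
      case False
      have "mat_adjoint (V k l) * 0\<^sub>m N N * V k' l' = 0\<^sub>m (a k l) (a k' l')"
        by (simp only: right_mult_zero_mat[OF v1'] left_mult_zero_mat[OF v2])
      then have "(mat_adjoint (V k l) * 0\<^sub>m N N * V k' l') $$ (p, p') = 0" using c by simp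
      then show ?thesis using False inj by (auto simp: dg dh)
    qed
    finally show "(mat_adjoint W * W) $$ (g, h) = 1\<^sub>m ?n $$ (g, h)" using gh by simp
  qed (use W in auto)
  have WW2: "W * mat_adjoint W = 1\<^sub>m N"
  proof (rule eq_matI)
    fix i j assume "i < dim_row (1\<^sub>m N)" "j < dim_col (1\<^sub>m N)"
    then have ij: "i < N" "j < N" by auto
    let ?f = "\<lambda>(k, l, y, p). T k l y $$ (i, p) * cnj (T k l y $$ (j, p))"
    have "(W * mat_adjoint W) $$ (i, j) = (\<Sum>g<?n. ?f (d g))"
      unfolding mat_mult_index[OF W W' ij] using ij W by (intro sum.cong) (auto simp: W_def split: prod.splits)
    also have "\<dots> = (\<Sum>u\<in>?C. ?f u)" by (rule sum.reindex_bij_betw[OF d])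
    also have "\<dots> = (\<Sum>k\<in>K. \<Sum>(l, y, p)\<in>(SIGMA l:L. {..<m l} \<times> {..<a k l}). T k l y $$ (i, p) * cnj (T k l y $$ (j, p)))"
    proof -
      have "?C = (SIGMA k:K. SIGMA l:L. {..<m l} \<times> {..<a k l})" by (auto simp: coords_def)
      then show ?thesis by (subst sum.Sigma) (use finK finL in auto)
    qed
    also have "\<dots> = (\<Sum>k\<in>K. \<Sum>l\<in>L. \<Sum>(y, p)\<in>{..<m l} \<times> {..<a k l}. T k l y $$ (i, p) * cnj (T k l y $$ (j, p)))"
      by (intro sum.cong refl, subst sum.Sigma) (use finL in auto)
    also have "\<dots> = (\<Sum>k\<in>K. \<Sum>l\<in>L. \<Sum>y<m l. \<Sum>p<a k l. T k l y $$ (i, p) * cnj (T k l y $$ (j, p)))"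
      by (simp only: sum.cartesian_product)
    also have "\<dots> = (\<Sum>k\<in>K. \<Sum>l\<in>L. \<Sum>y<m l. G k l y y $$ (i, j))"
    proof (intro sum.cong refl)
      fix k l y assume "k \<in> K" "l \<in> L" "y \<in> {..<m l}"
      then have c: "k \<in> K" "l \<in> L" "y < m l" by auto
      note t = Tc[OF c] and v = V(1)[OF c(1,2)] and g1 = G_carrier[OF c m_pos[OF c(2)]]
        and g2 = G_carrier[OF c(1,2) m_pos[OF c(2)] c(3)]
      note g3 = G_carrier[OF c(1,2) m_pos[OF c(2)] m_pos[OF c(2)]]
      note v' = mat_adjoint_carrier[OF v]
      have "T k l y * mat_adjoint (T k l y) = G k l y 0 * V k l * (mat_adjoint (V k l) * G k l 0 y)"
        unfolding T_def mat_adjoint_mult[OF g1 v] G_adjoint[OF c m_pos[OF c(2)]] ..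
      also have "\<dots> = G k l y 0 * (V k l * (mat_adjoint (V k l) * G k l 0 y))"
        by (rule assoc_mult_mat[OF g1 v mult_carrier_mat[OF v' g2]])
      also have "V k l * (mat_adjoint (V k l) * G k l 0 y) = G k l 0 0 * G k l 0 y"
        using assoc_mult_mat[OF v v' g2] V(3)[OF c(1,2)] by simp
      also have "G k l y 0 * (G k l 0 0 * G k l 0 y) = G k l y y"
        using c m_pos[OF c(2)] by (simp add: G_mult)
      finally have TT: "T k l y * mat_adjoint (T k l y) = G k l y y" .
      have "(\<Sum>p<a k l. T k l y $$ (i, p) * cnj (T k l y $$ (j, p))) = (T k l y * mat_adjoint (T k l y)) $$ (i, j)"
        unfolding mat_mult_index[OF t mat_adjoint_carrier[OF t] ij] using t ij by (intro sum.cong) auto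
      then show "(\<Sum>p<a k l. T k l y $$ (i, p) * cnj (T k l y $$ (j, p))) = G k l y y $$ (i, j)" by (simp add: TT)
    qed
    also have "\<dots> = 1\<^sub>m N $$ (i, j)" using G_sum[OF ij] ij by simp
    finally show "(W * mat_adjoint W) $$ (i, j) = 1\<^sub>m N $$ (i, j)" .
  qed (use W in auto)
  \<comment> \<open>Up to here \<open>W\<close> has \<open>?n\<close> columns. It is isometric in
    both directions, and cyclicity of the trace makes it square.\<close>
  have "mat_trace (1\<^sub>m N) = mat_trace (1\<^sub>m ?n)"
    using mat_trace_commute[OF W W'] unfolding WW1 WW2 .
  then have nN: "?n = N" by (simp add: mat_trace_one)
  show thesis
  proof (rule that[of d a W V])
    show "bij_betw d {..<N} ?C" using d by (simp add: nN)
    show "W \<in> carrier_mat N N" "mat_adjoint W * W = 1\<^sub>m N" "W * mat_adjoint W = 1\<^sub>m N"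
      using W WW1 WW2 by (simp_all add: nN)
    fix M :: "complex mat" assume M: "M \<in> carrier_mat N N"
    show "mat_adjoint W * M * W = labelled_mat N d
       (\<lambda>(k, l, y, p) (k', l', y', p'). (mat_adjoint (V k l) * (G k l 0 y * M * G k' l' y' 0) * V k' l') $$ (p, p'))"
    proof (rule eq_matI)
      fix g h assume "g < dim_row (labelled_mat N d
       (\<lambda>(k, l, y, p) (k', l', y', p'). (mat_adjoint (V k l) * (G k l 0 y * M * G k' l' y' 0) * V k' l') $$ (p, p')))"
       "h < dim_col (labelled_mat N d
       (\<lambda>(k, l, y, p) (k', l', y', p'). (mat_adjoint (V k l) * (G k l 0 y * M * G k' l' y' 0) * V k' l') $$ (p, p')))"
      then have gh: "g < ?n" "h < ?n" by (auto simp: nN)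
      obtain k l y p where dg: "d g = (k, l, y, p)" by (metis prod_cases4)
      obtain k' l' y' p' where dh: "d h = (k', l', y', p')" by (metis prod_cases4)
      show "(mat_adjoint W * M * W) $$ (g, h) = labelled_mat N d
       (\<lambda>(k, l, y, p) (k', l', y', p'). (mat_adjoint (V k l) * (G k l 0 y * M * G k' l' y' 0) * V k' l') $$ (p, p')) $$ (g, h)"
        unfolding WMW[OF M gh dg dh] using gh by (simp add: labelled_mat_def dg dh nN)
    qed (use W in \<open>auto simp: nN\<close>)
  qed (use V in auto)
qed

end

lemma unitary_conj_star_iso:
  fixes W :: "complex mat"
  assumes W: "W \<in> carrier_mat N N" and WW: "mat_adjoint W * W = 1\<^sub>m N" "W * mat_adjoint W = 1\<^sub>m N"
  shows "star_iso (\<lambda>X. mat_adjoint W * X * W) (carrier_mat N N) (carrier_mat N N)"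
proof -
  note W' = mat_adjoint_carrier[OF W]
  have c1: "mat_adjoint W * (W * X) = X" if "X \<in> carrier_mat N N" for X
    using square_mult_assoc[OF W' W that] WW that by simp
  have c2: "W * (mat_adjoint W * X) = X" if "X \<in> carrier_mat N N" for X
    using square_mult_assoc[OF W W' that] WW that by simp
  note a = square_mat_simps[where N = N] W W' WW c1 c2
  show ?thesis unfolding star_iso_def
  proof (intro conjI ballI allI)
    show "bij_betw (\<lambda>X. mat_adjoint W * X * W) (carrier_mat N N) (carrier_mat N N)"
      by (rule bij_betw_byWitness[where f' = "\<lambda>X. W * X * mat_adjoint W"]) (auto simp: a)
    fix X Y :: "complex mat" assume XY: "X \<in> carrier_mat N N" "Y \<in> carrier_mat N N"
    show "mat_adjoint W * (X + Y) * W = mat_adjoint W * X * W + mat_adjoint W * Y * W"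
      unfolding mult_add_distrib_mat[OF W' XY]
      by (rule add_mult_distrib_mat[OF mult_carrier_mat[OF W' XY(1)] mult_carrier_mat[OF W' XY(2)] W])
    show "mat_adjoint W * (X * Y) * W = mat_adjoint W * X * W * (mat_adjoint W * Y * W)"
      using XY by (simp add: a)
  next
    fix X :: "complex mat" and c assume X: "X \<in> carrier_mat N N"
    show "mat_adjoint W * (c \<cdot>\<^sub>m X) * W = c \<cdot>\<^sub>m (mat_adjoint W * X * W)"
      unfolding mult_smult_distrib[OF W' X]
      by (rule mult_smult_assoc_mat[OF mult_carrier_mat[OF W' X] W])
  next
    fix X :: "complex mat" assume X: "X \<in> carrier_mat N N"
    show "mat_adjoint W * mat_adjoint X * W = mat_adjoint (mat_adjoint W * X * W)"
      using X mat_adjoint_mult[OF W' X] mat_adjoint_mult[of "mat_adjoint W * X" N N W N] by (simp add: a)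
  qed
qed

section \<open>Matrix units attached to labels\<close>

context labelling
begin

definition lm_unit :: "'u \<Rightarrow> 'u \<Rightarrow> complex mat" where
  "lm_unit u v = lm (\<lambda>u' v'. if u' = u \<and> v' = v then 1 else 0)"

lemma lm_unit_carrier [simp]: "lm_unit u v \<in> carrier_mat N N"
  by (simp add: lm_unit_def)

lemma lm_unit_sandwich:
  assumes "v \<in> I" "u' \<in> I"
  shows "lm_unit u v * lm f * lm_unit u' v' = f v u' \<cdot>\<^sub>m lm_unit u v'"
proof -
  have 1: "lm_unit u v * lm f = lm (\<lambda>w w'. if w = u then f v w' else 0)"
    unfolding lm_unit_def lm_mult
  proof (rule lm_eqI)
    fix x w assume "x \<in> I" "w \<in> I"
    have "(\<Sum>z\<in>I. (if x = u \<and> z = v then 1 else 0) * f z w) = (\<Sum>z\<in>I. if z = v then (if x = u then f v w else 0) else 0)"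
      by (intro sum.cong) auto
    then show "(\<Sum>z\<in>I. (if x = u \<and> z = v then 1 else 0) * f z w) = (if x = u then f v w else 0)"
      using assms fin by simp
  qed
  show ?thesis unfolding 1 unfolding lm_unit_def lm_mult labelled_mat_smult
  proof (rule lm_eqI)
    fix x w assume "x \<in> I" "w \<in> I"
    have "(\<Sum>z\<in>I. (if x = u then f v z else 0) * (if z = u' \<and> w = v' then 1 else 0))
        = (\<Sum>z\<in>I. if z = u' then (if x = u \<and> w = v' then f v u' else 0) else 0)"
      by (intro sum.cong) auto
    then show "(\<Sum>z\<in>I. (if x = u then f v z else 0) * (if z = u' \<and> w = v' then 1 else 0))
        = f v u' * (if x = u \<and> w = v' then 1 else 0)"
      using assms fin by simp
  qed
qed

lemma lm_unit_adjoint: "mat_adjoint (lm_unit u v) = lm_unit v u"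
  unfolding lm_unit_def labelled_mat_adjoint by (rule lm_eqI) auto

lemma lm_unit_mult:
  assumes "v \<in> I" "u' \<in> I"
  shows "lm_unit u v * lm_unit u' v' = (if v = u' then lm_unit u v' else 0\<^sub>m N N)"
proof -
  have "lm_unit u v * lm_unit u' v' = lm_unit u v * 1\<^sub>m N * lm_unit u' v'"
    by (simp only: square_mult_one[OF lm_unit_carrier])
  also have "\<dots> = (if v = u' then 1 else 0) \<cdot>\<^sub>m lm_unit u v'"
    unfolding lm_one by (rule lm_unit_sandwich[OF assms])
  also have "\<dots> = (if v = u' then lm_unit u v' else 0\<^sub>m N N)"
    by (auto intro!: eq_matI simp: lm_unit_def)
  finally show ?thesis .
qed

lemma lm_diag_insert:
  assumes "u \<notin> J"
  shows "lm (\<lambda>v w. if v = w \<and> v \<in> insert u J then 1 else 0) = lm_unit u u + lm (\<lambda>v w. if v = w \<and> v \<in> J then 1 else 0)"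
  unfolding lm_unit_def labelled_mat_add by (rule lm_eqI) (use assms in auto)

lemma lm_zero: "0\<^sub>m N N = lm (\<lambda>u v. 0)"
  by (rule eq_matI) (auto simp: labelled_mat_def)

end

lemma (in block_labelling) lm_unit_bigA: "fst u = fst v \<Longrightarrow> lm_unit u v \<in> bigA"
  unfolding lm_unit_def bigA_iff by auto

lemma (in block_labelling) block_proj_nonzero:
  assumes "u \<in> I" "fst u = k"
  shows "block_proj k \<noteq> 0\<^sub>m N N"
  using assms unfolding block_proj_def lm_zero lm_eq_iff by fastforce

text \<open>The matrix units of the summands of \<open>B\<close>, cut down by the central projections of the summands
  of \<open>A\<close>, form one system of matrix units; diagonalizing it puts the inclusion in standard form.\<close>

theorem inclusion_standard_form:
  assumes inc: "unital_inclusion N B A"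
  obtains N' d s r m a \<theta> where "coord_inclusion N' d {..<s} {..<r} m a"
    "star_iso \<theta> A (labelled_alg N' d big_pattern)" "\<theta> ` B = labelled_alg N' d small_pattern"
    "0 < s" "\<And>i. i < s \<Longrightarrow> \<exists>j<r. 0 < a i j"
proof -
  have A: "unital_star_subalgebra N A" and B: "unital_star_subalgebra N B" and BA: "B \<subseteq> A"
    using inc by (auto simp: unital_inclusion_def fd_von_neumann_algebra_def)
  obtain s n \<theta>0 where s: "0 < s" and n: "\<And>i. i < s \<Longrightarrow> 0 < n i" and \<theta>0: "star_iso \<theta>0 A (block_alg s n)"
    using inc by (auto simp: unital_inclusion_def fd_von_neumann_algebra_def)
  obtain r m \<psi> where m: "\<And>j. j < r \<Longrightarrow> 0 < m j" and \<psi>: "star_iso \<psi> B (block_alg r m)"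
    using inc by (auto simp: unital_inclusion_def fd_von_neumann_algebra_def)
  define IA where "IA = (SIGMA i:{..<s}. {..<n i})"
  define IB where "IB = (SIGMA i:{..<r}. {..<m i})"
  define dA where "dA = inv_into IA (\<lambda>(i, x). offset n i + x)"
  define dB where "dB = inv_into IB (\<lambda>(i, x). offset m i + x)"
  have bid: "bij_betw (\<lambda>x. x) {..<k} {..<k}" for k :: nat by (simp add: bij_betw_def)
  interpret a: block_labelling "offset n s" dA IA
    unfolding dA_def IA_def
    by (standard, rule bij_betw_inv_into, rule offset_bij[of s "\<lambda>i x. x"]) (rule bid)
  interpret b: block_labelling "offset m r" dB IB
    unfolding dB_def IB_def
    by (standard, rule bij_betw_inv_into, rule offset_bij[of r "\<lambda>i x. x"]) (rule bid)
  have Aeq: "block_alg s n = a.bigA"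
    unfolding a.bigA_def unfolding dA_def IA_def by (rule block_alg_labelled[of s "\<lambda>i x. x"]) (rule bid)
  have Beq: "block_alg r m = b.bigA"
    unfolding b.bigA_def unfolding dB_def IB_def by (rule block_alg_labelled[of r "\<lambda>i x. x"]) (rule bid)
  let ?N = "offset n s" and ?M = "offset m r"
  note \<theta>A = \<theta>0[unfolded Aeq] and \<psi>B = \<psi>[unfolded Beq]
  define \<phi> where "\<phi> = inv_into B \<psi>"
  have \<phi>: "star_iso \<phi> b.bigA B" unfolding \<phi>_def by (rule star_iso_inv[OF \<psi>B B])
  \<comment> \<open>The inclusion of \<open>B\<close> in \<open>A\<close>, read between the two
    concrete block algebras.\<close>
  define \<rho> where "\<rho> X = \<theta>0 (\<phi> X)" for X
  note ph = star_isoD[OF \<phi>] and th = star_isoD[OF \<theta>A]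
  have phA: "\<phi> X \<in> A" if "X \<in> b.bigA" for X using ph(2)[OF that] BA by blast
  have \<rho>: "X \<in> b.bigA \<Longrightarrow> \<rho> X \<in> a.bigA"
    "X \<in> b.bigA \<Longrightarrow> Y \<in> b.bigA \<Longrightarrow> \<rho> (X + Y) = \<rho> X + \<rho> Y"
    "X \<in> b.bigA \<Longrightarrow> Y \<in> b.bigA \<Longrightarrow> \<rho> (X * Y) = \<rho> X * \<rho> Y"
    "X \<in> b.bigA \<Longrightarrow> \<rho> (c \<cdot>\<^sub>m X) = c \<cdot>\<^sub>m \<rho> X"
    "X \<in> b.bigA \<Longrightarrow> \<rho> (mat_adjoint X) = mat_adjoint (\<rho> X)" for X Y c
    unfolding \<rho>_def using phA by (simp_all add: ph th)
  have \<rho>_image: "\<rho> ` b.bigA = \<theta>0 ` B"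
    using ph(1) by (auto simp: \<rho>_def bij_betw_def image_image simp flip: image_image)
  have \<rho>_inj: "X = Y" if "X \<in> b.bigA" "Y \<in> b.bigA" "\<rho> X = \<rho> Y" for X Y
    using that phA ph(1) th(1) unfolding \<rho>_def bij_betw_def by (metis inj_onD)
  note bsub = unital_star_subalgebraD[OF b.bigA_subalgebra]
  note asub = unital_star_subalgebraD[OF a.bigA_subalgebra]
  have \<rho>_one: "\<rho> (1\<^sub>m ?M) = 1\<^sub>m ?N"
    unfolding \<rho>_def
    using star_iso_one[OF \<phi> b.bigA_subalgebra B] star_iso_one[OF \<theta>A A a.bigA_subalgebra] by simp
  have zeroB: "0\<^sub>m ?M ?M \<in> b.bigA"
    by (rule mat_subspaceD(2)[OF unital_star_subalgebra_subspace[OF b.bigA_subalgebra]])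
  have \<rho>_zero: "\<rho> (0\<^sub>m ?M ?M) = 0\<^sub>m ?N ?N"
  proof -
    have "\<rho> (0 \<cdot>\<^sub>m 0\<^sub>m ?M ?M) = 0 \<cdot>\<^sub>m \<rho> (0\<^sub>m ?M ?M)" by (rule \<rho>(4)[OF zeroB])
    moreover have "0 \<cdot>\<^sub>m X = 0\<^sub>m ?N ?N" if "X \<in> carrier_mat ?N ?N" for X :: "complex mat"
      using that by (auto intro!: eq_matI)
    ultimately show ?thesis using asub(2)[OF \<rho>(1)[OF zeroB]] by simp
  qed
  define E where "E l x y = b.lm_unit (l, x) (l, y)" for l x y
  have EB: "E l x y \<in> b.bigA" for l x y unfolding E_def by (rule b.lm_unit_bigA) simp
  define F where "F l x y = \<rho> (E l x y)" for l x y
  have FA: "F l x y \<in> a.bigA" for l x y unfolding F_def by (rule \<rho>(1)[OF EB])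
  have Fc: "F l x y \<in> carrier_mat ?N ?N" for l x y by (rule asub(2)[OF FA])
  have IBm: "(l, x) \<in> IB" if "l < r" "x < m l" for l x using that by (simp add: IB_def)
  define G where "G k l x y = a.block_proj k * F l x y" for k l x y
  have Gc: "G k l x y \<in> carrier_mat ?N ?N" for k l x y unfolding G_def by (rule mult_carrier_mat[OF a.block_proj_carrier Fc])
  \<comment> \<open>Elements of \<open>A\<close> commute with the block projections, so both
    cut-downs can be moved to the front, where they multiply to one or to zero.\<close>
  have sandwich: "G k l x y * X * G k' l' x' y' = (if k = k' then a.block_proj k * (F l x y * X * F l' x' y') else 0\<^sub>m ?N ?N)"
    if X: "X \<in> a.bigA" for X k k' l l' x y x' y'
  proof -
    let ?Z = "F l x y * X"
    have Xc: "X \<in> carrier_mat ?N ?N" by (rule asub(2)[OF X])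
    have ZA: "?Z \<in> a.bigA" by (rule asub(5)[OF FA X])
    note c = square_mat_simps[where N = ?N] Fc Xc a.block_proj_carrier asub(2)[OF ZA]
    have "G k l x y * X * G k' l' x' y' = a.block_proj k * (?Z * a.block_proj k') * F l' x' y'"
      unfolding G_def by (simp add: c)
    also have "\<dots> = (a.block_proj k * a.block_proj k') * (?Z * F l' x' y')"
      unfolding a.block_proj_commute[OF ZA, symmetric] by (simp add: c)
    finally show ?thesis unfolding a.block_proj_block_proj by (simp add: c)
  qed
  have rho_sandwich: "F l x y * \<rho> (b.lm f) * F l' x' y' = (if l = l' then f (l, y) (l, x') \<cdot>\<^sub>m F l x y' else 0\<^sub>m ?N ?N)"
    if lm: "b.lm f \<in> b.bigA" and mem: "(l, y) \<in> IB" "(l', x') \<in> IB" for f l x y l' x' y'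
  proof -
    have e: "E l x y * b.lm f * E l' x' y' = f (l, y) (l', x') \<cdot>\<^sub>m b.lm_unit (l, x) (l', y')"
      unfolding E_def by (rule b.lm_unit_sandwich[OF mem])
    have F: "F l x y * \<rho> (b.lm f) * F l' x' y' = \<rho> (E l x y * b.lm f * E l' x' y')"
      unfolding F_def using EB lm bsub(5) by (simp add: \<rho>(3))
    show ?thesis
    proof (cases "l = l'")
      case True
      then show ?thesis unfolding F e using \<rho>(4)[OF EB] by (simp add: F_def E_def)
    next
      case False
      then have "f (l, y) (l', x') = 0" using lm mem unfolding b.bigA_iff by auto
      then have "E l x y * b.lm f * E l' x' y' = 0\<^sub>m ?M ?M"
        unfolding e by (auto intro!: eq_matI simp: b.lm_unit_def)
      then show ?thesis unfolding F using False by (simp add: \<rho>_zero)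
    qed
  qed
  have FF: "F l x y * F l' x' y' = (if l = l' \<and> y = x' then F l x y' else 0\<^sub>m ?N ?N)"
    if c: "l < r" "y < m l" "l' < r" "x' < m l'" for l x y l' x' y'
    using b.lm_unit_mult[OF IBm IBm, of l y l' x' "(l, x)" "(l', y')"] c
    by (auto simp: F_def E_def \<rho>(3)[OF EB EB, symmetric, unfolded E_def] \<rho>_zero)
  interpret u: matrix_units ?N "{..<s}" "{..<r}" m G
  proof
    fix k l x y k' l' x' y'
    assume c: "k \<in> {..<s}" "l \<in> {..<r}" "x < m l" "y < m l" "k' \<in> {..<s}" "l' \<in> {..<r}" "x' < m l'" "y' < m l'"
    then have c': "l < r" "l' < r" by auto
    have "G k l x y * G k' l' x' y' = G k l x y * 1\<^sub>m ?N * G k' l' x' y'"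
      by (simp only: square_mult_one[OF Gc])
    also have "\<dots> = (if k = k' then a.block_proj k * (F l x y * F l' x' y') else 0\<^sub>m ?N ?N)"
      unfolding sandwich[OF asub(3)] by (simp only: square_mult_one[OF Fc])
    finally show "G k l x y * G k' l' x' y' = (if k = k' \<and> l = l' \<and> y = x' then G k l x y' else 0\<^sub>m ?N ?N)"
      unfolding FF[OF c'(1) c(4) c'(2) c(7)] using square_mult_zero(1)[OF a.block_proj_carrier] by (simp add: G_def)
  next
    fix k l x y
    have "mat_adjoint (F l x y) = F l y x"
      unfolding F_def \<rho>(5)[OF EB, symmetric] by (simp add: E_def b.lm_unit_adjoint)
    then show "mat_adjoint (G k l x y) = G k l y x"
      unfolding G_def mat_adjoint_mult[OF a.block_proj_carrier Fc] a.block_proj_adjoint using a.block_proj_commute[OF FA] by simp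
  next
    fix i j assume ij: "i < ?N" "j < ?N"
    \<comment> \<open>Additivity of \<rho> is pushed through the decomposition of a diagonal
      projection into units, one label at a time; with all labels it decomposes the
      identity.\<close>
    have diag: "\<rho> (b.lm (\<lambda>v w. if v = w \<and> v \<in> J then 1 else 0)) $$ (p, q) = (\<Sum>u\<in>J. \<rho> (b.lm_unit u u) $$ (p, q))"
      if "finite J" "p < ?N" "q < ?N" for J p q
      using that(1)
    proof (induction J)
      case empty
      then show ?case using \<rho>_zero that by (simp add: b.lm_zero[symmetric])
    next
      case (insert u J)
      have B: "b.lm_unit u u \<in> b.bigA" "b.lm (\<lambda>v w. if v = w \<and> v \<in> J then 1 else 0) \<in> b.bigA"
        by (auto simp: b.lm_unit_bigA b.bigA_iff)
      show ?case unfolding b.lm_diag_insert[OF insert.hyps(2)] \<rho>(2)[OF B]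
        using insert asub(2)[OF \<rho>(1)[OF B(2)]] that by simp
    qed
    have Fsum: "(\<Sum>l<r. \<Sum>y<m l. F l y y $$ (p, q)) = (if p = q then 1 else 0)" if "p < ?N" "q < ?N" for p q
    proof -
      have "(\<Sum>l<r. \<Sum>y<m l. F l y y $$ (p, q)) = (\<Sum>u\<in>IB. \<rho> (b.lm_unit u u) $$ (p, q))"
        unfolding IB_def F_def E_def by (subst sum.Sigma) (auto intro!: sum.cong)
      also have "\<dots> = \<rho> (b.lm (\<lambda>v w. if v = w \<and> v \<in> IB then 1 else 0)) $$ (p, q)"
        using diag[OF b.fin that] by simp
      also have "b.lm (\<lambda>v w. if v = w \<and> v \<in> IB then 1 else 0) = 1\<^sub>m ?M"
        unfolding b.lm_one by (rule b.lm_eqI) auto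
      finally show ?thesis using \<rho>_one that by simp
    qed
    have Psum: "(\<Sum>k<s. a.block_proj k $$ (p, q)) = (if p = q then 1 else 0)" if "p < ?N" "q < ?N" for p q
    proof -
      have "(\<Sum>k<s. a.block_proj k $$ (p, q)) = (\<Sum>k<s. if k = fst (dA p) then (if p = q then 1 else 0) else 0)"
        using that by (intro sum.cong) (auto simp: a.block_proj_def labelled_mat_def)
      moreover have "fst (dA p) < s" using a.label_mem[OF that(1)] by (auto simp: IA_def)
      ultimately show ?thesis by simp
    qed
    have "(\<Sum>k<s. \<Sum>l<r. \<Sum>y<m l. G k l y y $$ (i, j))
        = (\<Sum>k<s. \<Sum>l<r. \<Sum>y<m l. \<Sum>q<?N. a.block_proj k $$ (i, q) * F l y y $$ (q, j))"
      unfolding G_def mat_mult_index[OF a.block_proj_carrier Fc ij] ..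
    also have "\<dots> = (\<Sum>q<?N. (\<Sum>k<s. a.block_proj k $$ (i, q)) * (\<Sum>l<r. \<Sum>y<m l. F l y y $$ (q, j)))"
    proof -
      have "(\<Sum>l<r. \<Sum>y<m l. \<Sum>q<?N. a.block_proj k $$ (i, q) * F l y y $$ (q, j))
          = (\<Sum>q<?N. a.block_proj k $$ (i, q) * (\<Sum>l<r. \<Sum>y<m l. F l y y $$ (q, j)))" for k
        unfolding sum_distrib_left
        by (subst (2) sum.swap, rule sum.cong, simp, rule sum.swap)
      then show ?thesis by (simp add: sum_distrib_right) (rule sum.swap)
    qed
    also have "\<dots> = (\<Sum>q<?N. if q = i then (if i = j then 1 else 0) else 0)"
      using ij by (intro sum.cong) (auto simp: Fsum Psum)
    also have "\<dots> = (if i = j then 1 else 0)" using ij by simp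
    finally show "(\<Sum>k<s. \<Sum>l<r. \<Sum>y<m l. G k l y y $$ (i, j)) = (if i = j then 1 else 0)" .
  qed (use m Gc in auto)
  obtain a d W V where d: "bij_betw d {..<?N} (coords {..<s} {..<r} m a)"
    and W: "W \<in> carrier_mat ?N ?N" and WW: "mat_adjoint W * W = 1\<^sub>m ?N" "W * mat_adjoint W = 1\<^sub>m ?N"
    and V: "\<And>k l. k \<in> {..<s} \<Longrightarrow> l \<in> {..<r} \<Longrightarrow> V k l \<in> carrier_mat ?N (a k l)"
      "\<And>k l. k \<in> {..<s} \<Longrightarrow> l \<in> {..<r} \<Longrightarrow> mat_adjoint (V k l) * V k l = 1\<^sub>m (a k l)"
      "\<And>k l. k \<in> {..<s} \<Longrightarrow> l \<in> {..<r} \<Longrightarrow> V k l * mat_adjoint (V k l) = G k l 0 0"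
    and WMW: "\<And>M. M \<in> carrier_mat ?N ?N \<Longrightarrow> mat_adjoint W * M * W = labelled_mat ?N d
       (\<lambda>(k, l, y, p) (k', l', y', p'). (mat_adjoint (V k l) * (G k l 0 y * M * G k' l' y' 0) * V k' l') $$ (p, p'))"
    by (rule u.diagonalization) blast
  note W' = mat_adjoint_carrier[OF W]
  have c1: "mat_adjoint W * (W * X) = X" if "X \<in> carrier_mat ?N ?N" for X
    using square_mult_assoc[OF W' W that] WW that by simp
  have c2: "W * (mat_adjoint W * X) = X" if "X \<in> carrier_mat ?N ?N" for X
    using square_mult_assoc[OF W W' that] WW that by simp
  note ws = square_mat_simps[where N = ?N] W W' WW c1 c2
  interpret c: block_labelling ?N d "coords {..<s} {..<r} m a"
    by standard (rule d)
  \<comment> \<open>If the corners of \<open>M\<close> between matrix units are scalar multiples of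
    \<open>G k l 0 0\<close>, then \<open>W\<close> brings \<open>M\<close> into a form acting on
    \<open>y\<close> alone. This applies to the central projections of \<open>A\<close> as well as
    to the elements of \<open>B\<close>.\<close>
  have compress: "mat_adjoint W * M * W = c.lm (\<lambda>(k, l, y, p) (k', l', y', p').
      if k = k' \<and> l = l' \<and> p = p' then f k l y y' else 0)"
    if M: "M \<in> carrier_mat ?N ?N"
      and f: "\<And>k l y k' l' y'. k < s \<Longrightarrow> l < r \<Longrightarrow> y < m l \<Longrightarrow> k' < s \<Longrightarrow> l' < r \<Longrightarrow> y' < m l' \<Longrightarrow>
        G k l 0 y * M * G k' l' y' 0 = (if k = k' \<and> l = l' then f k l y y' \<cdot>\<^sub>m G k l 0 0 else 0\<^sub>m ?N ?N)" for M f
    unfolding WMW[OF M]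
  proof (rule c.lm_eqI)
    fix u v assume uv: "u \<in> coords {..<s} {..<r} m a" "v \<in> coords {..<s} {..<r} m a"
    obtain k l y p where u: "u = (k, l, y, p)" by (metis prod_cases4)
    obtain k' l' y' p' where v: "v = (k', l', y', p')" by (metis prod_cases4)
    have b: "k < s" "l < r" "y < m l" "p < a k l" "k' < s" "l' < r" "y' < m l'" "p' < a k' l'"
      using uv by (auto simp: u v coords_def)
    have b': "k \<in> {..<s}" "l \<in> {..<r}" "k' \<in> {..<s}" "l' \<in> {..<r}" using b by auto
    note v1 = V(1)[OF b'(1,2)] and v2 = V(1)[OF b'(3,4)]
    note v1' = mat_adjoint_carrier[OF v1]
    have "(mat_adjoint (V k l) * (G k l 0 y * M * G k' l' y' 0) * V k' l') $$ (p, p')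
        = (if k = k' \<and> l = l' \<and> p = p' then f k l y y' else 0)"
    proof (cases "k = k' \<and> l = l'")
      case True
      have "mat_adjoint (V k l) * (f k l y y' \<cdot>\<^sub>m G k l 0 0) * V k l
          = f k l y y' \<cdot>\<^sub>m (mat_adjoint (V k l) * G k l 0 0 * V k l)"
        using mult_smult_distrib[OF v1' Gc] mult_smult_assoc_mat[OF mult_carrier_mat[OF v1' Gc] v1] by simp
      also have "mat_adjoint (V k l) * G k l 0 0 * V k l = (mat_adjoint (V k l) * V k l) * (mat_adjoint (V k l) * V k l)"
        unfolding V(3)[OF b'(1,2), symmetric]
        using assoc_mult_mat[OF v1' v1 v1'] assoc_mult_mat[OF mult_carrier_mat[OF v1' v1] v1' v1] by simp
      also have "\<dots> = 1\<^sub>m (a k l)" using V(2)[OF b'(1,2)] by simp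
      finally show ?thesis using True f[OF b(1-3,5-7)] b by auto
    next
      case False
      have "mat_adjoint (V k l) * 0\<^sub>m ?N ?N * V k' l' = 0\<^sub>m (a k l) (a k' l')"
        by (simp only: right_mult_zero_mat[OF v1'] left_mult_zero_mat[OF v2])
      then have "(mat_adjoint (V k l) * 0\<^sub>m ?N ?N * V k' l') $$ (p, p') = 0" using b by simp
      then show ?thesis using False f[OF b(1-3,5-7)] by auto
    qed
    then show "(case u of (k, l, y, p) \<Rightarrow> \<lambda>(k', l', y', p'). (mat_adjoint (V k l) * (G k l 0 y * M * G k' l' y' 0) * V k' l') $$ (p, p')) v
        = (case u of (k, l, y, p) \<Rightarrow> \<lambda>(k', l', y', p'). if k = k' \<and> l = l' \<and> p = p' then f k l y y' else 0) v"
      by (simp add: u v)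
  qed
  have Wpk: "mat_adjoint W * a.block_proj k0 * W = c.block_proj k0" for k0
  proof -
    have "mat_adjoint W * a.block_proj k0 * W = c.lm (\<lambda>(k, l, y, p) (k', l', y', p').
      if k = k' \<and> l = l' \<and> p = p' then (if k = k0 \<and> y = y' then 1 else 0) else 0)"
    proof (rule compress[OF a.block_proj_carrier])
      fix k l y k' l' y' assume b: "k < s" "l < r" "y < m l" "k' < s" "l' < r" "y' < m l'"
      show "G k l 0 y * a.block_proj k0 * G k' l' y' 0 =
        (if k = k' \<and> l = l' then (if k = k0 \<and> y = y' then 1 else 0) \<cdot>\<^sub>m G k l 0 0 else 0\<^sub>m ?N ?N)"
      proof -
        have "F l 0 y * a.block_proj k0 * F l' y' 0 = a.block_proj k0 * (F l 0 y * F l' y' 0)"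
          unfolding a.block_proj_commute[OF FA, symmetric] using Fc by (simp add: square_mat_simps[where N = ?N])
        then have "a.block_proj k * (F l 0 y * a.block_proj k0 * F l' y' 0) = (a.block_proj k * a.block_proj k0) * (F l 0 y * F l' y' 0)"
          using Fc by (simp add: square_mat_simps[where N = ?N])
        also have "\<dots> = (if k = k0 \<and> l = l' \<and> y = y' then G k l 0 0 else 0\<^sub>m ?N ?N)"
          unfolding a.block_proj_block_proj FF[OF b(2,3,5,6)] using Fc by (auto simp: G_def square_mat_simps[where N = ?N])
        finally show ?thesis
          unfolding sandwich[OF a.block_proj_bigA] using Gc[of k l 0 0] by (auto intro!: eq_matI)
      qed
    qed
    also have "\<dots> = c.block_proj k0" unfolding c.block_proj_def by (rule c.lm_eqI) (auto split: if_splits)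
    finally show ?thesis .
  qed
  have W\<rho>: "mat_adjoint W * \<rho> (b.lm f) * W = c.lm (\<lambda>(k, l, y, p) (k', l', y', p').
      if k = k' \<and> l = l' \<and> p = p' then f (l, y) (l, y') else 0)" if lm: "b.lm f \<in> b.bigA" for f
  proof (rule compress[OF asub(2)[OF \<rho>(1)[OF lm]]])
    fix k l y k' l' y' assume b: "k < s" "l < r" "y < m l" "k' < s" "l' < r" "y' < m l'"
    show "G k l 0 y * \<rho> (b.lm f) * G k' l' y' 0 =
        (if k = k' \<and> l = l' then f (l, y) (l, y') \<cdot>\<^sub>m G k l 0 0 else 0\<^sub>m ?N ?N)"
      unfolding sandwich[OF \<rho>(1)[OF lm]] rho_sandwich[OF lm IBm[OF b(2,3)] IBm[OF b(5,6)]]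
      using mult_smult_distrib[OF a.block_proj_carrier Fc] square_mult_zero(1)[OF a.block_proj_carrier] by (simp add: G_def)
  qed
  \<comment> \<open>\<open>W\<close> carries the block projections to those of the coordinates by
    \<open>Wpk\<close>, and both algebras are the commutants of their block projections;
    \<open>WA'\<close> is the other direction.\<close>
  have WA: "mat_adjoint W * X * W \<in> c.bigA" if X: "X \<in> a.bigA" for X
  proof (rule c.commute_imp_bigA)
    have Xc: "X \<in> carrier_mat ?N ?N" by (rule asub(2)[OF X])
    show "mat_adjoint W * X * W \<in> carrier_mat ?N ?N" using Xc by (simp add: ws)
    fix k
    have "c.block_proj k * (mat_adjoint W * X * W) = mat_adjoint W * (a.block_proj k * X) * W"
      unfolding Wpk[symmetric] using Xc by (simp add: ws)
    also have "\<dots> = mat_adjoint W * X * W * c.block_proj k"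
      unfolding Wpk[symmetric] a.block_proj_commute[OF X] using Xc by (simp add: ws)
    finally show "c.block_proj k * (mat_adjoint W * X * W) = mat_adjoint W * X * W * c.block_proj k" .
  qed
  have WA': "W * Y * mat_adjoint W \<in> a.bigA" if Y: "Y \<in> c.bigA" for Y
  proof (rule a.commute_imp_bigA)
    have Yc: "Y \<in> carrier_mat ?N ?N" using Y c.bigA_carrier by blast
    show "W * Y * mat_adjoint W \<in> carrier_mat ?N ?N" using Yc by (simp add: ws)
    fix k
    have P: "a.block_proj k = W * c.block_proj k * mat_adjoint W" unfolding Wpk[symmetric] by (simp add: ws)
    have "a.block_proj k * (W * Y * mat_adjoint W) = W * (c.block_proj k * Y) * mat_adjoint W"
      unfolding P using Yc by (simp add: ws)
    also have "\<dots> = W * Y * mat_adjoint W * a.block_proj k"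
      unfolding P c.block_proj_commute[OF Y] using Yc by (simp add: ws)
    finally show "a.block_proj k * (W * Y * mat_adjoint W) = W * Y * mat_adjoint W * a.block_proj k" .
  qed
  define Ad where "Ad X = mat_adjoint W * X * W" for X
  have AdA: "Ad ` a.bigA = c.bigA"
  proof (intro equalityI subsetI)
    fix Y assume Y: "Y \<in> c.bigA"
    have Yc: "Y \<in> carrier_mat ?N ?N" using Y c.bigA_carrier by blast
    have "Y = Ad (W * Y * mat_adjoint W)" unfolding Ad_def using Yc by (simp add: ws)
    then show "Y \<in> Ad ` a.bigA" using WA'[OF Y] by blast
  qed (auto simp: Ad_def WA)
  have Ad_iso: "star_iso Ad a.bigA c.bigA"
    using star_iso_restrict[OF unitary_conj_star_iso[OF W WW] a.bigA_carrier] AdA by (simp add: Ad_def[abs_def])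
  \<comment> \<open>With a zero column the compressed image of a minimal projection of the summand
    \<open>l\<close> would be zero, against injectivity of \<rho>.\<close>
  have cols: "\<exists>k\<in>{..<s}. 0 < a k l" if "l \<in> {..<r}" for l
  proof (rule ccontr)
    assume no: "\<not> ?thesis"
    let ?f = "\<lambda>u v. if u = (l, 0) \<and> v = (l, 0) then 1 else 0 :: complex"
    have B: "b.lm ?f \<in> b.bigA" by (auto simp: b.bigA_iff)
    have "mat_adjoint W * \<rho> (b.lm ?f) * W = 0\<^sub>m ?N ?N"
      unfolding W\<rho>[OF B] c.lm_zero by (rule c.lm_eqI) (use no in \<open>auto simp: coords_def\<close>)
    then have "W * (mat_adjoint W * \<rho> (b.lm ?f) * W) * mat_adjoint W = 0\<^sub>m ?N ?N" using W W' by simp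
    then have "\<rho> (b.lm ?f) = \<rho> (0\<^sub>m ?M ?M)" unfolding \<rho>_zero using asub(2)[OF \<rho>(1)[OF B]] by (simp add: ws)
    then have "b.lm ?f = 0\<^sub>m ?M ?M" by (rule \<rho>_inj[OF B zeroB])
    then show False using IBm[of l 0] m that unfolding b.lm_zero b.lm_eq_iff by fastforce
  qed
  \<comment> \<open>With a zero row the block \<open>i\<close> has no coordinates, so its central
    projection would be zero although \<open>n i\<close> is positive.\<close>
  have rows: "\<exists>j<r. 0 < a i j" if i: "i < s" for i
  proof (rule ccontr)
    assume no: "\<not> ?thesis"
    have "c.block_proj i = 0\<^sub>m ?N ?N" unfolding c.block_proj_def c.lm_zero
      by (rule c.lm_eqI) (use no in \<open>auto simp: coords_def\<close>)
    then have "W * (mat_adjoint W * a.block_proj i * W) * mat_adjoint W = 0\<^sub>m ?N ?N" unfolding Wpk using W W' by simp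
    then have "a.block_proj i = 0\<^sub>m ?N ?N" by (simp add: ws)
    then show False using a.block_proj_nonzero[of "(i, 0)" i] n[OF i] i by (simp add: IA_def)
  qed
  interpret c: coord_inclusion ?N d "{..<s}" "{..<r}" m a
    by standard (use cols m in auto)
  show thesis
  proof (rule that[of ?N d s r m a "Ad \<circ> \<theta>0"])
    show "coord_inclusion ?N d {..<s} {..<r} m a" by (rule c.coord_inclusion_axioms)
    show "star_iso (Ad \<circ> \<theta>0) A (labelled_alg ?N d big_pattern)"
      using star_iso_trans[OF \<theta>A Ad_iso] unfolding c.bigA_def .
    have "(Ad \<circ> \<theta>0) ` B = Ad ` \<rho> ` b.bigA" by (simp add: \<rho>_image image_comp)
    also have "\<dots> = c.smallB"
    proof (intro equalityI subsetI)
      fix Y assume "Y \<in> Ad ` \<rho> ` b.bigA"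
      then obtain X where X: "X \<in> b.bigA" "Y = Ad (\<rho> X)" by blast
      obtain f where f: "X = b.lm f" by (rule b.bigA_obtain[OF X(1)])
      have "Y = c.lm (c.small_entry (\<lambda>l y y'. f (l, y) (l, y')))"
        unfolding X(2) f Ad_def W\<rho>[OF X(1)[unfolded f]] c.small_entry_def ..
      then show "Y \<in> c.smallB" unfolding c.smallB_eq by blast
    next
      fix Y assume "Y \<in> c.smallB"
      then obtain q where q: "Y = c.lm (c.small_entry q)" unfolding c.smallB_eq by blast
      let ?f = "\<lambda>u v. if fst u = fst v then q (fst u) (snd u) (snd v) else 0"
      have B: "b.lm ?f \<in> b.bigA" by (auto simp: b.bigA_iff)
      have "Y = Ad (\<rho> (b.lm ?f))"
        unfolding q Ad_def W\<rho>[OF B] c.small_entry_def by (rule c.lm_eqI) (auto split: if_splits)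
      then show "Y \<in> Ad ` \<rho> ` b.bigA" using B by blast
    qed
    finally show "(Ad \<circ> \<theta>0) ` B = labelled_alg ?N d small_pattern" unfolding c.smallB_def .
  qed (use s rows in auto)
qed

section \<open>Generated inclusions\<close>

lemma labelled_alg_subspace: "mat_subspace N (labelled_alg N d P)"
proof -
  let ?f = "\<lambda>c u v. case P u v of None \<Rightarrow> 0 | Some x \<Rightarrow> c x"
  have "0\<^sub>m N N = labelled_mat N d (?f (\<lambda>_. 0))"
    by (rule eq_matI) (auto simp: labelled_mat_def split: option.splits)
  moreover have "labelled_mat N d (?f c) + labelled_mat N d (?f c') = labelled_mat N d (?f (\<lambda>x. c x + c' x))" for c c'
    unfolding labelled_mat_add by (rule eq_matI) (auto simp: labelled_mat_def split: option.splits)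
  moreover have "b \<cdot>\<^sub>m labelled_mat N d (?f c) = labelled_mat N d (?f (\<lambda>x. b * c x))" for b c
    unfolding labelled_mat_smult by (rule eq_matI) (auto simp: labelled_mat_def split: option.splits)
  ultimately show ?thesis
    unfolding mat_subspace_def using labelled_alg_carrier[of N d P] by (auto simp: labelled_alg_def)
qed

text \<open>Only vanishing and coincidence of entries matter, so the values of a pattern may be
  renamed by any map that is injective on the values that occur.\<close>

lemma labelled_alg_recode:
  assumes P: "\<And>g h. g < N \<Longrightarrow> h < N \<Longrightarrow> P' (d' g) (d' h) = map_option \<xi> (P (d g) (d h))"
    and inj: "inj_on \<xi> {x. \<exists>g<N. \<exists>h<N. P (d g) (d h) = Some x}"
  shows "labelled_alg N d P = labelled_alg N d' P'"
proof (intro equalityI subsetI)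
  fix X assume "X \<in> labelled_alg N d P"
  then obtain c where X: "X = labelled_mat N d (\<lambda>u v. case P u v of None \<Rightarrow> 0 | Some x \<Rightarrow> c x)"
    by (auto simp: labelled_alg_def)
  let ?R = "{x. \<exists>g<N. \<exists>h<N. P (d g) (d h) = Some x}"
  have inv: "inv_into ?R \<xi> (\<xi> x) = x" if "g < N" "h < N" "P (d g) (d h) = Some x" for g h x
    by (rule inv_into_f_f[OF inj]) (use that in blast)
  have "X = labelled_mat N d' (\<lambda>u v. case P' u v of None \<Rightarrow> 0 | Some x \<Rightarrow> c (inv_into ?R \<xi> x))"
    unfolding X by (rule eq_matI) (auto simp: labelled_mat_def P inv split: option.splits)
  then show "X \<in> labelled_alg N d' P'" by (auto simp: labelled_alg_def)
next
  fix X assume "X \<in> labelled_alg N d' P'"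
  then obtain c where X: "X = labelled_mat N d' (\<lambda>u v. case P' u v of None \<Rightarrow> 0 | Some x \<Rightarrow> c x)"
    by (auto simp: labelled_alg_def)
  have "X = labelled_mat N d (\<lambda>u v. case P u v of None \<Rightarrow> 0 | Some x \<Rightarrow> c (\<xi> x))"
    unfolding X by (rule eq_matI) (auto simp: labelled_mat_def P split: option.splits)
  then show "X \<in> labelled_alg N d P" by (auto simp: labelled_alg_def)
qed

definition tensor_pattern :: "('u \<Rightarrow> 'u \<Rightarrow> 'c option) \<Rightarrow> ('v \<Rightarrow> 'v \<Rightarrow> 'e option) \<Rightarrow> 'u \<times> 'v \<Rightarrow> 'u \<times> 'v \<Rightarrow> ('c \<times> 'e) option" where
  "tensor_pattern P Q = (\<lambda>(u, u') (v, v'). case P u v of None \<Rightarrow> None | Some x \<Rightarrow> map_option (Pair x) (Q u' v'))"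

text \<open>Kronecker products have coefficients of product form \<open>c x * c' y\<close>; the span
  reaches arbitrary coefficients on pairs because it contains the indicator of each pair of
  values.\<close>

lemma alg_tensor_labelled:
  "alg_tensor N (labelled_alg N d P) N' (labelled_alg N' d' P')
    = labelled_alg (N * N') (\<lambda>g. (d (g div N'), d' (g mod N'))) (tensor_pattern P P')"
    (is "?L = ?R")
proof
  let ?d = "\<lambda>g. (d (g div N'), d' (g mod N'))"
  let ?S = "{kron X Y |X Y. X \<in> labelled_alg N d P \<and> Y \<in> labelled_alg N' d' P'}"
  have lt: "g div N' < N" "g mod N' < N'" if "g < N * N'" for g
    using that by (simp add: less_mult_imp_div_less, cases "N' = 0", auto)
  have kr: "kron (labelled_mat N d f) (labelled_mat N' d' f') = labelled_mat (N * N') ?d (\<lambda>u v. f (fst u) (fst v) * f' (snd u) (snd v))" for f f'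
    by (rule eq_matI) (auto simp: kron_def labelled_mat_def lt)
  have sub: "?S \<subseteq> ?R"
  proof
    fix Z assume "Z \<in> ?S"
    then obtain c c' where Z: "Z = kron (labelled_mat N d (\<lambda>u v. case P u v of None \<Rightarrow> 0 | Some x \<Rightarrow> c x))
        (labelled_mat N' d' (\<lambda>u v. case P' u v of None \<Rightarrow> 0 | Some x \<Rightarrow> c' x))"
      by (auto simp: labelled_alg_def)
    have "Z = labelled_mat (N * N') ?d (\<lambda>u v. case tensor_pattern P P' u v of None \<Rightarrow> 0 | Some x \<Rightarrow> (\<lambda>(x, y). c x * c' y) x)"
      unfolding Z kr by (rule eq_matI) (auto simp: labelled_mat_def tensor_pattern_def split: option.splits)
    then show "Z \<in> ?R" by (auto simp: labelled_alg_def)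
  qed
  show "?L \<subseteq> ?R"
    unfolding alg_tensor_def by (rule mat_span_minimal[OF labelled_alg_subspace sub])
  have Sc: "?S \<subseteq> carrier_mat (N * N') (N * N')" using sub labelled_alg_carrier by blast
  show "?R \<subseteq> ?L"
  proof
    fix Z assume "Z \<in> ?R"
    then obtain c where Z: "Z = labelled_mat (N * N') ?d (\<lambda>u v. case tensor_pattern P P' u v of None \<Rightarrow> 0 | Some x \<Rightarrow> c x)"
      by (auto simp: labelled_alg_def)
    let ?E = "\<lambda>N d P z. labelled_mat N d (\<lambda>u v. case P u v of None \<Rightarrow> 0 | Some x \<Rightarrow> if x = z then 1 else 0)"
    \<comment> \<open>These finite sets contain all values that occur. \<open>the None\<close> may
      add one more, whose indicator matrix is zero unless the value occurs anyway.\<close>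
    define R where "R = (\<lambda>(g, h). the (P (d g) (d h))) ` ({..<N} \<times> {..<N})"
    define R' where "R' = (\<lambda>(g, h). the (P' (d' g) (d' h))) ` ({..<N'} \<times> {..<N'})"
    have R: "x \<in> R" if "g < N" "h < N" "P (d g) (d h) = Some x" for g h x
      unfolding R_def using that by (intro image_eqI[of _ _ "(g, h)"]) auto
    have R': "x \<in> R'" if "g < N'" "h < N'" "P' (d' g) (d' h) = Some x" for g h x
      unfolding R'_def using that by (intro image_eqI[of _ _ "(g, h)"]) auto
    have finR: "finite (R \<times> R')" by (auto simp: R_def R'_def)
    let ?M = "\<lambda>w. kron (?E N d P (fst w)) (?E N' d' P' (snd w))"
    have "mat (N * N') (N * N') (\<lambda>p. \<Sum>w\<in>R \<times> R'. c w * ?M w $$ p) \<in> mat_span (N * N') ?S"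
    proof (rule mat_subspace_sum[OF mat_span_subspace[OF Sc] finR])
      fix w
      have "?M w \<in> ?S" by (auto simp: labelled_alg_def)
      then show "?M w \<in> mat_span (N * N') ?S" using mat_span_superset[OF Sc] by blast
    qed
    also have "mat (N * N') (N * N') (\<lambda>p. \<Sum>w\<in>R \<times> R'. c w * ?M w $$ p) = Z"
    proof (rule eq_matI)
      fix g h assume "g < dim_row Z" "h < dim_col Z"
      then have gh: "g < N * N'" "h < N * N'" by (auto simp: Z)
      note l = lt[OF gh(1)] lt[OF gh(2)]
      show "mat (N * N') (N * N') (\<lambda>p. \<Sum>w\<in>R \<times> R'. c w * ?M w $$ p) $$ (g, h) = Z $$ (g, h)"
      proof (cases "tensor_pattern P P' (?d g) (?d h)")
        case None
        then have "P (d (g div N')) (d (h div N')) = None \<or> P' (d' (g mod N')) (d' (h mod N')) = None"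
          by (auto simp: tensor_pattern_def split: option.splits)
        then have "?M w $$ (g, h) = 0" for w
          unfolding kr using gh by (auto simp: labelled_mat_def)
        then show ?thesis using gh None by (simp add: Z labelled_mat_def)
      next
        case (Some xy)
        then obtain x y where xy: "xy = (x, y)" "P (d (g div N')) (d (h div N')) = Some x"
          "P' (d' (g mod N')) (d' (h mod N')) = Some y"
          by (auto simp: tensor_pattern_def split: option.splits)
        have "(\<Sum>w\<in>R \<times> R'. c w * ?M w $$ (g, h)) = (\<Sum>w\<in>R \<times> R'. if w = (x, y) then c (x, y) else 0)"
          unfolding kr using gh by (intro sum.cong) (auto simp: labelled_mat_def xy)
        also have "\<dots> = c (x, y)" using finR R[OF l(1,3) xy(2)] R'[OF l(2,4) xy(3)] by simp
        finally show ?thesis using gh Some by (simp add: Z labelled_mat_def xy(1))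
      qed
    qed (auto simp: Z)
    finally show "Z \<in> ?L" unfolding alg_tensor_def .
  qed
qed

lemma tensor_label_bij:
  fixes N N' :: nat
  assumes "bij_betw d {..<N} I" "bij_betw d' {..<N'} I'"
  shows "bij_betw (\<lambda>g. (d (g div N'), d' (g mod N'))) {..<N * N'} (I \<times> I')"
proof -
  have 1: "bij_betw (\<lambda>w. (w div N', w mod N')) {..<N * N'} ({..<N} \<times> {..<N'})"
  proof (rule bij_betw_byWitness[where f' = "\<lambda>(y, p). y * N' + p"])
    show "(\<lambda>(y, p). y * N' + p) ` ({..<N} \<times> {..<N'}) \<subseteq> {..<N * N'}"
      using div_mod_bij[of N' N] by (simp add: bij_betw_def)
    show "(\<lambda>w. (w div N', w mod N')) ` {..<N * N'} \<subseteq> {..<N} \<times> {..<N'}"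
    proof safe
      fix w assume "w < N * N'"
      then show "w div N' < N" "w mod N' < N'"
        by (simp add: less_mult_imp_div_less, cases "N' = 0", auto)
    qed
  qed auto
  from bij_betw_trans[OF 1 bij_betw_map_prod[OF assms]] show ?thesis by (simp add: o_def)
qed

text \<open>\<open>Q\<close> tells the values of the first summand from those of the second. No
  value is shared, so the coefficients on both sides can be chosen independently under one
  pattern.\<close>

lemma alg_sum_labelled:
  assumes in1: "\<And>g h x. g < N1 \<Longrightarrow> h < N1 \<Longrightarrow> P (d1 g) (d1 h) = Some x \<Longrightarrow> Q x"
    and in2: "\<And>g h x. g < N2 \<Longrightarrow> h < N2 \<Longrightarrow> P (d2 g) (d2 h) = Some x \<Longrightarrow> \<not> Q x"
    and cross: "\<And>g h. g < N1 \<Longrightarrow> h < N2 \<Longrightarrow> P (d1 g) (d2 h) = None \<and> P (d2 h) (d1 g) = None"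
  shows "alg_sum (labelled_alg N1 d1 P) (labelled_alg N2 d2 P)
    = labelled_alg (N1 + N2) (\<lambda>g. if g < N1 then d1 g else d2 (g - N1)) P" (is "?L = ?R")
proof -
  let ?f = "\<lambda>c u v. case P u v of None \<Rightarrow> 0 | Some x \<Rightarrow> c x"
  let ?d = "\<lambda>g. if g < N1 then d1 g else d2 (g - N1)"
  have eq: "diag_block_mat [labelled_mat N1 d1 (?f c1), labelled_mat N2 d2 (?f c2)] = labelled_mat (N1 + N2) ?d (?f c)"
    if "\<And>g h x. g < N1 \<Longrightarrow> h < N1 \<Longrightarrow> P (d1 g) (d1 h) = Some x \<Longrightarrow> c x = c1 x"
      "\<And>g h x. g < N2 \<Longrightarrow> h < N2 \<Longrightarrow> P (d2 g) (d2 h) = Some x \<Longrightarrow> c x = c2 x" for c c1 c2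
    by (rule eq_matI) (use that cross in \<open>auto simp: labelled_mat_def Let_def split: option.splits\<close>)
  show ?thesis
  proof (intro equalityI subsetI)
    fix Z assume "Z \<in> ?L"
    then obtain c1 c2 where Z: "Z = diag_block_mat [labelled_mat N1 d1 (?f c1), labelled_mat N2 d2 (?f c2)]"
      by (auto simp: alg_sum_def labelled_alg_def)
    have "Z = labelled_mat (N1 + N2) ?d (?f (\<lambda>x. if Q x then c1 x else c2 x))"
      unfolding Z by (rule eq) (use in1 in2 in auto)
    then show "Z \<in> ?R" by (auto simp: labelled_alg_def)
  next
    fix Z assume "Z \<in> ?R"
    then obtain c where "Z = labelled_mat (N1 + N2) ?d (?f c)" by (auto simp: labelled_alg_def)
    then have Z: "Z = diag_block_mat [labelled_mat N1 d1 (?f c), labelled_mat N2 d2 (?f c)]" by (simp only: eq)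
    have "labelled_mat N1 d1 (?f c) \<in> labelled_alg N1 d1 P" "labelled_mat N2 d2 (?f c) \<in> labelled_alg N2 d2 P"
      by (auto simp: labelled_alg_def)
    then show "Z \<in> ?L" unfolding alg_sum_def Z by blast
  qed
qed

lemma sum_label_bij:
  assumes 1: "bij_betw d1 {..<N1::nat} I1" and 2: "bij_betw d2 {..<N2} I2" and "I1 \<inter> I2 = {}"
  shows "bij_betw (\<lambda>g. if g < N1 then d1 g else d2 (g - N1)) {..<N1 + N2} (I1 \<union> I2)"
proof -
  let ?d = "\<lambda>g. if g < N1 then d1 g else d2 (g - N1)"
  have "bij_betw ?d {..<N1} I1" using 1 by (rule bij_betw_cong[THEN iffD1, rotated]) auto
  moreover have "bij_betw (\<lambda>g. g - N1) {N1..<N1 + N2} {..<N2}"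
    by (rule bij_betw_byWitness[where f' = "\<lambda>g. g + N1"]) auto
  from bij_betw_trans[OF this 2] have "bij_betw ?d {N1..<N1 + N2} I2"
    by (rule bij_betw_cong[THEN iffD1, rotated]) auto
  ultimately have "bij_betw ?d ({..<N1} \<union> {N1..<N1 + N2}) (I1 \<union> I2)"
    using assms(3) by (rule bij_betw_combine)
  moreover have "{..<N1} \<union> {N1..<N1 + N2} = {..<N1 + N2}" by auto
  ultimately show ?thesis by simp
qed

text \<open>The enumeration is existential because sums and tensor products each impose their own
  order on the basis.\<close>

definition realizable :: "nat set \<Rightarrow> nat set \<Rightarrow> (nat \<Rightarrow> nat) \<Rightarrow> (nat \<Rightarrow> nat \<Rightarrow> nat) \<Rightarrow> bool" where
  "realizable K L m a \<longleftrightarrow> (\<exists>N d. bij_betw d {..<N} (coords K L m a) \<and>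
     generated_inclusion N (labelled_alg N d small_pattern) (labelled_alg N d big_pattern))"

text \<open>By \<open>z\<close> no coordinate pairs a row of one part with a column of the other, so
  the coordinates of the union are the disjoint union of the two coordinate sets.\<close>

lemma realizable_sum:
  assumes 1: "realizable K1 L1 m a" and 2: "realizable K2 L2 m a"
    and disj: "K1 \<inter> K2 = {}" "L1 \<inter> L2 = {}"
    and z: "\<And>k l. k \<in> K1 \<Longrightarrow> l \<in> L2 \<Longrightarrow> a k l = 0" "\<And>k l. k \<in> K2 \<Longrightarrow> l \<in> L1 \<Longrightarrow> a k l = 0"
  shows "realizable (K1 \<union> K2) (L1 \<union> L2) m a"
proof -
  obtain N1 d1 where d1: "bij_betw d1 {..<N1} (coords K1 L1 m a)"
    and g1: "generated_inclusion N1 (labelled_alg N1 d1 small_pattern) (labelled_alg N1 d1 big_pattern)"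
    using 1 by (auto simp: realizable_def)
  obtain N2 d2 where d2: "bij_betw d2 {..<N2} (coords K2 L2 m a)"
    and g2: "generated_inclusion N2 (labelled_alg N2 d2 small_pattern) (labelled_alg N2 d2 big_pattern)"
    using 2 by (auto simp: realizable_def)
  let ?d = "\<lambda>g. if g < N1 then d1 g else d2 (g - N1)"
  have m1: "fst (d1 g) \<in> K1" "fst (snd (d1 g)) \<in> L1" if "g < N1" for g
    using bij_betwE[OF d1, rule_format, of g] that by (auto simp: coords_def)
  have m2: "fst (d2 g) \<in> K2" "fst (snd (d2 g)) \<in> L2" if "g < N2" for g
    using bij_betwE[OF d2, rule_format, of g] that by (auto simp: coords_def)
  have "alg_sum (labelled_alg N1 d1 small_pattern) (labelled_alg N2 d2 small_pattern) = labelled_alg (N1 + N2) ?d small_pattern"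
  proof (rule alg_sum_labelled[where Q = "\<lambda>x. fst x \<in> L1"])
    show "fst x \<in> L1" if "g < N1" "h < N1" "small_pattern (d1 g) (d1 h) = Some x" for g h x
      using m1[OF that(1)] that(3) by (auto simp: small_pattern_def split: prod.splits if_splits)
    show "fst x \<notin> L1" if "g < N2" "h < N2" "small_pattern (d2 g) (d2 h) = Some x" for g h x
      using m2[OF that(1)] that(3) disj by (auto simp: small_pattern_def split: prod.splits if_splits)
    show "small_pattern (d1 g) (d2 h) = None \<and> small_pattern (d2 h) (d1 g) = None" if "g < N1" "h < N2" for g h
      using m1[OF that(1)] m2[OF that(2)] disj by (auto simp: small_pattern_def split: prod.splits)
  qed
  moreover have "alg_sum (labelled_alg N1 d1 big_pattern) (labelled_alg N2 d2 big_pattern) = labelled_alg (N1 + N2) ?d big_pattern"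
  proof (rule alg_sum_labelled[where Q = "\<lambda>x. fst (fst x) \<in> K1"])
    show "fst (fst x) \<in> K1" if "g < N1" "h < N1" "big_pattern (d1 g) (d1 h) = Some x" for g h x
      using m1[OF that(1)] that(3) by (auto simp: big_pattern_def split: if_splits)
    show "fst (fst x) \<notin> K1" if "g < N2" "h < N2" "big_pattern (d2 g) (d2 h) = Some x" for g h x
      using m2[OF that(1)] that(3) disj by (auto simp: big_pattern_def split: if_splits)
    show "big_pattern (d1 g) (d2 h) = None \<and> big_pattern (d2 h) (d1 g) = None" if "g < N1" "h < N2" for g h
      using m1[OF that(1)] m2[OF that(2)] disj by (auto simp: big_pattern_def)
  qed
  moreover have "bij_betw ?d {..<N1 + N2} (coords (K1 \<union> K2) (L1 \<union> L2) m a)"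
  proof -
    have "coords K1 L1 m a \<inter> coords K2 L2 m a = {}" using disj by (auto simp: coords_def)
    moreover have "coords (K1 \<union> K2) (L1 \<union> L2) m a = coords K1 L1 m a \<union> coords K2 L2 m a"
      using z by (auto simp: coords_def)
    ultimately show ?thesis using sum_label_bij[OF d1 d2] by simp
  qed
  ultimately show ?thesis
    using generated_inclusion.direct_sum[OF g1 g2] unfolding realizable_def
    by (intro exI[of _ "N1 + N2"] exI[of _ ?d]) simp
qed

section \<open>The building blocks as labelled algebras, and the classes of columns\<close>

lemma carrier_mat_labelled: "carrier_mat k k = labelled_alg k (\<lambda>g. g) (\<lambda>u v. Some (u, v))"
proof (intro equalityI subsetI)
  fix X :: "complex mat" assume "X \<in> carrier_mat k k"
  then have "X = labelled_mat k (\<lambda>g. g) (\<lambda>u v. case Some (u, v) of None \<Rightarrow> 0 | Some x \<Rightarrow> X $$ x)"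
    by (intro eq_matI) (auto simp: labelled_mat_def)
  then show "X \<in> labelled_alg k (\<lambda>g. g) (\<lambda>u v. Some (u, v))" unfolding labelled_alg_def by blast
qed (use labelled_alg_carrier in blast)

lemma diagonal_labelled:
  "{D \<in> carrier_mat t t. diagonal_mat D} = labelled_alg t (\<lambda>g. g) (\<lambda>u v. if u = v then Some u else None)"
proof (intro equalityI subsetI)
  fix X :: "complex mat" assume "X \<in> {D \<in> carrier_mat t t. diagonal_mat D}"
  then have "X = labelled_mat t (\<lambda>g. g) (\<lambda>u v. case if u = v then Some u else None of None \<Rightarrow> 0 | Some x \<Rightarrow> X $$ (x, x))"
    by (intro eq_matI) (auto simp: labelled_mat_def diagonal_mat_def)
  then show "X \<in> labelled_alg t (\<lambda>g. g) (\<lambda>u v. if u = v then Some u else None)" unfolding labelled_alg_def by blast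
next
  fix X :: "complex mat" assume "X \<in> labelled_alg t (\<lambda>g. g) (\<lambda>u v. if u = v then Some u else None)"
  then show "X \<in> {D \<in> carrier_mat t t. diagonal_mat D}"
    by (auto simp: labelled_alg_def labelled_mat_def diagonal_mat_def)
qed

text \<open>The one-element value type makes all diagonal entries coincide. The labelling is
  arbitrary so that it can be shared with the block algebra containing the scalars.\<close>

lemma scalars_labelled:
  assumes d: "inj_on d {..<N}"
  shows "range (\<lambda>c. c \<cdot>\<^sub>m 1\<^sub>m N) = labelled_alg N d (\<lambda>u v. if u = v then Some () else None)"
proof -
  have "c \<cdot>\<^sub>m 1\<^sub>m N = labelled_mat N d (\<lambda>u v. case if u = v then Some () else None of None \<Rightarrow> 0 | Some x \<Rightarrow> c)" for c
    using d by (intro eq_matI) (auto simp: labelled_mat_def inj_on_def)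
  then have "range (\<lambda>c. c \<cdot>\<^sub>m 1\<^sub>m N)
      = range (\<lambda>c. labelled_mat N d (\<lambda>u v. case if u = v then Some () else None of None \<Rightarrow> 0 | Some x \<Rightarrow> c))"
    by simp
  also have "\<dots> = range (\<lambda>c. labelled_mat N d (\<lambda>u v. case if u = v then Some () else None of None \<Rightarrow> 0 | Some x \<Rightarrow> c x))"
    (is "range ?g = range ?h")
  proof (intro equalityI subsetI)
    fix X assume "X \<in> range ?g"
    then obtain c where "X = ?g c" by blast
    then have "X = ?h (\<lambda>_. c)" by simp
    then show "X \<in> range ?h" by blast
  next
    fix X assume "X \<in> range ?h"
    then obtain c where X: "X = ?h c" by blast
    have "c = (\<lambda>_. c ())" by (rule ext) simp
    with X have "X = ?h (\<lambda>_. c ())" by (rule back_subst[of "\<lambda>c. X = ?h c"])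
    then have "X = ?g (c ())" by simp
    then show "X \<in> range ?g" by blast
  qed
  finally show ?thesis unfolding labelled_alg_def .
qed

text \<open>With constant sizes and multiplicities depending on \<open>k\<close> alone, coordinates
  are a product of the ranges of \<open>y\<close>, of \<open>l\<close> and of \<open>(k, p)\<close>.
  Here \<open>B\<close> is full in \<open>y\<close>, diagonal in \<open>l\<close> and scalar in
  \<open>(k, p)\<close>, while \<open>A\<close> is full in \<open>y\<close> and \<open>l\<close> and
  block diagonal in \<open>k\<close>.\<close>

lemma realizable_class:
  assumes K: "finite K" "K \<noteq> {}" and L: "finite L" "L \<noteq> {}"
    and m: "\<And>l. l \<in> L \<Longrightarrow> m l = \<mu>" "0 < \<mu>" and a: "\<And>k l. k \<in> K \<Longrightarrow> l \<in> L \<Longrightarrow> a k l = c k" "\<And>k. k \<in> K \<Longrightarrow> 0 < c k"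
  shows "realizable K L m a"
proof -
  obtain kk where kk: "bij_betw kk {..<card K} K" using ex_bij_betw_nat_finite[OF K(1)] by (metis lessThan_atLeast0)
  obtain ll where ll: "bij_betw ll {..<card L} L" using ex_bij_betw_nat_finite[OF L(1)] by (metis lessThan_atLeast0)
  let ?v = "card K" and ?t = "card L" and ?c = "\<lambda>i. c (kk i)"
  let ?w = "offset ?c ?v"
  have kkK: "kk i \<in> K" if "i < ?v" for i using kk that by (auto simp: bij_betw_def)
  have bid: "bij_betw (\<lambda>x. x) {..<k} {..<k}" for k :: nat by (simp add: bij_betw_def)
  let ?J = "SIGMA i:{..<?v}. {..<?c i}"
  let ?d3 = "inv_into ?J (\<lambda>(i, x). offset ?c i + x)"
  have d3: "bij_betw ?d3 {..<?w} ?J"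
    by (rule bij_betw_inv_into, rule offset_bij[of ?v "\<lambda>i x. x"]) (rule bid)
  have A3: "block_alg ?v ?c = labelled_alg ?w ?d3 big_pattern"
    by (rule block_alg_labelled[of ?v "\<lambda>i x. x"]) (rule bid)
  note B3 = scalars_labelled[OF bij_betw_imp_inj_on[OF d3]]
  have "generated_inclusion ?w (range (\<lambda>c. c \<cdot>\<^sub>m 1\<^sub>m ?w)) (block_alg ?v ?c)"
    by (rule generated_inclusion.scalars) (use K kkK a(2) in \<open>auto simp: card_gt_0_iff offset_def\<close>)
  moreover have "generated_inclusion ?t {D \<in> carrier_mat ?t ?t. diagonal_mat D} (carrier_mat ?t ?t)"
    by (rule generated_inclusion.diagonal) (use L in \<open>simp add: card_gt_0_iff\<close>)
  moreover have "generated_inclusion \<mu> (carrier_mat \<mu> \<mu>) (carrier_mat \<mu> \<mu>)"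
    by (rule generated_inclusion.full[OF m(2)])
  ultimately have gen: "generated_inclusion (\<mu> * (?t * ?w))
      (alg_tensor \<mu> (carrier_mat \<mu> \<mu>) (?t * ?w) (alg_tensor ?t {D \<in> carrier_mat ?t ?t. diagonal_mat D} ?w (range (\<lambda>c. c \<cdot>\<^sub>m 1\<^sub>m ?w))))
      (alg_tensor \<mu> (carrier_mat \<mu> \<mu>) (?t * ?w) (alg_tensor ?t (carrier_mat ?t ?t) ?w (block_alg ?v ?c)))"
    by (intro generated_inclusion.tensor)
  let ?N = "\<mu> * (?t * ?w)"
  define d0 where "d0 g = (g div (?t * ?w), g mod (?t * ?w) div ?w, ?d3 (g mod (?t * ?w) mod ?w))" for g
  \<comment> \<open>From the order of the tensor factors to that of the coordinates.\<close>
  define F where "F = (\<lambda>(y, j, i, p). (kk i, ll j, y :: nat, p :: nat))"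
  have d0: "bij_betw d0 {..<?N} ({..<\<mu>} \<times> {..<?t} \<times> ?J)"
    using tensor_label_bij[OF bid[of \<mu>] tensor_label_bij[OF bid[of ?t] d3]] unfolding d0_def[abs_def] .
  have ik: "kk i = kk i' \<longleftrightarrow> i = i'" if "i < ?v" "i' < ?v" for i i'
    using kk that by (auto simp: bij_betw_def inj_on_def)
  have il: "ll i = ll i' \<longleftrightarrow> i = i'" if "i < ?t" "i' < ?t" for i i'
    using ll that by (auto simp: bij_betw_def inj_on_def)
  have F: "bij_betw F ({..<\<mu>} \<times> {..<?t} \<times> ?J) (coords K L m a)"
  proof -
    have sk: "\<exists>i<?v. kk i = k" if "k \<in> K" for k using kk that unfolding bij_betw_def by (metis imageE lessThan_iff)
    have sl: "\<exists>i<?t. ll i = k" if "k \<in> L" for k using ll that unfolding bij_betw_def by (metis imageE lessThan_iff)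
    have llL: "ll i \<in> L" if "i < ?t" for i using ll that by (auto simp: bij_betw_def)
    show ?thesis unfolding bij_betw_def
    proof (intro conjI equalityI subsetI)
      show "inj_on F ({..<\<mu>} \<times> {..<?t} \<times> ?J)" by (auto simp: inj_on_def F_def ik il)
      fix u assume "u \<in> coords K L m a"
      then obtain k l y p where u: "u = (k, l, y, p)" "k \<in> K" "l \<in> L" "y < \<mu>" "p < c k"
        by (auto simp: coords_def m a)
      obtain i j where "i < ?v" "kk i = k" "j < ?t" "ll j = l" using sk[OF u(2)] sl[OF u(3)] by blast
      then show "u \<in> F ` ({..<\<mu>} \<times> {..<?t} \<times> ?J)"
        using u by (intro image_eqI[of _ _ "(y, j, i, p)"]) (auto simp: F_def)
    qed (auto simp: F_def coords_def kkK llL m a)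
  qed
  define d where "d = F \<circ> d0"
  have d: "bij_betw d {..<?N} (coords K L m a)" unfolding d_def by (rule bij_betw_trans[OF d0 F])
  have d0mem: "d0 g \<in> {..<\<mu>} \<times> {..<?t} \<times> ?J" if "g < ?N" for g using d0 that by (auto simp: bij_betw_def)
  let ?PA = "tensor_pattern (\<lambda>u v. Some (u, v)) (tensor_pattern (\<lambda>u v. Some (u, v)) big_pattern)
    :: nat \<times> nat \<times> nat \<times> nat \<Rightarrow> nat \<times> nat \<times> nat \<times> nat \<Rightarrow> _"
  let ?PB = "tensor_pattern (\<lambda>u v. Some (u, v)) (tensor_pattern (\<lambda>u v. if u = v then Some u else None) (\<lambda>u v. if u = v then Some () else None))
    :: nat \<times> nat \<times> nat \<times> nat \<Rightarrow> nat \<times> nat \<times> nat \<times> nat \<Rightarrow> _"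
  have "labelled_alg ?N d0 ?PA = labelled_alg ?N d big_pattern"
  proof (rule labelled_alg_recode)
    \<comment> \<open>Three pairs of factor labels are regrouped into one pair of
      coordinates.\<close>
    let ?\<xi> = "\<lambda>((y, y'), (j, j'), (u, u')). (F (y, j, u), F (y', j', u'))"
    show "big_pattern (d g) (d h) = map_option ?\<xi> (?PA (d0 g) (d0 h))" if "g < ?N" "h < ?N" for g h
      using d0mem[OF that(1)] d0mem[OF that(2)]
      by (auto simp: d_def big_pattern_def tensor_pattern_def F_def ik split: prod.splits)
    have Fi: "u = v" if "F u = F v" "u \<in> {..<\<mu>} \<times> {..<?t} \<times> ?J" "v \<in> {..<\<mu>} \<times> {..<?t} \<times> ?J" for u v
      using F that by (auto simp: bij_betw_def inj_on_def)
    show "inj_on ?\<xi> {x. \<exists>g<?N. \<exists>h<?N. ?PA (d0 g) (d0 h) = Some x}"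
    proof (rule inj_onI)
      fix x x' assume "x \<in> {x. \<exists>g<?N. \<exists>h<?N. ?PA (d0 g) (d0 h) = Some x}" "x' \<in> {x. \<exists>g<?N. \<exists>h<?N. ?PA (d0 g) (d0 h) = Some x}"
        and e: "?\<xi> x = ?\<xi> x'"
      then obtain g h g' h' where gh: "g < ?N" "h < ?N" "?PA (d0 g) (d0 h) = Some x" "g' < ?N" "h' < ?N" "?PA (d0 g') (d0 h') = Some x'"
        by blast
      have sp: "x = ((fst u, fst v), (fst (snd u), fst (snd v)), (snd (snd u), snd (snd v)))" if "?PA u v = Some x" for u v x
        using that by (auto simp: tensor_pattern_def big_pattern_def split: prod.splits if_splits)
      show "x = x'"
        using e Fi[OF _ d0mem d0mem, of g g'] Fi[OF _ d0mem d0mem, of h h'] gh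
        unfolding sp[OF gh(3)] sp[OF gh(6)] by simp
    qed
  qed
  moreover have "labelled_alg ?N d0 ?PB = labelled_alg ?N d small_pattern"
  proof (rule labelled_alg_recode)
    \<comment> \<open>The block and the position in it leave no trace here: the scalar factor
      contributes only \<open>()\<close>, as an entry of \<open>B\<close> must not depend on
      \<open>k\<close> and \<open>p\<close>.\<close>
    let ?\<xi> = "\<lambda>((y, y'), j, _). (ll j, y, y')"
    show "small_pattern (d g) (d h) = map_option ?\<xi> (?PB (d0 g) (d0 h))" if "g < ?N" "h < ?N" for g h
      using d0mem[OF that(1)] d0mem[OF that(2)]
      by (auto simp: d_def small_pattern_def tensor_pattern_def F_def ik il split: prod.splits)
    have lt: "fst (snd x) < ?t" if "g < ?N" "h < ?N" "?PB (d0 g) (d0 h) = Some x" for g h x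
      using d0mem[OF that(1)] that(3) by (auto simp: tensor_pattern_def split: prod.splits if_splits)
    show "inj_on ?\<xi> {x. \<exists>g<?N. \<exists>h<?N. ?PB (d0 g) (d0 h) = Some x}"
    proof (rule inj_onI)
      fix x x' assume "x \<in> {x. \<exists>g<?N. \<exists>h<?N. ?PB (d0 g) (d0 h) = Some x}" "x' \<in> {x. \<exists>g<?N. \<exists>h<?N. ?PB (d0 g) (d0 h) = Some x}"
        and e: "?\<xi> x = ?\<xi> x'"
      then have "fst (snd x) < ?t" "fst (snd x') < ?t" using lt by blast+
      then show "x = x'" using e il by (cases x; cases x') (auto simp: prod_eq_iff)
    qed
  qed
  ultimately have "generated_inclusion ?N (labelled_alg ?N d small_pattern) (labelled_alg ?N d big_pattern)"
    using gen unfolding A3 B3 diagonal_labelled unfolding carrier_mat_labelled alg_tensor_labelled d0_def[abs_def] by simp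
  then show ?thesis using d unfolding realizable_def by blast
qed

text \<open>\<open>S\<close> is the class of columns interchangeable with \<open>j\<close>, and
  \<open>R\<close> the set of rows it meets. The entries linking \<open>R\<close> with other
  columns, or other rows with \<open>S\<close>, vanish; so the class splits off as a direct summand
  and the rest has fewer columns.\<close>

lemma realizable_interchangeable:
  assumes "finite K" "finite L" "L \<noteq> {}" "interchangeable_columns K L m a"
    and "\<And>l. l \<in> L \<Longrightarrow> 0 < m l" and "\<And>l. l \<in> L \<Longrightarrow> \<exists>k\<in>K. 0 < a k l" and "\<And>k. k \<in> K \<Longrightarrow> \<exists>l\<in>L. 0 < a k l"
  shows "realizable K L m a"
  using assms
proof (induction "card L" arbitrary: K L rule: less_induct)
  case less
  note fin = less.prems(1,2) and C = less.prems(4) and m = less.prems(5) and cols = less.prems(6) and rows = less.prems(7)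
  obtain j where j: "j \<in> L" using less.prems(3) by blast
  obtain i where i: "i \<in> K" "0 < a i j" using cols[OF j] by blast
  define S where "S = {l \<in> L. 0 < a i l}"
  define R where "R = {k \<in> K. 0 < a k j}"
  have jS: "j \<in> S" "S \<subseteq> L" and iR: "i \<in> R" "R \<subseteq> K" using i j by (auto simp: S_def R_def)
  have S: "m l = m j" "k \<in> K \<Longrightarrow> a k l = a k j" if "l \<in> S" for k l
    by (rule interchangeable_columnsD[OF C i(1)]; use that i j in \<open>auto simp: S_def\<close>)+
  \<comment> \<open>A nonzero entry would let \<open>l\<close> meet \<open>j\<close> in the row
    \<open>k\<close>; then the columns agree in the row \<open>i\<close> too, and \<open>l\<close>
    would belong to \<open>S\<close>.\<close>
  have z1: "a k l = 0" if "k \<in> R" "l \<in> L - S" for k l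
  proof (rule ccontr)
    assume "a k l \<noteq> 0"
    then have "a i l = a i j" using interchangeable_columnsD(2)[OF C, of k l j i] that i j iR by (auto simp: R_def)
    then show False using that i by (auto simp: S_def)
  qed
  have z2: "a k l = 0" if "k \<in> K - R" "l \<in> S" for k l
    using S(2)[OF that(2), of k] that by (auto simp: R_def)
  have RS: "realizable R S m a"
  proof (rule realizable_class[where \<mu> = "m j" and c = "\<lambda>k. a k j"])
    show "finite R" "finite S" using fin jS iR finite_subset by blast+
    show "R \<noteq> {}" "S \<noteq> {}" using jS iR by blast+
    show "\<And>l. l \<in> S \<Longrightarrow> m l = m j" by (rule S(1))
    show "0 < m j" by (rule m[OF j])
    show "\<And>k l. k \<in> R \<Longrightarrow> l \<in> S \<Longrightarrow> a k l = a k j" using S(2) iR by blast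
    show "\<And>k. k \<in> R \<Longrightarrow> 0 < a k j" by (simp add: R_def)
  qed
  show ?case
  proof (cases "S = L")
    case True
    \<comment> \<open>Every row is nonzero somewhere, and with a single class it is then nonzero in
      column \<open>j\<close>.\<close>
    have "R = K"
    proof
      show "K \<subseteq> R"
      proof
        fix k assume k: "k \<in> K"
        then obtain l where "l \<in> L" "0 < a k l" using rows by blast
        then show "k \<in> R" using S(2)[of l k] k True by (simp add: R_def)
      qed
    qed (rule iR(2))
    then show ?thesis using RS True by simp
  next
    case False
    have "realizable (K - R) (L - S) m a"
    proof (rule less.hyps)
      show "card (L - S) < card L" using fin jS by (intro psubset_card_mono) auto
      show "interchangeable_columns (K - R) (L - S) m a" using C unfolding interchangeable_columns_def by blast
      show "\<exists>k\<in>K - R. 0 < a k l" if "l \<in> L - S" for l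
        using cols[of l] z1[OF _ that] that by fastforce
      show "\<exists>l\<in>L - S. 0 < a k l" if "k \<in> K - R" for k
        using rows[of k] z2[OF that] that by fastforce
    qed (use fin False jS m in auto)
    from realizable_sum[OF RS this] z1 z2 have "realizable (R \<union> (K - R)) (S \<union> (L - S)) m a" by blast
    moreover have "R \<union> (K - R) = K" "S \<union> (L - S) = L" using jS iR by auto
    ultimately show ?thesis by simp
  qed
qed

text \<open>Regularity passes to the standard form and makes its columns interchangeable. The
  generated inclusion has the same coordinates in another basis order.\<close>

lemma regular_imp_generated:
  assumes inc: "unital_inclusion N B A" and reg: "regular_inclusion N B A"
  shows "\<exists>N' B' A'. generated_inclusion N' B' A' \<and> inclusion_iso B A B' A'"
proof -
  obtain N0 d s r m a \<theta> where ci: "coord_inclusion N0 d {..<s} {..<r} m a"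
    and \<theta>: "star_iso \<theta> A (labelled_alg N0 d big_pattern)" "\<theta> ` B = labelled_alg N0 d small_pattern"
    and s: "0 < s" and rows: "\<And>i. i < s \<Longrightarrow> \<exists>j<r. 0 < a i j"
    using inclusion_standard_form[OF inc] by metis
  interpret c: coord_inclusion N0 d "{..<s}" "{..<r}" m a by (rule ci)
  have A: "unital_star_subalgebra N A" and BA: "B \<subseteq> A"
    using inc by (auto simp: unital_inclusion_def fd_von_neumann_algebra_def)
  have "regular_inclusion N0 c.smallB c.bigA"
    using regular_inclusion_star_iso[OF \<theta>(1)[folded c.bigA_def] A c.bigA_subalgebra BA reg]
    unfolding \<theta>(2) c.smallB_def .
  then have C: "interchangeable_columns {..<s} {..<r} m a" by (rule c.regular_imp_interchangeable)
  have "r \<noteq> 0" using rows[OF s] by auto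
  then have "realizable {..<s} {..<r} m a"
    by (intro realizable_interchangeable[OF _ _ _ C] c.m_pos c.col_nonzero) (use rows in \<open>auto simp: Bex_def\<close>)
  then obtain N' d' where d': "bij_betw d' {..<N'} (coords {..<s} {..<r} m a)"
    and g: "generated_inclusion N' (labelled_alg N' d' small_pattern) (labelled_alg N' d' big_pattern)"
    by (auto simp: realizable_def)
  obtain \<theta>' where \<theta>': "star_iso \<theta>' (labelled_alg N0 d big_pattern) (labelled_alg N' d' big_pattern)"
    "\<theta>' ` labelled_alg N0 d small_pattern = labelled_alg N' d' small_pattern"
    using relabelling_inclusion_iso[OF c.bij d'] unfolding inclusion_iso_def by blast
  have "inclusion_iso B A (labelled_alg N' d' small_pattern) (labelled_alg N' d' big_pattern)"
    unfolding inclusion_iso_def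
    using star_iso_trans[OF \<theta>(1) \<theta>'(1)] \<theta>(2) \<theta>'(2) by (metis image_comp)
  then show ?thesis using g by blast
qed

theorem theoremA:
  fixes N :: nat and A B :: "complex mat set"
  assumes "unital_inclusion N B A"
  shows "(\<forall>r m s n a. has_inclusion_matrix B A r m s n a \<longrightarrow>
            (regular_inclusion N B A \<longleftrightarrow>
               normalizer_matrix a \<and>
               (\<forall>i<s. \<forall>j\<in>row_support a i. \<forall>j'\<in>row_support a i. m j = m j'))) \<and>
         (regular_inclusion N B A \<longrightarrow>
            (\<exists>N' B' A'. generated_inclusion N' B' A' \<and> inclusion_iso B A B' A'))"
  using regular_iff_normalizer_matrix[OF assms] regular_imp_generated[OF assms] by blast

end
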